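(* Let $\{e^{-zA}\}_{z\in S_\theta}$ be a holomorphic contraction semigroup of semi-angle $\theta\in(0,\pi/2]$ on a Banach space $\mathfrak{X}$, with generator $A$. Let $B$ be the generator of a contraction semigroup on $\mathfrak{X}$. Suppose there exists $\alpha\in[0,1)$ such that $\mathrm{dom}(A^{\alpha})\subseteq \mathrm{dom}(B)$, and suppose $\mathrm{dom}(A^* )\subseteq\mathrm{dom}(B^* )$. Then there are constants $M_1,M_2,\tilde M_2,\eta>0$ such that for any $t\ge 0$ and any integer $n>2$: $$\left\|\left(e^{-tB/n}e^{-tA/n}\right)^n-e^{-t(A+B)}\right\|\le e^{\eta t}\,(M_1+M_2\,t^{1-\alpha})\,\frac{\ln n}{n^{1-\alpha}}\qquad\text{if }\alpha>0,$$ $$\left\|\left(e^{-tB/n}e^{-tA/n}\right)^n-e^{-t(A+B)}\right\|\le e^{\eta t}\,(M_1+\tilde M_2\,t)\,\frac{2(\ln n)^2}{n}\qquad\text{if }\alpha=0.$$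
   Context: Sign convention: the generator $A$ of a strongly continuous semigroup $\{U(t)\}_{t\ge0}$ is defined by $\lim_{t\to+0}(U(t)x-x)/t=-Ax$ for $x\in\mathrm{dom}(A)$, and one writes $U(t)=e^{-tA}$. A contraction semigroup is a $C_0$-semigroup with $\|e^{-tA}\|\le1$ for all $t\ge0$. For $0<\theta\le\pi/2$ let $S_\theta=\{z\in\mathbb{C}: z\ne0,\ |\arg z|<\theta\}$. A bounded holomorphic semigroup of semi-angle $\theta$ is a family $\{U(z)\}_{z\in S_\theta}$ of bounded operators with: (i) for each $0<\epsilon<\theta$, $\|U(z)\|\le M_\epsilon<\infty$ for $z\in S_{\theta-\epsilon}$; (ii) $U(z_1)U(z_2)=U(z_1+z_2)$ for $z_1,z_2\in S_\theta$; (iii) $z\mapsto U(z)$ is analytic on $S_\theta$; (iv) for $0<\epsilon<\theta$ and $x\in\mathfrak{X}$, $U(z)x\to x$ as $z\to0$ in $S_{\theta-\epsilon}$. It is a holomorphic contraction semigroup if moreover its restriction to $[0,\infty)$ is a contraction $C_0$-semigroup. Fractional powers: $A^0=\mathbb{1}$ (so $\mathrm{dom}(A^0)=\mathfrak{X}$), and for $0<\alpha<1$, $A^\alpha$ is the usual closed fractional power of the generator of a bounded semigroup, given on $\mathrm{dom}(A)$ by $A^\alpha x=\frac{1}{\Gamma(-\alpha)}\int_0^\infty \lambda^{-\alpha-1}(e^{-\lambda A}-\mathbb{1})x\,d\lambda$. $A^*,B^*$ are the adjoint operators in the dual space $\mathfrak{X}^*$. $A+B$ is the algebraic sum with domain $\mathrm{dom}(A)$;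 under the hypotheses it is the generator of a contraction semigroup, denoted $e^{-t(A+B)}$. $\|\cdot\|$ is the operator norm on $\mathfrak{X}$. *)

theory Defs
  imports "HOL-Analysis.Analysis"
begin

class complex_banach = banach +
  fixes scaleC :: "complex \<Rightarrow> 'a \<Rightarrow> 'a"  (infixr \<open>*\<^sub>C\<close> 75)
  assumes scaleC_add_right: "c *\<^sub>C (x + y) = c *\<^sub>C x + c *\<^sub>C y"
    and scaleC_add_left: "(c + d) *\<^sub>C x = c *\<^sub>C x + d *\<^sub>C x"
    and scaleC_scaleC: "c *\<^sub>C d *\<^sub>C x = (c * d) *\<^sub>C x"
    and scaleC_of_real: "complex_of_real r *\<^sub>C x = r *\<^sub>R x"
    and norm_scaleC: "norm (c *\<^sub>C x) = cmod c * norm x"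

instantiation complex :: complex_banach
begin

definition scaleC_complex :: "complex \<Rightarrow> complex \<Rightarrow> complex"
  where "scaleC_complex c x = c * x"

instance
  by standard
    (simp_all add: scaleC_complex_def algebra_simps norm_mult scaleR_conv_of_real)

end

text \<open>The operator norm of a bounded operator is \<open>onorm\<close>; it only depends on the
  norm, so the real and the complex operator norm coincide.\<close>

definition bounded_clinear :: "('a::complex_banach \<Rightarrow> 'b::complex_banach) \<Rightarrow> bool"
  where "bounded_clinear f \<longleftrightarrow> bounded_linear f \<and> (\<forall>c x. f (c *\<^sub>C x) = c *\<^sub>C f x)"

definition C0_semigroup :: "(real \<Rightarrow> 'a::complex_banach \<Rightarrow> 'a) \<Rightarrow> bool"
  where "C0_semigroup U \<longleftrightarrow>
    (\<forall>t\<ge>0. bounded_clinear (U t)) \<and>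
    U 0 = id \<and>
    (\<forall>s\<ge>0. \<forall>t\<ge>0. U (s + t) = U s \<circ> U t) \<and>
    (\<forall>x. ((\<lambda>t. U t x) \<longlongrightarrow> x) (at_right 0))"

definition contraction_semigroup :: "(real \<Rightarrow> 'a::complex_banach \<Rightarrow> 'a) \<Rightarrow> bool"
  where "contraction_semigroup U \<longleftrightarrow> C0_semigroup U \<and> (\<forall>t\<ge>0. onorm (U t) \<le> 1)"

text \<open>Unbounded operators are represented by their graphs, so that the domain of an operator
  \<open>A\<close> is \<open>Domain A\<close>. The sign convention for generators is \<open>U t = exp (- t A)\<close>.\<close>

definition generator :: "(real \<Rightarrow> 'a::complex_banach \<Rightarrow> 'a) \<Rightarrow> ('a \<times> 'a) set"
  where "generator U = {(x, y). ((\<lambda>t. (U t x - x) /\<^sub>R t) \<longlongrightarrow> - y) (at_right 0)}"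

definition op_sum :: "('a::complex_banach \<times> 'a) set \<Rightarrow> ('a \<times> 'a) set \<Rightarrow> ('a \<times> 'a) set"
  where "op_sum A B = {(x, y + z) | x y z. (x, y) \<in> A \<and> (x, z) \<in> B}"

text \<open>The dual space consists of the \<open>f :: 'a \<Rightarrow> complex\<close> with \<open>bounded_clinear f\<close>. The set
  below is the graph of an operator whenever \<open>A\<close> is densely defined, in particular for
  generators of strongly continuous semigroups.\<close>

definition adjoint_op ::
    "('a::complex_banach \<times> 'a) set \<Rightarrow> (('a \<Rightarrow> complex) \<times> ('a \<Rightarrow> complex)) set"
  where "adjoint_op A =
    {(f, g). bounded_clinear f \<and> bounded_clinear g \<and> (\<forall>(x, y)\<in>A. f y = g x)}"

definition sector :: "real \<Rightarrow> complex set"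
  where "sector \<theta> = {z. z \<noteq> 0 \<and> \<bar>Arg z\<bar> < \<theta>}"

text \<open>Complex differentiability with respect to the operator norm.\<close>

definition op_holomorphic_on ::
    "(complex \<Rightarrow> 'a::complex_banach \<Rightarrow> 'a) \<Rightarrow> complex set \<Rightarrow> bool"
  where "op_holomorphic_on U S \<longleftrightarrow>
    (\<forall>z\<in>S. \<exists>D. bounded_clinear D \<and>
      ((\<lambda>w. onorm (\<lambda>x. inverse (w - z) *\<^sub>C (U w x - U z x) - D x)) \<longlongrightarrow> 0) (at z within S))"

definition bounded_holomorphic_semigroup ::
    "real \<Rightarrow> (complex \<Rightarrow> 'a::complex_banach \<Rightarrow> 'a) \<Rightarrow> bool"
  where "bounded_holomorphic_semigroup \<theta> U \<longleftrightarrow>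
    0 < \<theta> \<and> \<theta> \<le> pi / 2 \<and>
    (\<forall>z\<in>sector \<theta>. bounded_clinear (U z)) \<and>
    (\<forall>\<epsilon>. 0 < \<epsilon> \<and> \<epsilon> < \<theta> \<longrightarrow> (\<exists>M. \<forall>z\<in>sector (\<theta> - \<epsilon>). onorm (U z) \<le> M)) \<and>
    (\<forall>z1\<in>sector \<theta>. \<forall>z2\<in>sector \<theta>. U z1 \<circ> U z2 = U (z1 + z2)) \<and>
    op_holomorphic_on U (sector \<theta>) \<and>
    (\<forall>\<epsilon> x. 0 < \<epsilon> \<and> \<epsilon> < \<theta> \<longrightarrow> ((\<lambda>z. U z x) \<longlongrightarrow> x) (at 0 within sector (\<theta> - \<epsilon>)))"

text \<open>The value at \<open>0\<close>, which lies outside the sector, is fixed to be the identity by the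
  condition on the restriction to \<open>[0, \<infinity>)\<close>.\<close>

definition holomorphic_contraction_semigroup ::
    "real \<Rightarrow> (complex \<Rightarrow> 'a::complex_banach \<Rightarrow> 'a) \<Rightarrow> bool"
  where "holomorphic_contraction_semigroup \<theta> U \<longleftrightarrow>
    bounded_holomorphic_semigroup \<theta> U \<and> contraction_semigroup (\<lambda>t. U (complex_of_real t))"

text \<open>The fractional power \<open>A\<^sup>\<alpha>\<close>, for \<open>0 \<le> \<alpha> < 1\<close>, of the generator \<open>A\<close> of the bounded
  semigroup \<open>U\<close>. For \<open>0 < \<alpha>\<close> it is Balakrishnan's closed operator: the closure of the operator
  given on the domain of \<open>A\<close> by the integral formula (that domain is a core of \<open>A\<^sup>\<alpha>\<close>).
  The gauge integral is used because the Bochner integral of the library requires a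
  separable space; for \<open>x\<close> in the domain of \<open>A\<close> the integrand is continuous and absolutely
  integrable, so both integrals agree.\<close>

definition frac_power ::
    "(real \<Rightarrow> 'a::complex_banach \<Rightarrow> 'a) \<Rightarrow> real \<Rightarrow> ('a \<times> 'a) set"
  where "frac_power U \<alpha> =
    (if \<alpha> = 0 then Id
     else closure {(x, (1 / Gamma (- \<alpha>)) *\<^sub>R I) | x I. x \<in> Domain (generator U) \<and>
       ((\<lambda>l. l powr (- \<alpha> - 1) *\<^sub>R (U l x - x)) has_integral I) {0<..}})"

end

theory Submission
  imports Defs "HOL-Complex_Analysis.Complex_Analysis" "HOL-Real_Asymp.Real_Asymp"
begin

text \<open>Write \<open>C = A + B\<close>, \<open>W(t) = e\<^sup>-\<^sup>t\<^sup>C\<close>, \<open>F(\<tau>) = e\<^sup>-\<^sup>\<tau>\<^sup>B e\<^sup>-\<^sup>\<tau>\<^sup>A\<close>, \<open>R = (1 + A)\<^sup>-\<^sup>1\<close> and \<open>\<tau> = t/n\<close>. In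
  \<open>F(\<tau>)\<^sup>n - W(\<tau>)\<^sup>n = \<Sum>\<^sub>k F(\<tau>)\<^bsup>n-1-k\<^esup> (F(\<tau>) - W(\<tau>)) W(\<tau>)\<^sup>k\<close> the difference is sandwiched between
  smoothing factors: \<open>R (F(\<tau>) - W(\<tau>)) R\<close> is of order \<open>\<tau>\<^sup>2\<close>, because \<open>B R\<close> is bounded (the domain of \<open>B\<close>
  contains that of \<open>A\<^sup>\<alpha>\<close>) and \<open>R B\<close> is bounded (the domain condition on the adjoints). On the right,
  \<open>A W(s)\<close> is of order \<open>1/s\<close>, since \<open>W\<close> inherits the smoothing of the holomorphic semigroup. On the left,
  expanding \<open>F(\<tau>)\<^sup>m\<close> around \<open>e\<^sup>-\<^sup>m\<^sup>\<tau>\<^sup>A\<close> bounds \<open>F(\<tau>)\<^sup>m (1 + A)\<close> by a multiple of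
  \<open>1/(m\<tau>) + \<tau>\<^sup>-\<^sup>\<alpha>\<close> (for \<open>\<alpha> = 0\<close> the second term carries a factor \<open>ln m\<close>). Summing over \<open>k\<close> gives
  the rate. The generation of \<open>W\<close> uses that \<open>B\<close> has \<open>A\<close>-bound zero. The closed graph arguments
  become instances of uniform boundedness, for \<open>(1 - e\<^sup>-\<^sup>h\<^sup>B)/h\<close> on the graph of \<open>A\<^sup>\<alpha>\<close> and on the dual space.\<close>

section \<open>Norming functionals and uniform boundedness\<close>

text \<open>One resolvent next to \<open>F(\<tau>) - W(\<tau>)\<close> gains one power of \<tau>,
  two gain \<tau>^2. With both, the main part of a summand is \<tau>^2 * 1/((n-1-k)\<tau>) *
  1/(k\<tau>), and partial fractions sum this to ln n / n. The obstacle is the left factor: powers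
  of \<open>F(\<tau>)\<close> form no semigroup and the semigroup of \<open>B\<close> has no
  smoothing, so all smoothing must come from the semigroup S of \<open>A\<close>. Each replacement
  costs (V(\<tau>) - 1) S(s) (1 + A), of order \<tau> * s^(-1-\<alpha>). These costs add up to
  \<tau>^(-\<alpha>) times a partial sum of j^(-1-\<alpha>), which lowers 1/n to n^(\<alpha>-1) and
  at \<alpha> = 0 brings in the second logarithm. The first and the last summand lack one smoothing
  factor and use a single resolvent. Bounds for an operator times 1 + A are stated as bounds by
  \<open>norm (R x)\<close>, so that no operator has to be extended from a domain. Smoothing of
  \<open>W\<close> is proved up to a fixed time only, so powers of 1 + t appear; three of them are
  absorbed in exp (3 * t), hence \<eta> = 3.\<close>

definition sublinear :: "('a::real_normed_vector \<Rightarrow> real) \<Rightarrow> bool"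
  where "sublinear q \<longleftrightarrow> (\<forall>x y. q (x + y) \<le> q x + q y) \<and> (\<forall>c x. 0 \<le> c \<longrightarrow> q (c *\<^sub>R x) = c * q x)"

text \<open>Lowers \<open>q\<close> along \<open>- a\<close>: the choice \<open>t = 1\<close> at
  \<open>y = - a\<close> gives at most \<open>- q a\<close>, the value at \<open>- a\<close> of a
  linear functional that agrees with \<open>q\<close> at \<open>a\<close>.\<close>

definition sublinear_reduct :: "('a::real_normed_vector \<Rightarrow> real) \<Rightarrow> 'a \<Rightarrow> 'a \<Rightarrow> real"
  where "sublinear_reduct q a y = (INF t\<in>{0..}. q (y + t *\<^sub>R a) - t * q a)"

lemma sublinear_add: "sublinear q \<Longrightarrow> q (x + y) \<le> q x + q y"
  and sublinear_scale: "sublinear q \<Longrightarrow> 0 \<le> c \<Longrightarrow> q (c *\<^sub>R x) = c * q x"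
  by (auto simp: sublinear_def)

lemma sublinear_zero: "sublinear q \<Longrightarrow> q 0 = 0"
  using sublinear_scale[of q 0 0] by simp

lemma sublinear_minus: assumes "sublinear q" shows "- q (- x) \<le> q x"
  using sublinear_add[OF assms, of x "-x"] sublinear_zero[OF assms] by simp

text \<open>A real infimum carries information only on a set bounded below; subadditivity supplies
  the bound \<open>- q (- y)\<close>, which does not depend on \<open>t\<close>.\<close>

lemma sublinear_reduct_bdd:
  assumes "sublinear q"
  shows "bdd_below ((\<lambda>t. q (y + t *\<^sub>R a) - t * q a) ` {0..})"
proof (rule bdd_belowI2)
  fix t :: real assume "t \<in> {0..}"
  then have "t * q a = q ((y + t *\<^sub>R a) + (- y))"
    using sublinear_scale[OF assms, of t a] by simp
  also have "\<dots> \<le> q (y + t *\<^sub>R a) + q (- y)" by (rule sublinear_add[OF assms])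
  finally show "- q (- y) \<le> q (y + t *\<^sub>R a) - t * q a" by simp
qed

lemma sublinear_reduct_le:
  assumes "sublinear q" "0 \<le> t"
  shows "sublinear_reduct q a y \<le> q (y + t *\<^sub>R a) - t * q a"
  unfolding sublinear_reduct_def
  by (rule cINF_lower[OF sublinear_reduct_bdd[OF assms(1)]]) (use assms in auto)

lemma sublinear_sublinear_reduct:
  assumes q: "sublinear q" shows "sublinear (sublinear_reduct q a)"
proof -
  let ?r = "sublinear_reduct q a"
  have ge: "m \<le> ?r y" if "\<And>t. 0 \<le> t \<Longrightarrow> m \<le> q (y + t *\<^sub>R a) - t * q a" for m y
    unfolding sublinear_reduct_def by (rule cINF_greatest) (use that in auto)
  have add: "?r (x + y) \<le> ?r x + ?r y" for x y
  proof -
    have "?r (x + y) - ?r y \<le> q (x + s *\<^sub>R a) - s * q a" if s: "0 \<le> s" for s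
    proof -
      have "?r (x + y) - (q (x + s *\<^sub>R a) - s * q a) \<le> ?r y"
      proof (rule ge)
        fix t :: real assume t: "0 \<le> t"
        have "?r (x + y) \<le> q ((x + y) + (s + t) *\<^sub>R a) - (s + t) * q a"
          by (rule sublinear_reduct_le[OF q]) (use s t in auto)
        also have "(x + y) + (s + t) *\<^sub>R a = (x + s *\<^sub>R a) + (y + t *\<^sub>R a)"
          by (simp add: algebra_simps)
        finally show "?r (x + y) - (q (x + s *\<^sub>R a) - s * q a) \<le> q (y + t *\<^sub>R a) - t * q a"
          using sublinear_add[OF q, of "x + s *\<^sub>R a" "y + t *\<^sub>R a"] by (simp add: algebra_simps)
      qed
      then show ?thesis by simp
    qed
    then have "?r (x + y) - ?r y \<le> ?r x" by (rule ge)
    then show ?thesis by simp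
  qed
  have le: "?r (c *\<^sub>R x) \<le> c * ?r x" if c: "0 < c" for c x
  proof -
    have "?r (c *\<^sub>R x) / c \<le> ?r x"
    proof (rule ge)
      fix t :: real assume t: "0 \<le> t"
      have "?r (c *\<^sub>R x) \<le> q (c *\<^sub>R x + (c * t) *\<^sub>R a) - (c * t) * q a"
        by (rule sublinear_reduct_le[OF q]) (use c t in auto)
      also have "c *\<^sub>R x + (c * t) *\<^sub>R a = c *\<^sub>R (x + t *\<^sub>R a)" by (simp add: algebra_simps)
      also have "q \<dots> = c * q (x + t *\<^sub>R a)" using sublinear_scale[OF q] c by simp
      finally show "?r (c *\<^sub>R x) / c \<le> q (x + t *\<^sub>R a) - t * q a"
        using c by (simp add: field_simps)
    qed
    then show ?thesis using c by (simp add: field_simps)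
  qed
  have eq: "?r (c *\<^sub>R x) = c * ?r x" if c: "0 \<le> c" for c x
  proof (cases "c = 0")
    case True
    have "0 \<le> ?r 0" by (rule ge) (use sublinear_scale[OF q] in auto)
    moreover have "?r 0 \<le> 0" using sublinear_reduct_le[OF q, of 0 a 0] sublinear_zero[OF q] by simp
    ultimately show ?thesis using True by simp
  next
    case False
    then have c: "0 < c" using c by simp
    from le[of "inverse c" "c *\<^sub>R x"] c have "?r x \<le> inverse c * ?r (c *\<^sub>R x)" by simp
    then have "c * ?r x \<le> ?r (c *\<^sub>R x)" using c by (simp add: field_simps)
    with le[OF c, of x] show ?thesis by simp
  qed
  show ?thesis unfolding sublinear_def using add eq by blast
qed

text \<open>Zorn's lemma, with chains bounded by their pointwise infimum. The infimum stays
  subadditive because of two members of a chain one lies below both, and it is finite because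
  \<open>- p (- x)\<close> bounds every sublinear minorant of \<open>p\<close> from below.\<close>

lemma sublinear_minimal_below:
  fixes p :: "'a::real_normed_vector \<Rightarrow> real"
  assumes p: "sublinear p"
  shows "\<exists>q. sublinear q \<and> q \<le> p \<and> (\<forall>r. sublinear r \<and> r \<le> q \<longrightarrow> r = q)"
proof -
  define S where "S = {q. sublinear q \<and> q \<le> p}"
  let ?P = "\<lambda>q r :: 'a \<Rightarrow> real. r \<le> q"
  have "\<exists>m\<in>S. \<forall>q\<in>S. ?P m q \<longrightarrow> q = m"
  proof (rule predicate_Zorn)
    show "partial_order_on S (relation_of ?P S)"
      by (rule partial_order_on_relation_ofI) auto
  next
    fix C assume C: "C \<in> Chains (relation_of ?P S)"
    have CS: "C \<subseteq> S" using C by (auto simp: Chains_def relation_of_def)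
    have chain: "q \<le> r \<or> r \<le> q" if "q \<in> C" "r \<in> C" for q r
      using C that by (auto simp: Chains_def relation_of_def)
    show "\<exists>u\<in>S. \<forall>q\<in>C. u \<le> q"
    proof (cases "C = {}")
      case True then show ?thesis using p by (auto simp: S_def)
    next
      case False
      define u where "u x = (INF q\<in>C. q x)" for x
      have bdd: "bdd_below ((\<lambda>q. q x) ` C)" for x
      proof (rule bdd_belowI2)
        fix q assume "q \<in> C"
        then have q: "sublinear q" "q \<le> p" using CS by (auto simp: S_def)
        show "- p (- x) \<le> q x"
          using sublinear_minus[OF q(1), of x] le_funD[OF q(2), of "- x"] by linarith
      qed
      have low: "u x \<le> q x" if "q \<in> C" for q x
        unfolding u_def by (rule cINF_lower[OF bdd that])
      have gr: "m \<le> u x" if "\<And>q. q \<in> C \<Longrightarrow> m \<le> q x" for m x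
        unfolding u_def by (rule cINF_greatest[OF False that])
      have add: "u (x + y) \<le> u x + u y" for x y
      proof -
        have "u (x + y) - u y \<le> u x"
        proof (rule gr)
          fix q assume q: "q \<in> C"
          have "u (x + y) - q x \<le> u y"
          proof (rule gr)
            fix r assume r: "r \<in> C"
            obtain w where w: "w \<in> C" "w \<le> q" "w \<le> r" using chain[OF q r] q r by blast
            have "u (x + y) \<le> w (x + y)" by (rule low[OF w(1)])
            also have "\<dots> \<le> w x + w y" using w(1) CS by (intro sublinear_add) (auto simp: S_def)
            also have "\<dots> \<le> q x + r y" using w by (auto simp: le_fun_def intro!: add_mono)
            finally show "u (x + y) - q x \<le> r y" by simp
          qed
          then show "u (x + y) - u y \<le> q x" by simp
        qed
        then show ?thesis by simp
      qed
      have sc: "u (c *\<^sub>R x) = c * u x" if c: "0 \<le> c" for c x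
      proof (cases "c = 0")
        case True
        have z: "q 0 = 0" if "q \<in> C" for q using that CS sublinear_zero by (auto simp: S_def)
        obtain q where "q \<in> C" using False by blast
        then have "u 0 = 0" using low[of q 0] gr[of 0 0] z by fastforce
        then show ?thesis using True by simp
      next
        case False
        then have c: "0 < c" using c by simp
        have qc: "q (c *\<^sub>R x) = c * q x" if "q \<in> C" for q
          using that CS c by (intro sublinear_scale) (auto simp: S_def)
        have "u (c *\<^sub>R x) / c \<le> u x"
          by (rule gr) (use low qc c in \<open>fastforce simp: field_simps\<close>)
        moreover have "c * u x \<le> u (c *\<^sub>R x)"
          proof (rule gr)
          fix q assume q: "q \<in> C"
          have "c * u x \<le> c * q x" using low[OF q, of x] c by (intro mult_left_mono) auto
          then show "c * u x \<le> q (c *\<^sub>R x)" using qc[OF q] by simp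
        qed
        ultimately show ?thesis using c by (simp add: field_simps)
      qed
      have "u \<le> p"
      proof (rule le_funI)
        fix x
        obtain q where q: "q \<in> C" using False by blast
        then have "q \<le> p" using CS by (auto simp: S_def)
        then have "q x \<le> p x" by (rule le_funD)
        with low[OF q, of x] show "u x \<le> p x" by linarith
      qed
      then have "u \<in> S" using add sc by (auto simp: S_def sublinear_def)
      then show ?thesis using low by (auto simp: le_fun_def)
    qed
  qed
  then obtain m where m: "m \<in> S" and min: "\<And>q. q \<in> S \<Longrightarrow> q \<le> m \<Longrightarrow> q = m" by blast
  show ?thesis
    by (rule exI[of _ m]) (use m min in \<open>auto simp: S_def intro: order_trans\<close>)
qed

text \<open>Minimality forces \<open>q\<close> to agree with all its reducts, and the reduct in direction \<open>a\<close> satisfies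
  \<open>r (- a) \<le> - q a\<close>. Zorn's lemma on sublinear functionals thus replaces the extension argument of
  the Hahn-Banach theorem.\<close>

lemma sublinear_minimal_linear:
  assumes q: "sublinear q" and min: "\<And>r. sublinear r \<Longrightarrow> r \<le> q \<Longrightarrow> r = q"
  shows "linear q"
proof -
  have red: "sublinear_reduct q a = q" for a
  proof (rule min[OF sublinear_sublinear_reduct[OF q]])
    show "sublinear_reduct q a \<le> q"
      using sublinear_reduct_le[OF q, of 0 a] by (simp add: le_fun_def)
  qed
  have neg: "q (- a) = - q a" for a
  proof -
    have "q (- a) \<le> - q a"
      using sublinear_reduct_le[OF q, of 1 a "- a"] sublinear_zero[OF q] by (simp add: red)
    then show ?thesis using sublinear_minus[OF q, of a] by simp
  qed
  show ?thesis
  proof (rule linearI)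
    fix x y
    have "q x \<le> q (x + y) + q (- y)" using sublinear_add[OF q, of "x + y" "- y"] by simp
    then show "q (x + y) = q x + q y" using sublinear_add[OF q, of x y] neg[of y] by simp
  next
    fix c x
    show "q (c *\<^sub>R x) = c *\<^sub>R q x"
    proof (cases "0 \<le> c")
      case True then show ?thesis using sublinear_scale[OF q] by simp
    next
      case False
      then have "q ((- c) *\<^sub>R (- x)) = (- c) * q (- x)" using sublinear_scale[OF q, of "- c" "- x"] by simp
      then show ?thesis using neg[of x] by simp
    qed
  qed
qed

text \<open>A minimal functional is taken below the reduct of the norm in direction
  \<open>x\<close>, not below the norm itself: the reduct forces
  \<open>q (- x) \<le> - norm x\<close>, and linearity turns this into the value at
  \<open>x\<close>.\<close>

lemma norming_functional:
  fixes x :: "'a::real_normed_vector"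
  shows "\<exists>u. bounded_linear u \<and> (\<forall>y. \<bar>u y\<bar> \<le> norm y) \<and> u x = norm x"
proof -
  have n: "sublinear (norm :: 'a \<Rightarrow> real)"
    by (auto simp: sublinear_def norm_triangle_ineq)
  let ?p = "sublinear_reduct norm x"
  have p: "sublinear ?p" by (rule sublinear_sublinear_reduct[OF n])
  obtain q where q: "sublinear q" "q \<le> ?p" and min: "\<And>r. sublinear r \<Longrightarrow> r \<le> q \<Longrightarrow> r = q"
    using sublinear_minimal_below[OF p] by blast
  have lin: "linear q" by (rule sublinear_minimal_linear[OF q(1) min])
  have le: "q y \<le> norm y" for y
    using le_funD[OF q(2), of y] sublinear_reduct_le[OF n, of 0 x y] by simp
  have neg: "q (- y) = - q y" for y using lin linear_neg by blast
  have abs: "\<bar>q y\<bar> \<le> norm y" for y using le[of y] le[of "- y"] neg[of y] by auto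
  have "q (- x) \<le> - norm x"
    using le_funD[OF q(2), of "- x"] sublinear_reduct_le[OF n, of 1 x "- x"] by simp
  then have "q x = norm x" using neg[of x] le[of x] by simp
  moreover have "bounded_linear q"
    using lin abs by (intro bounded_linear_intro[where K = 1]) (auto simp: linear_add linear_cmul)
  ultimately show ?thesis using abs by blast
qed

text \<open>A closed subspace \<open>G\<close> takes the place of the whole space because one
  application is to a graph inside a product space. Baire's theorem is therefore applied in the
  subspace topology.\<close>

lemma uniform_boundedness:
  fixes T :: "'i \<Rightarrow> 'b::banach \<Rightarrow> 'c::real_normed_vector"
  assumes G: "closed G" "subspace G"
    and T: "\<And>i. i \<in> I \<Longrightarrow> bounded_linear (T i)"
    and pw: "\<And>x. x \<in> G \<Longrightarrow> \<exists>M. \<forall>i\<in>I. norm (T i x) \<le> M"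
  shows "\<exists>C\<ge>0. \<forall>i\<in>I. \<forall>x\<in>G. norm (T i x) \<le> C * norm x"
proof -
  define E where "E n = {x \<in> G. \<forall>i\<in>I. norm (T i x) \<le> real n}" for n :: nat
  have clE: "closedin (top_of_set G) (E n)" for n
  proof -
    have "E n = G \<inter> (\<Inter>i\<in>I. {x. norm (T i x) \<le> real n})" by (auto simp: E_def)
    moreover have "closed (\<Inter>i\<in>I. {x. norm (T i x) \<le> real n})"
      using T by (intro closed_INT ballI closed_Collect_le continuous_intros
          linear_continuous_on) (auto intro: bounded_linear.continuous_on)
    ultimately show ?thesis by (metis closedin_closed_Int)
  qed
  have un: "(\<Union>n. E n) = G"
  proof
    show "G \<subseteq> (\<Union>n. E n)"
    proof
      fix x assume x: "x \<in> G"
      obtain M where M: "\<forall>i\<in>I. norm (T i x) \<le> M" using pw[OF x] by blast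
      obtain n :: nat where "M \<le> real n" using real_arch_simple by blast
      then have "x \<in> E n" using M x by (force simp: E_def)
      then show "x \<in> (\<Union>n. E n)" by blast
    qed
  qed (auto simp: E_def)
  have cm: "completely_metrizable_space (top_of_set G)"
    by (rule completely_metrizable_space_closedin) (use G in \<open>auto simp: completely_metrizable_space_euclidean\<close>)
  have G0: "0 \<in> G" using G(2) subspace_0 by blast
  have "\<exists>n. (top_of_set G) interior_of (E n) \<noteq> {}"
  proof (rule ccontr)
    assume "\<not> ?thesis"
    then have "(top_of_set G) interior_of (\<Union>(range E)) = {}"
      using clE cm by (intro Baire_category_alt) auto
    then show False using un G0 interior_of_topspace[of "top_of_set G"] by auto
  qed
  then obtain n x0 where x0: "x0 \<in> (top_of_set G) interior_of (E n)" by blast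
  then obtain S where S: "open S" "x0 \<in> S" "G \<inter> S \<subseteq> E n" "x0 \<in> G"
    by (auto simp: interior_of_def openin_open)
  obtain r where r: "r > 0" "cball x0 r \<subseteq> S" using S open_contains_cball by blast
  \<comment> \<open>Moving from \<open>x0\<close> by a vector of \<open>G\<close> of length
    \<open>r\<close> stays in \<open>E n\<close>; the increment is a difference of two values of
    norm at most \<open>n\<close>, hence \<open>2 * n / r\<close>.\<close>
  have bd: "norm (T i x) \<le> (2 * real n / r) * norm x" if i: "i \<in> I" and x: "x \<in> G" for i x
  proof (cases "x = 0")
    case True then show ?thesis using linear_0[OF bounded_linear.linear[OF T[OF i]]] by simp
  next
    case False
    let ?c = "r / norm x"
    have "x0 + ?c *\<^sub>R x \<in> G" using S x G(2) by (intro subspace_add subspace_scale)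
    moreover have "x0 + ?c *\<^sub>R x \<in> cball x0 r" using False r by (simp add: dist_norm)
    ultimately have 1: "x0 + ?c *\<^sub>R x \<in> E n" using S r by blast
    have 2: "x0 \<in> E n" using S by blast
    interpret bounded_linear "T i" by (rule T[OF i])
    have "?c *\<^sub>R T i x = T i (x0 + ?c *\<^sub>R x) - T i x0" by (simp add: add scaleR)
    then have "norm (?c *\<^sub>R T i x) \<le> norm (T i (x0 + ?c *\<^sub>R x)) + norm (T i x0)"
      by (simp add: norm_triangle_ineq4)
    also have "\<dots> \<le> real n + real n" using 1 2 i by (intro add_mono) (auto simp: E_def)
    finally show ?thesis using False r by (simp add: field_simps)
  qed
  show ?thesis
    by (rule exI[of _ "2 * real n / r"]) (use bd r in auto)
qed

section \<open>Contraction semigroups and their generators\<close>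

lemma bounded_linear_scaleC: "bounded_linear (\<lambda>x::'a::complex_banach. c *\<^sub>C x)"
proof (rule bounded_linear_intro[where K = "cmod c"])
  fix r :: real and x y :: 'a
  show "c *\<^sub>C (x + y) = c *\<^sub>C x + c *\<^sub>C y" by (rule scaleC_add_right)
  show "c *\<^sub>C (r *\<^sub>R x) = r *\<^sub>R (c *\<^sub>C x)"
    by (metis scaleC_of_real scaleC_scaleC mult.commute)
  show "norm (c *\<^sub>C x) \<le> norm x * cmod c" by (simp add: norm_scaleC)
qed

locale contraction_sg =
  fixes S :: "real \<Rightarrow> 'a::complex_banach \<Rightarrow> 'a"
  assumes contr: "contraction_semigroup S"
begin

lemma bdd_clinear: "0 \<le> t \<Longrightarrow> bounded_clinear (S t)"
  using contr by (auto simp: contraction_semigroup_def C0_semigroup_def)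

lemma bdd_linear: "0 \<le> t \<Longrightarrow> bounded_linear (S t)"
  using bdd_clinear by (auto simp: bounded_clinear_def)

lemma linear_simps:
  assumes "0 \<le> t"
  shows "S t (x + y) = S t x + S t y" "S t (x - y) = S t x - S t y" "S t (- x) = - S t x"
    "S t (r *\<^sub>R x) = r *\<^sub>R S t x" "S t (c *\<^sub>C x) = c *\<^sub>C S t x" "S t 0 = 0"
proof -
  interpret bounded_linear "S t" by (rule bdd_linear[OF assms])
  show "S t (x + y) = S t x + S t y" "S t (x - y) = S t x - S t y" "S t (- x) = - S t x"
    "S t (r *\<^sub>R x) = r *\<^sub>R S t x" "S t 0 = 0"
    by (auto simp: add diff neg scaleR zero)
  show "S t (c *\<^sub>C x) = c *\<^sub>C S t x"
    using bdd_clinear[OF assms] by (auto simp: bounded_clinear_def)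
qed

lemma norm_le: "0 \<le> t \<Longrightarrow> norm (S t x) \<le> norm x"
  using onorm[OF bdd_linear, of t x] contr
    mult_right_mono[of "onorm (S t)" 1 "norm x"]
  by (fastforce simp: contraction_semigroup_def)

lemma at_0 [simp]: "S 0 = id" "S 0 x = x"
  using contr by (auto simp: contraction_semigroup_def C0_semigroup_def)

lemma add: "0 \<le> s \<Longrightarrow> 0 \<le> t \<Longrightarrow> S (s + t) x = S s (S t x)"
  using contr by (auto simp: contraction_semigroup_def C0_semigroup_def)

lemma tendsto_0: "((\<lambda>t. S t x) \<longlongrightarrow> x) (at_right 0)"
  using contr by (auto simp: contraction_semigroup_def C0_semigroup_def)

lemma near_0: "0 < e \<Longrightarrow> \<exists>d>0. \<forall>h. 0 \<le> h \<longrightarrow> h < d \<longrightarrow> norm (S h x - x) < e"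
proof -
  assume e: "0 < e"
  from tendstoD[OF tendsto_0 e, of x] obtain d where d: "0 < d" "\<forall>h. 0 < h \<longrightarrow> h < d \<longrightarrow> dist (S h x) x < e"
    by (auto simp: eventually_at_right_field)
  have "norm (S h x - x) < e" if "0 \<le> h" "h < d" for h
    using that d(2) e by (cases "h = 0") (auto simp: dist_norm)
  then show ?thesis using d(1) by blast
qed

text \<open>Factoring out the operator at the earlier time leaves an increment at time zero, so
  strong continuity at zero gives a modulus of continuity uniform in time.\<close>

lemma diff_le: 
  assumes "0 \<le> s" "0 \<le> t" shows "norm (S t x - S s x) \<le> norm (S \<bar>t - s\<bar> x - x)"
proof -
  have *: "norm (S t x - S s x) \<le> norm (S (t - s) x - x)" if "0 \<le> s" "s \<le> t" for s t
  proof -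
    have "S t x - S s x = S s (S (t - s) x - x)"
      using that add[of s "t - s" x] by (simp add: linear_simps)
    then show ?thesis using norm_le that by simp
  qed
  show ?thesis
  proof (cases "s \<le> t")
    case True then show ?thesis using * assms by simp
  next
    case False then show ?thesis using *[of t s] assms by (simp add: norm_minus_commute)
  qed
qed

lemma cont: "continuous_on {0..} (\<lambda>t. S t x)"
  unfolding continuous_on_iff
proof (intro ballI allI impI)
  fix t e :: real assume t: "t \<in> {0..}" and e: "0 < e"
  obtain d where d: "0 < d" "\<And>h. 0 \<le> h \<Longrightarrow> h < d \<Longrightarrow> norm (S h x - x) < e"
    using near_0[OF e] by blast
  show "\<exists>d>0. \<forall>s\<in>{0..}. dist s t < d \<longrightarrow> dist (S s x) (S t x) < e"
  proof (intro exI[of _ d] conjI d ballI impI)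
    fix s :: real assume s: "s \<in> {0..}" and "dist s t < d"
    then have "norm (S \<bar>s - t\<bar> x - x) < e" by (intro d) (auto simp: dist_real_def)
    then show "dist (S s x) (S t x) < e" using diff_le[of t s x] t s by (auto simp: dist_norm)
  qed
qed

definition G where "G = generator S"

text \<open>The difference quotient without division: in this form error terms can be added and sent
  through contractions.\<close>

lemma G_iff_eps:
  "(x, y) \<in> G \<longleftrightarrow> (\<forall>e>0. \<exists>d>0. \<forall>h. 0 < h \<longrightarrow> h < d \<longrightarrow> norm (S h x - x + h *\<^sub>R y) \<le> e * h)"
  (is "_ \<longleftrightarrow> ?R")
proof -
  have eq: "norm (S h x - x + h *\<^sub>R y) = h * dist ((S h x - x) /\<^sub>R h) (- y)" if "0 < h" for h
  proof -
    have "S h x - x + h *\<^sub>R y = h *\<^sub>R ((S h x - x) /\<^sub>R h - (- y))"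
      using that by (simp add: algebra_simps)
    then show ?thesis using that by (metis abs_of_pos dist_norm norm_scaleR)
  qed
  have "(x, y) \<in> G \<longleftrightarrow> (\<forall>e>0. \<exists>d>0. \<forall>h. 0 < h \<longrightarrow> h < d \<longrightarrow> dist ((S h x - x) /\<^sub>R h) (- y) < e)"
    by (auto simp: G_def generator_def tendsto_iff eventually_at_right_field)
  also have "\<dots> \<longleftrightarrow> ?R"
  proof (intro iffI allI impI)
    fix e :: real assume H: "\<forall>e>0. \<exists>d>0. \<forall>h. 0 < h \<longrightarrow> h < d \<longrightarrow> dist ((S h x - x) /\<^sub>R h) (- y) < e" and e: "0 < e"
    obtain d where "0 < d" "\<forall>h. 0 < h \<longrightarrow> h < d \<longrightarrow> dist ((S h x - x) /\<^sub>R h) (- y) < e"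
      using H e by blast
    then show "\<exists>d>0. \<forall>h. 0 < h \<longrightarrow> h < d \<longrightarrow> norm (S h x - x + h *\<^sub>R y) \<le> e * h"
      by (intro exI[of _ d]) (auto simp: eq mult.commute intro!: mult_mono less_imp_le)
  next
    fix e :: real assume H: ?R and e: "0 < e"
    \<comment> \<open>Half of \<open>e\<close>, because the non-strict bound has to yield a strict
      one.\<close>
    obtain d where d: "0 < d" "\<And>h. 0 < h \<Longrightarrow> h < d \<Longrightarrow> norm (S h x - x + h *\<^sub>R y) \<le> (e/2) * h"
      using H e by (metis half_gt_zero)
    have "dist ((S h x - x) /\<^sub>R h) (- y) < e" if h: "0 < h" "h < d" for h
    proof -
      have "h * dist ((S h x - x) /\<^sub>R h) (- y) \<le> h * (e/2)" using d(2)[OF h] h by (simp add: eq mult.commute)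
      then have "dist ((S h x - x) /\<^sub>R h) (- y) \<le> e/2" using h by (simp only: mult_le_cancel_left_pos)
      then show ?thesis using e by linarith
    qed
    then show "\<exists>d>0. \<forall>h. 0 < h \<longrightarrow> h < d \<longrightarrow> dist ((S h x - x) /\<^sub>R h) (- y) < e" using d(1) by blast
  qed
  finally show ?thesis .
qed

lemma G_if_deriv:
  assumes "((\<lambda>t. S t x) has_vector_derivative - y) (at 0 within {0..})"
  shows "(x, y) \<in> G"
  unfolding G_iff_eps
proof (intro allI impI)
  fix e :: real assume e: "0 < e"
  obtain d where d: "0 < d" "\<forall>h\<in>{0..}. norm (h - 0) < d \<longrightarrow>
      norm (S h x - S 0 x - (h - 0) *\<^sub>R (- y)) \<le> e * norm (h - 0)"
    using assms e unfolding has_vector_derivative_def has_derivative_within_alt by meson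
  show "\<exists>d>0. \<forall>h. 0 < h \<longrightarrow> h < d \<longrightarrow> norm (S h x - x + h *\<^sub>R y) \<le> e * h"
    using d by (intro exI[of _ d]) force
qed

lemma deriv:
  assumes xy: "(x, y) \<in> G" and t: "0 \<le> t"
  shows "((\<lambda>t. S t x) has_vector_derivative - S t y) (at t within {0..})"
  unfolding has_vector_derivative_def has_derivative_within_alt
proof (intro conjI allI impI)
  fix e :: real assume e: "0 < e"
  then have e2: "0 < e / 2" by simp
  obtain d1 where d1: "0 < d1" "\<And>h. 0 < h \<Longrightarrow> h < d1 \<Longrightarrow> norm (S h x - x + h *\<^sub>R y) \<le> e / 2 * h"
    using xy e2 unfolding G_iff_eps by meson
  obtain d2 where d2: "0 < d2" "\<And>h. 0 \<le> h \<Longrightarrow> h < d2 \<Longrightarrow> norm (S h y - y) < e / 2"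
    using near_0[OF e2] by blast
  show "\<exists>d>0. \<forall>s\<in>{0..}. norm (s - t) < d \<longrightarrow>
      norm (S s x - S t x - (s - t) *\<^sub>R (- S t y)) \<le> e * norm (s - t)"
  proof (intro exI[of _ "min d1 d2"] conjI ballI impI)
    fix s :: real assume s: "s \<in> {0..}" and st: "norm (s - t) < min d1 d2"
    consider "s = t" | "t < s" | "s < t" by linarith
    then show "norm (S s x - S t x - (s - t) *\<^sub>R (- S t y)) \<le> e * norm (s - t)"
    proof cases
      case 1 then show ?thesis by simp
    next
      case 2
      define h where "h = s - t"
      have h: "0 < h" "h < d1" "h < d2" "s = t + h" using 2 st by (auto simp: h_def)
      have "S s x - S t x - (s - t) *\<^sub>R (- S t y) = S t (S h x - x + h *\<^sub>R y)"
        using h t add[of t h x] by (simp add: linear_simps)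
      then have "norm (S s x - S t x - (s - t) *\<^sub>R (- S t y)) \<le> norm (S h x - x + h *\<^sub>R y)"
        using norm_le t by simp
      also have "\<dots> \<le> e / 2 * h" using d1 h by blast
      also have "\<dots> \<le> e * h" using e h by simp
      finally show ?thesis using h by simp
    next
      case 3
      define h where "h = t - s"
      have h: "0 < h" "h < d1" "h < d2" "t = s + h" using 3 st by (auto simp: h_def)
      have s0: "0 \<le> s" using s by simp
      \<comment> \<open>Factoring out the earlier time \<open>s\<close> puts \<open>S h y\<close> in
        place of \<open>y\<close>; the correction \<open>h (S h y - y)\<close> is again small by
        strong continuity.\<close>
      have "S s x - S t x - (s - t) *\<^sub>R (- S t y) = S s (- (S h x - x + h *\<^sub>R y) - h *\<^sub>R (S h y - y))"
        using h s0 add[of s h x] add[of s h y] by (simp add: linear_simps algebra_simps)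
      then have "norm (S s x - S t x - (s - t) *\<^sub>R (- S t y))
          \<le> norm (- (S h x - x + h *\<^sub>R y) - h *\<^sub>R (S h y - y))"
        using norm_le s0 by simp
      also have "\<dots> \<le> norm (S h x - x + h *\<^sub>R y) + h * norm (S h y - y)"
        using norm_triangle_ineq4[of "- (S h x - x + h *\<^sub>R y)" "h *\<^sub>R (S h y - y)"] h
        by (simp only: norm_minus_cancel norm_scaleR abs_of_pos)
      also have "\<dots> \<le> e / 2 * h + h * (e / 2)"
        using d1(2)[of h] d2(2)[of h] h by (intro add_mono mult_left_mono) auto
      also have "\<dots> = e * norm (s - t)" using h by simp
      finally show ?thesis .
    qed
  qed (use d1 d2 in auto)
qed (rule bounded_linear_scaleR_left)

lemma deriv_at:
  assumes "(x, y) \<in> G" "0 < t"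
  shows "((\<lambda>t. S t x) has_vector_derivative - S t y) (at t)"
proof -
  have "at t within {0..} = at t" using assms by (intro at_within_interior) auto
  then show ?thesis using deriv[of x y t] assms by simp
qed

lemma G_unique: assumes "(x, y) \<in> G" "(x, y') \<in> G" shows "y = y'"
proof -
  have "- y = - y'"
    using assms unfolding G_def generator_def mem_Collect_eq case_prod_conv
    by (rule tendsto_unique[OF trivial_limit_at_right_real])
  then show ?thesis by simp
qed

lemma G_add: "(x, y) \<in> G \<Longrightarrow> (x', y') \<in> G \<Longrightarrow> (x + x', y + y') \<in> G"
proof -
  assume a: "(x, y) \<in> G" "(x', y') \<in> G"
  have "((\<lambda>t. S t x + S t x') has_vector_derivative - y + - y') (at 0 within {0..})"
    using deriv[OF a(1), of 0] deriv[OF a(2), of 0] by (intro has_vector_derivative_add) auto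
  then show ?thesis
    by (intro G_if_deriv) (auto simp: linear_simps elim!: has_vector_derivative_transform[rotated 2])
qed

lemma G_scaleC: assumes "(x, y) \<in> G" shows "(c *\<^sub>C x, c *\<^sub>C y) \<in> G"
proof (rule G_if_deriv)
  interpret c: bounded_linear "(\<lambda>x. c *\<^sub>C x) :: 'a \<Rightarrow> 'a" by (rule bounded_linear_scaleC)
  have "((\<lambda>t. c *\<^sub>C S t x) has_vector_derivative c *\<^sub>C (- S 0 y)) (at 0 within {0..})"
    using deriv[OF assms, of 0] by (intro c.has_vector_derivative) auto
  then show "((\<lambda>t. S t (c *\<^sub>C x)) has_vector_derivative - (c *\<^sub>C y)) (at 0 within {0..})"
    by (auto simp: linear_simps c.neg elim!: has_vector_derivative_transform[rotated 2])
qed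

lemma G_scaleR: "(x, y) \<in> G \<Longrightarrow> (r *\<^sub>R x, r *\<^sub>R y) \<in> G"
  using G_scaleC[of x y "complex_of_real r"] by (simp add: scaleC_of_real)

lemma G_diff: "(x, y) \<in> G \<Longrightarrow> (x', y') \<in> G \<Longrightarrow> (x - x', y - y') \<in> G"
  using G_add[of x y "- x'" "- y'"] G_scaleR[of x' y' "-1"] by simp

lemma G_zero: "(0, 0) \<in> G"
  unfolding G_iff_eps by (auto simp: linear_simps intro!: exI[of _ 1])

lemma G_invariant: assumes "(x, y) \<in> G" "0 \<le> t" shows "(S t x, S t y) \<in> G"
proof (rule G_if_deriv)
  have "((\<lambda>s. S t (S s x)) has_vector_derivative S t (- S 0 y)) (at 0 within {0..})"
    using deriv[OF assms(1), of 0]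
    by (intro bounded_linear.has_vector_derivative[OF bdd_linear] assms) auto
  then show "((\<lambda>s. S s (S t x)) has_vector_derivative - S t y) (at 0 within {0..})"
    using assms add[of _ t x] add[of t _ x]
    by (auto simp: linear_simps add.commute[of t] elim!: has_vector_derivative_transform[rotated 2])
qed

text \<open>With \<open>w = 0\<close> this is a first-order bound, with \<open>w = y\<close> a bound
  of the Taylor remainder. \<open>R\<close> is kept inside the norm because later it makes
  derivatives bounded by the norm of the initial vector.\<close>

lemma mean_value:
  assumes xy: "(x, y) \<in> G" and h: "0 \<le> h" and R: "bounded_linear R"
    and bd: "\<And>s. 0 \<le> s \<Longrightarrow> s \<le> h \<Longrightarrow> norm (R (S s y - w)) \<le> M"
  shows "norm (R (S h x - x + h *\<^sub>R w)) \<le> M * h"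
proof (cases "h = 0")
  case True
  interpret bounded_linear R by (rule R)
  show ?thesis using True by (simp add: zero)
next
  case False
  then have h: "0 < h" using h by simp
  define f where "f s = R (S s x - x + s *\<^sub>R w)" for s
  have d: "(f has_vector_derivative - R (S s y - w)) (at s within {0..})" if "0 \<le> s" for s
  proof -
    have "((\<lambda>s. S s x - x + s *\<^sub>R w) has_vector_derivative - S s y - 0 + w) (at s within {0..})"
      using deriv[OF xy that]
      by (intro derivative_intros) (auto intro!: derivative_eq_intros)
    from bounded_linear.has_vector_derivative[OF R this]
    have "(f has_vector_derivative R (- S s y - 0 + w)) (at s within {0..})" by (simp add: f_def[abs_def])
    moreover have "R (- S s y - 0 + w) = - R (S s y - w)"
      using linear_neg[OF bounded_linear.linear[OF R], of "S s y - w"] by simp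
    ultimately show ?thesis by simp
  qed
  have "norm (f h - f 0) \<le> M * h - M * 0"
  proof (rule differentiable_bound_general[OF h])
    show "continuous_on {0..h} f"
      unfolding continuous_on_eq_continuous_within
    proof
      fix s assume "s \<in> {0..h}"
      then have "continuous (at s within {0..}) f" by (intro has_vector_derivative_continuous[OF d]) auto
      then show "continuous (at s within {0..h}) f" by (rule continuous_within_subset) auto
    qed
    show "continuous_on {0..h} (\<lambda>s. M * s)" by (intro continuous_intros)
    fix s assume s: "0 < s" "s < h"
    have "at s within {0..} = at s" using s by (intro at_within_interior) auto
    then show "(f has_vector_derivative - R (S s y - w)) (at s)" using d[of s] s by simp
    show "((\<lambda>s. M * s) has_vector_derivative M) (at s)"
      by (auto intro!: derivative_eq_intros simp flip: has_real_derivative_iff_has_vector_derivative)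
    show "norm (- R (S s y - w)) \<le> M" using bd[of s] s by simp
  qed
  moreover have "f 0 = 0" using linear_0[OF bounded_linear.linear[OF R]] by (simp add: f_def)
  ultimately show ?thesis by (simp add: f_def)
qed

lemma mean_value0:
  assumes "(x, y) \<in> G" "0 \<le> h" "bounded_linear R"
    and "\<And>s. 0 \<le> s \<Longrightarrow> s \<le> h \<Longrightarrow> norm (R (S s y)) \<le> M"
  shows "norm (R (S h x - x)) \<le> M * h"
  using mean_value[OF assms(1-3), where w = 0] assms(4) by simp

lemma norm_diff_le: "(x, y) \<in> G \<Longrightarrow> 0 \<le> h \<Longrightarrow> norm (S h x - x) \<le> norm y * h"
  by (rule mean_value0[where R = "\<lambda>x. x"]) (auto intro: norm_le)

text \<open>The bound for \<open>X n\<close> comes from \<open>mean_value\<close> with a radius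
  \<open>d\<close> that depends only on \<open>y\<close> and \<open>e\<close>, so it survives the
  limit.\<close>

lemma G_closed:
  assumes X: "X \<longlonglongrightarrow> x" and Y: "Y \<longlonglongrightarrow> y" and XY: "\<And>n. (X n, Y n) \<in> G"
  shows "(x, y) \<in> G"
  unfolding G_iff_eps
proof (intro allI impI)
  fix e :: real assume e: "0 < e"
  obtain d where d: "0 < d" "\<And>h. 0 \<le> h \<Longrightarrow> h < d \<Longrightarrow> norm (S h y - y) < e"
    using near_0[OF e] by blast
  have "norm (S h x - x + h *\<^sub>R y) \<le> e * h" if h: "0 < h" "h < d" for h
  proof -
    have ev: "norm (S h (X n) - X n + h *\<^sub>R y) \<le> (e + norm (Y n - y)) * h" for n
    proof (rule mean_value[OF XY, where R = "\<lambda>x. x"])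
      fix s assume s: "0 \<le> s" "s \<le> h"
      have "norm (S s (Y n) - y) = norm ((S s y - y) + S s (Y n - y))" using s by (simp add: linear_simps)
      also have "\<dots> \<le> norm (S s y - y) + norm (S s (Y n - y))" by (rule norm_triangle_ineq)
      also have "\<dots> \<le> e + norm (Y n - y)"
        using d(2)[of s] s h norm_le[of s "Y n - y"] by (intro add_mono) auto
      finally show "norm (S s (Y n) - y) \<le> e + norm (Y n - y)" .
    qed (use h in auto)
    have 1: "(\<lambda>n. norm (S h (X n) - X n + h *\<^sub>R y)) \<longlonglongrightarrow> norm (S h x - x + h *\<^sub>R y)"
      using h by (intro tendsto_intros X bounded_linear.tendsto[OF bdd_linear]) auto
    have "(\<lambda>n. norm (Y n - y)) \<longlonglongrightarrow> norm (y - y)"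
      by (intro tendsto_intros Y)
    then have 2: "(\<lambda>n. (e + norm (Y n - y)) * h) \<longlonglongrightarrow> (e + 0) * h"
      by (intro tendsto_intros) auto
    show ?thesis using LIMSEQ_le[OF 1 2] ev by auto
  qed
  then show "\<exists>d>0. \<forall>h. 0 < h \<longrightarrow> h < d \<longrightarrow> norm (S h x - x + h *\<^sub>R y) \<le> e * h" using d(1) by blast
qed

text \<open>Up to \<open>o(h)\<close>, \<open>(1 + l h) x\<close> equals
  \<open>S h x + h (l x + y)\<close>, and \<open>S h\<close> is a contraction.\<close>

lemma G_accretive:
  assumes xy: "(x, y) \<in> G" and l: "0 \<le> l"
  shows "l * norm x \<le> norm (l *\<^sub>R x + y)"
proof (rule field_le_epsilon)
  fix e :: real assume e: "0 < e"
  obtain d where d: "0 < d" "\<And>h. 0 < h \<Longrightarrow> h < d \<Longrightarrow> norm (S h x - x + h *\<^sub>R y) \<le> e * h"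
    using xy e unfolding G_iff_eps by meson
  define h where "h = d / 2"
  have h: "0 < h" "h < d" using d by (auto simp: h_def)
  have "(1 + l * h) *\<^sub>R x = S h x + h *\<^sub>R (l *\<^sub>R x + y) - (S h x - x + h *\<^sub>R y)"
    by (simp add: algebra_simps)
  then have "norm ((1 + l * h) *\<^sub>R x) \<le> norm (S h x + h *\<^sub>R (l *\<^sub>R x + y)) + norm (S h x - x + h *\<^sub>R y)"
    by (metis norm_triangle_ineq4)
  also have "\<dots> \<le> (norm (S h x) + norm (h *\<^sub>R (l *\<^sub>R x + y))) + e * h"
    by (intro add_mono norm_triangle_ineq d h)
  also have "\<dots> \<le> norm x + h * norm (l *\<^sub>R x + y) + e * h"
    using norm_le[of h x] h by simp
  finally have "(1 + l * h) * norm x \<le> norm x + h * norm (l *\<^sub>R x + y) + e * h"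
    using h l by simp
  then have "h * (l * norm x) \<le> h * (norm (l *\<^sub>R x + y) + e)" by (simp add: algebra_simps)
  then show "l * norm x \<le> norm (l *\<^sub>R x + y) + e" using h by (simp only: mult_le_cancel_left_pos)
qed

text \<open>The witness is the Laplace integral of \<open>S s x\<close> truncated at
  \<open>T\<close>. Truncation keeps all integrals proper; its price is the exponential
  remainder.\<close>

lemma G_laplace:
  assumes l: "0 < l" and T: "0 \<le> T"
  shows "\<exists>y. (y, x - exp (- l * T) *\<^sub>R S T x - l *\<^sub>R y) \<in> G"
proof -
  define f where "f s = exp (- l * s) *\<^sub>R S s x" for s
  \<comment> \<open>The interval reaches to \<open>T + 1\<close> so that \<open>P (T + h)\<close>
    can be differentiated from the right at \<open>h = 0\<close>.\<close>
  have fc: "continuous_on {0..T+1} f"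
    unfolding f_def by (intro continuous_intros continuous_on_subset[OF cont]) auto
  define P where "P u = integral {0..u} f" for u
  have P: "(P has_vector_derivative f u) (at u within {0..T+1})" if "u \<in> {0..T+1}" for u
    unfolding P_def by (rule integral_has_vector_derivative[OF fc that])
  have "S h (P T) = exp (l * h) *\<^sub>R (P (T + h) - P h)" if h: "0 \<le> h" "h \<le> 1" for h
  proof -
    have i: "f integrable_on {a..b}" if "0 \<le> a" "b \<le> T+1" for a b
      using that by (intro integrable_continuous_real continuous_on_subset[OF fc]) auto
    have "S h (P T) = integral {0..T} (S h \<circ> f)"
      unfolding P_def using h by (intro integral_linear[symmetric] i bdd_linear) auto
    also have "\<dots> = integral {0..T} (\<lambda>s. exp (l * h) *\<^sub>R (f \<circ> (+) h) s)"
    proof (rule integral_cong)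
      fix s assume s: "s \<in> {0..T}"
      show "(S h \<circ> f) s = exp (l * h) *\<^sub>R (f \<circ> (+) h) s"
        using h s add[of h s x] by (simp add: f_def linear_simps exp_add[symmetric] algebra_simps)
    qed
    also have "\<dots> = exp (l * h) *\<^sub>R integral {0..T} (f \<circ> (+) h)" by (rule integral_cmul)
    also have "integral {0..T} (f \<circ> (+) h) = integral {0 + h..T + h} f" by (rule integral_shift_Icc_real)
    also have "\<dots> = P (T + h) - P h"
      using Henstock_Kurzweil_Integration.integral_combine[OF h(1) _ i[of 0 "T + h"]] h T by (simp add: P_def algebra_simps)
    finally show ?thesis .
  qed
  note shift = this
  have "((\<lambda>h. exp (l * h) *\<^sub>R (P (T + h) - P h)) has_vector_derivative
     exp (l * 0) *\<^sub>R (1 *\<^sub>R f (T + 0) - f 0) + (l * exp (l * 0)) *\<^sub>R (P (T + 0) - P 0)) (at 0 within {0..1})"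
  proof (rule has_vector_derivative_scaleR)
    show "((\<lambda>h. exp (l * h)) has_field_derivative l * exp (l * 0)) (at 0 within {0..1})"
      by (auto intro!: derivative_eq_intros)
    show "((\<lambda>h. P (T + h) - P h) has_vector_derivative (1 *\<^sub>R f (T + 0) - f 0)) (at 0 within {0..1})"
    proof (rule has_vector_derivative_diff)
      have "(P has_vector_derivative f (T + 0)) (at (T + 0) within (\<lambda>h. T + h) ` {0..1})"
        using T by (intro has_vector_derivative_within_subset[OF P]) auto
      moreover have "((\<lambda>h. T + h) has_vector_derivative 1) (at 0 within {0..1})"
        by (auto intro!: derivative_eq_intros)
      ultimately show "((\<lambda>h. P (T + h)) has_vector_derivative 1 *\<^sub>R f (T + 0)) (at 0 within {0..1})"
        using vector_diff_chain_within[of "\<lambda>h. T + h" 1 0 "{0..1}" P] by (simp add: o_def)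
      show "(P has_vector_derivative f 0) (at 0 within {0..1})"
        using T by (intro has_vector_derivative_within_subset[OF P]) auto
    qed
  qed
  then have "((\<lambda>h. S h (P T)) has_vector_derivative
     exp (l * 0) *\<^sub>R (1 *\<^sub>R f (T + 0) - f 0) + (l * exp (l * 0)) *\<^sub>R (P (T + 0) - P 0)) (at 0 within {0..1})"
    by (rule has_vector_derivative_transform[rotated 2]) (auto simp: shift)
  moreover have "exp (l * 0) *\<^sub>R (1 *\<^sub>R f (T + 0) - f 0) + (l * exp (l * 0)) *\<^sub>R (P (T + 0) - P 0)
      = - (x - exp (- l * T) *\<^sub>R S T x - l *\<^sub>R P T)"
    by (simp add: f_def P_def)
  moreover have "at 0 within {0..1::real} = at 0 within {0..}"
    by (simp add: at_within_Icc_at_right at_within_Ici_at_right)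
  ultimately have "((\<lambda>h. S h (P T)) has_vector_derivative - (x - exp (- l * T) *\<^sub>R S T x - l *\<^sub>R P T)) (at 0 within {0..})"
    by simp
  from G_if_deriv[OF this] show ?thesis by blast
qed

text \<open>The truncation time tends to infinity. Accretivity turns the vanishing of the remainders
  \<open>r n\<close> into the Cauchy property of the truncated integrals, and closedness of the
  generator identifies the limit.\<close>

lemma G_surj:
  assumes l: "0 < l"
  shows "\<exists>y z. (y, z) \<in> G \<and> l *\<^sub>R y + z = x"
proof -
  have "\<exists>y. (y, x - exp (- l * real n) *\<^sub>R S (real n) x - l *\<^sub>R y) \<in> G" for n
    using G_laplace[OF l] by simp
  then obtain y where y: "\<And>n. (y n, x - exp (- l * real n) *\<^sub>R S (real n) x - l *\<^sub>R y n) \<in> G" by metis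
  define r where "r n = exp (- l * real n) *\<^sub>R S (real n) x" for n
  have y: "(y n, x - r n - l *\<^sub>R y n) \<in> G" for n using y by (simp add: r_def)
  have "(\<lambda>n. exp (- l * real n)) \<longlonglongrightarrow> 0"
    using l by real_asymp
  then have "(\<lambda>n. exp (- l * real n) * norm x) \<longlonglongrightarrow> 0" by (rule tendsto_mult_left_zero)
  then have r0: "r \<longlonglongrightarrow> 0"
    by (rule Lim_null_comparison[rotated])
      (auto simp: r_def intro!: always_eventually mult_left_mono norm_le)
  have "Cauchy y"
  proof (rule CauchyI)
    fix e :: real assume e: "0 < e"
    from LIMSEQ_imp_Cauchy[OF r0] obtain N where N: "\<And>m n. m \<ge> N \<Longrightarrow> n \<ge> N \<Longrightarrow> norm (r m - r n) < l * e"
      using e l by (metis CauchyD mult_pos_pos)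
    show "\<exists>N. \<forall>m\<ge>N. \<forall>n\<ge>N. norm (y m - y n) < e"
    proof (intro exI[of _ N] allI impI)
      fix m n assume mn: "m \<ge> N" "n \<ge> N"
      have "l * norm (y m - y n) \<le> norm (l *\<^sub>R (y m - y n) + ((x - r m - l *\<^sub>R y m) - (x - r n - l *\<^sub>R y n)))"
        using l by (intro G_accretive G_diff y) auto
      also have "\<dots> = norm (r m - r n)" by (simp add: algebra_simps norm_minus_commute)
      also have "\<dots> < l * e" by (rule N[OF mn])
      finally show "norm (y m - y n) < e" using l by simp
    qed
  qed
  then obtain y0 where y0: "y \<longlonglongrightarrow> y0" using Cauchy_convergent convergent_def by blast
  have "(\<lambda>n. x - r n - l *\<^sub>R y n) \<longlonglongrightarrow> x - 0 - l *\<^sub>R y0" by (intro tendsto_intros r0 y0)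
  from G_closed[OF y0 this y] have "(y0, x - l *\<^sub>R y0) \<in> G" by simp
  then show ?thesis by (intro exI[of _ y0] exI[of _ "x - l *\<^sub>R y0"]) auto
qed

end

section \<open>Generation by m-accretive operators\<close>

lemma norm_add_add_diff_le: "norm (a + b - c) \<le> norm a + norm b + norm (c::'a::real_normed_vector)"
  using norm_triangle_ineq4[of "a + b" c] norm_triangle_ineq[of a b] by linarith

lemma funpow_commute:
  assumes "\<And>x. P (Q x) = Q (P x)"
  shows "(P ^^ n) (Q x) = Q ((P ^^ n) x)"
  by (induction n) (auto simp: assms)

lemma funpow_comp_commute:
  assumes "\<And>x. P (Q x) = Q (P x)"
  shows "((\<lambda>x. P (Q x)) ^^ n) x = (P ^^ n) ((Q ^^ n) x)"
proof (induction n)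
  case (Suc n)
  have "Q ((P ^^ n) y) = (P ^^ n) (Q y)" for y using funpow_commute[of P Q, OF assms] by simp
  then show ?case by (simp add: Suc)
qed simp

lemma funpow_norm_le:
  fixes P :: "'a::real_normed_vector \<Rightarrow> 'a"
  assumes "\<And>x. norm (P x) \<le> norm x"
  shows "norm ((P ^^ n) x) \<le> norm x"
  by (induction n) (auto intro: order_trans[OF assms])

lemma funpow_bounded_linear:
  fixes P :: "'a::real_normed_vector \<Rightarrow> 'a"
  shows "bounded_linear P \<Longrightarrow> bounded_linear (P ^^ n)"
proof (induction n)
  case 0 show ?case by (simp add: id_def bounded_linear_ident)
next
  case (Suc n) then show ?case by (auto simp: o_def intro: bounded_linear_compose)
qed

text \<open>Commutation lets every summand of the telescoped difference act on
  \<open>P x - Q x\<close> for the same \<open>x\<close>, so one estimate at a domain vector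
  suffices.\<close>

lemma commuting_contractions_funpow_diff:
  fixes P Q :: "'a::real_normed_vector \<Rightarrow> 'a"
  assumes P: "bounded_linear P" "\<And>x. norm (P x) \<le> norm x"
    and Q: "bounded_linear Q" "\<And>x. norm (Q x) \<le> norm x"
    and comm: "\<And>x. P (Q x) = Q (P x)"
  shows "norm ((P ^^ n) x - (Q ^^ n) x) \<le> real n * norm (P x - Q x)"
proof (induction n)
  case (Suc n)
  interpret Qn: bounded_linear "Q ^^ n" by (rule funpow_bounded_linear[OF Q(1)])
  interpret P: bounded_linear P by (rule P)
  have "(P ^^ Suc n) x - (Q ^^ Suc n) x = P ((P ^^ n) x - (Q ^^ n) x) + (Q ^^ n) (P x - Q x)"
    using funpow_commute[of Q P n x] comm by (simp add: P.diff Qn.diff funpow_swap1)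
  then have "norm ((P ^^ Suc n) x - (Q ^^ Suc n) x)
      \<le> norm (P ((P ^^ n) x - (Q ^^ n) x)) + norm ((Q ^^ n) (P x - Q x))"
    by (metis norm_triangle_ineq)
  also have "\<dots> \<le> norm ((P ^^ n) x - (Q ^^ n) x) + norm (P x - Q x)"
    by (intro add_mono P funpow_norm_le Q)
  also have "\<dots> \<le> real (Suc n) * norm (P x - Q x)" using Suc by (simp add: algebra_simps)
  finally show ?case .
qed simp

lemma convergent_if_geometric_steps:
  fixes f :: "nat \<Rightarrow> 'a::banach"
  assumes "\<And>k. N \<le> k \<Longrightarrow> norm (f (Suc k) - f k) \<le> M / 2 ^ k"
  shows "convergent f"
proof -
  have "summable (\<lambda>k. M * (1/2) ^ k)" by (intro summable_mult summable_geometric) simp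
  then have "summable (\<lambda>k. M / 2 ^ k)" by (simp add: power_divide)
  then have "summable (\<lambda>k. f (Suc k) - f k)"
    by (rule summable_comparison_test'[where N = N]) (use assms in simp)
  then have "convergent (\<lambda>n. \<Sum>k<n. f (Suc k) - f k)" by (simp add: summable_iff_convergent)
  then have "convergent (\<lambda>n. f n - f 0)" by (simp add: sum_lessThan_telescope)
  then have "convergent (\<lambda>n. (f n - f 0) + f 0)" by (intro convergent_add convergent_const)
  then show ?thesis by simp
qed

text \<open>The range condition is asked for small \<open>h\<close> only, which is what the fixed
  point argument for the sum delivers. It is the reason for the side conditions
  \<open>t / 2 ^ k \<le> h0\<close> below.\<close>

locale m_accretive =
  fixes C :: "('a::complex_banach \<times> 'a) set" and h0 :: real
  assumes C_add: "\<And>x y x' y'. (x, y) \<in> C \<Longrightarrow> (x', y') \<in> C \<Longrightarrow> (x + x', y + y') \<in> C"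
    and C_scaleC: "\<And>x y c. (x, y) \<in> C \<Longrightarrow> (c *\<^sub>C x, c *\<^sub>C y) \<in> C"
    and accretive: "\<And>x y h. (x, y) \<in> C \<Longrightarrow> 0 \<le> h \<Longrightarrow> norm x \<le> norm (x + h *\<^sub>R y)"
    and h0: "0 < h0"
    and surj: "\<And>h x. 0 < h \<Longrightarrow> h \<le> h0 \<Longrightarrow> \<exists>y z. (y, z) \<in> C \<and> y + h *\<^sub>R z = x"
    and dense: "\<And>x e. 0 < e \<Longrightarrow> \<exists>y z. (y, z) \<in> C \<and> norm (y - x) < e"
begin

lemma C_scaleR: "(x, y) \<in> C \<Longrightarrow> (r *\<^sub>R x, r *\<^sub>R y) \<in> C"
  using C_scaleC[of x y "complex_of_real r"] by (simp add: scaleC_of_real)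

lemma C_diff: "(x, y) \<in> C \<Longrightarrow> (x', y') \<in> C \<Longrightarrow> (x - x', y - y') \<in> C"
  using C_add[of x y "- x'" "- y'"] C_scaleR[of x' y' "-1"] by simp

text \<open>The resolvent \<open>(1 + h C)^-1\<close>. The case \<open>h = 0\<close> is set apart
  because \<open>C\<close> need not be defined everywhere, while \<open>J 0\<close> has to be the
  identity on the whole space.\<close>

definition J :: "real \<Rightarrow> 'a \<Rightarrow> 'a"
  where "J h x = (if h = 0 then x else THE y. \<exists>z. (y, z) \<in> C \<and> y + h *\<^sub>R z = x)"

lemma J_0 [simp]: "J 0 x = x" by (simp add: J_def)

lemma resolvent_unique:
  assumes "(y, z) \<in> C" "(y', z') \<in> C" "0 \<le> h" "y + h *\<^sub>R z = y' + h *\<^sub>R z'"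
  shows "y = y'"
proof -
  have "norm (y - y') \<le> norm ((y - y') + h *\<^sub>R (z - z'))"
    using assms by (intro accretive C_diff)
  also have "(y - y') + h *\<^sub>R (z - z') = 0" using assms(4) by (simp add: algebra_simps)
  finally show ?thesis by simp
qed

lemma J_eq:
  assumes "(y, z) \<in> C" "0 \<le> h"
  shows "J h (y + h *\<^sub>R z) = y"
proof (cases "h = 0")
  case False
  have "(THE y'. \<exists>z'. (y', z') \<in> C \<and> y' + h *\<^sub>R z' = y + h *\<^sub>R z) = y"
  proof (rule the_equality)
    show "\<exists>z'. (y, z') \<in> C \<and> y + h *\<^sub>R z' = y + h *\<^sub>R z" using assms(1) by blast
    show "y' = y" if "\<exists>z'. (y', z') \<in> C \<and> y' + h *\<^sub>R z' = y + h *\<^sub>R z" for y'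
      using that resolvent_unique[OF _ assms] by blast
  qed
  then show ?thesis using False by (simp add: J_def)
qed simp

lemma J_ex:
  assumes "0 < h" "h \<le> h0"
  shows "\<exists>z. (J h x, z) \<in> C \<and> J h x + h *\<^sub>R z = x"
proof -
  obtain y z where "(y, z) \<in> C" "y + h *\<^sub>R z = x" using surj[OF assms] by blast
  then show ?thesis using J_eq[of y z h] assms by auto
qed

lemma J_norm: assumes "0 \<le> h" "h \<le> h0" shows "norm (J h x) \<le> norm x"
proof (cases "h = 0")
  case False
  then obtain z where "(J h x, z) \<in> C" "J h x + h *\<^sub>R z = x" using J_ex[of h x] assms by auto
  then show ?thesis using accretive[of "J h x" z h] assms by simp
qed simp

lemma J_add: assumes "0 \<le> h" "h \<le> h0" shows "J h (x + y) = J h x + J h y"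
proof (cases "h = 0")
  case False
  then obtain z w where z: "(J h x, z) \<in> C" "J h x + h *\<^sub>R z = x" and w: "(J h y, w) \<in> C" "J h y + h *\<^sub>R w = y"
    using J_ex[of h] assms by (metis order_le_less)
  have "(J h x + J h y) + h *\<^sub>R (z + w) = (J h x + h *\<^sub>R z) + (J h y + h *\<^sub>R w)"
    by (simp add: algebra_simps)
  also have "\<dots> = x + y" by (simp only: z w)
  finally show ?thesis using J_eq[OF C_add[OF z(1) w(1)] assms(1)] by simp
qed simp

lemma J_scaleC: assumes "0 \<le> h" "h \<le> h0" shows "J h (c *\<^sub>C x) = c *\<^sub>C J h x"
proof (cases "h = 0")
  case False
  then obtain z where z: "(J h x, z) \<in> C" "J h x + h *\<^sub>R z = x" using J_ex[of h x] assms by auto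
  have "c *\<^sub>C x = c *\<^sub>C J h x + h *\<^sub>R (c *\<^sub>C z)"
  proof -
    have "c *\<^sub>C x = c *\<^sub>C (J h x + h *\<^sub>R z)" by (simp add: z)
    also have "\<dots> = c *\<^sub>C J h x + h *\<^sub>R (c *\<^sub>C z)"
      by (simp add: scaleC_add_right linear_cmul[OF bounded_linear.linear[OF bounded_linear_scaleC]])
    finally show ?thesis .
  qed
  then show ?thesis using J_eq[OF C_scaleC[OF z(1)], of h c] assms by simp
qed simp

lemma J_scaleR: assumes "0 \<le> h" "h \<le> h0" shows "J h (r *\<^sub>R x) = r *\<^sub>R J h x"
  using J_scaleC[OF assms, of "complex_of_real r" x] by (simp add: scaleC_of_real)

lemma J_bounded_linear: assumes "0 \<le> h" "h \<le> h0" shows "bounded_linear (J h)"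
  by (rule bounded_linear_intro[where K = 1]) (auto simp: J_add J_scaleR J_norm assms)

lemma J_C:
  assumes xy: "(x, y) \<in> C" and h: "0 \<le> h" "h \<le> h0"
  shows "(J h x, J h y) \<in> C" "h \<noteq> 0 \<Longrightarrow> \<exists>w. (J h y, w) \<in> C"
proof -
  have *: "(J h x, J h y) \<in> C \<and> (\<exists>w. (J h y, w) \<in> C)" if h0: "h \<noteq> 0"
  proof -
    obtain q where q: "(J h x, q) \<in> C" "J h x + h *\<^sub>R q = x" using J_ex[of h x] h h0 by auto
    \<comment> \<open>\<open>q\<close> is \<open>C (J h x)\<close>; written this way it is a
      combination of two domain elements, which is the gain of one domain order.\<close>
    have qe: "q = inverse h *\<^sub>R (x - J h x)"
      using q(2) h0 by (metis add_diff_cancel_left' divideR_right divide_inverse_commute)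
    have "(inverse h *\<^sub>R (x - J h x), inverse h *\<^sub>R (y - q)) \<in> C"
      by (intro C_scaleR C_diff xy q)
    then have qC: "(q, inverse h *\<^sub>R (y - q)) \<in> C" by (simp add: qe[symmetric])
    have "q + h *\<^sub>R (inverse h *\<^sub>R (y - q)) = y" using h0 by simp
    with J_eq[OF qC h(1)] have "J h y = q" by simp
    then show ?thesis using q qC by auto
  qed
  show "(J h x, J h y) \<in> C" using * xy by (cases "h = 0") auto
  show "h \<noteq> 0 \<Longrightarrow> \<exists>w. (J h y, w) \<in> C" using * by blast
qed

lemma J_commute:
  assumes a: "0 \<le> a" "a \<le> h0" and b: "0 \<le> b" "b \<le> h0"
  shows "J a (J b x) = J b (J a x)"
proof (cases "b = 0")
  case False
  then obtain w where w: "(J b x, w) \<in> C" "J b x + b *\<^sub>R w = x" using J_ex[of b x] b by auto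
  have "J a x = J a (J b x) + b *\<^sub>R J a w"
    using w(2) J_add[OF a, of "J b x" "b *\<^sub>R w"] J_scaleR[OF a] by simp
  then show ?thesis using J_eq[OF J_C(1)[OF w(1) a] b(1)] by simp
qed simp

lemma J_diff_norm:
  assumes xy: "(x, y) \<in> C" and h: "0 \<le> h" "h \<le> h0"
  shows "norm (J h x - x) \<le> h * norm y"
proof -
  have "J h x = x - h *\<^sub>R J h y"
    using J_eq[OF xy h(1)] J_add[OF h, of x "h *\<^sub>R y"] J_scaleR[OF h, of h y]
    by (metis add_diff_cancel)
  then show ?thesis using J_norm[OF h, of y] h by (simp add: mult_left_mono)
qed

text \<open>Once the resolvents commute, this estimate yields at once the convergence of
  \<open>(1 + (t/2\<^sup>k) C)\<close> to the power \<open>- 2\<^sup>k\<close> (case \<open>a = b\<close>) and the semigroup law of the limit.\<close>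

lemma J_step:
  assumes x: "(x, x1) \<in> C" "(x1, x2) \<in> C" and a: "0 \<le> a" and b: "0 \<le> b" and ab: "a + b \<le> h0"
  shows "norm (J a (J b x) - J (a + b) x) \<le> a * b * norm x2"
proof -
  have h: "a \<le> h0" "b \<le> h0" "0 \<le> a + b" using a b ab by auto
  let ?P = "\<lambda>y. J (a + b) (J a (J b y))"
  note lin = J_add[OF a h(1)] J_add[OF b h(2)] J_add[OF h(3) ab]
    J_scaleR[OF a h(1)] J_scaleR[OF b h(2)] J_scaleR[OF h(3) ab]
  have "J b ((x + a *\<^sub>R x1) + b *\<^sub>R (x1 + a *\<^sub>R x2)) = x + a *\<^sub>R x1"
    by (intro J_eq C_add C_scaleR x b)
  then have "J a (J b ((x + a *\<^sub>R x1) + b *\<^sub>R (x1 + a *\<^sub>R x2))) = x"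
    using J_eq[OF x(1) a] by simp
  then have 1: "J (a + b) x = ?P ((x + (a + b) *\<^sub>R x1) + (a * b) *\<^sub>R x2)"
    by (simp add: algebra_simps)
  have "J (a + b) (x + (a + b) *\<^sub>R x1) = x" by (rule J_eq[OF x(1) h(3)])
  then have "J a (J b x) = J a (J b (J (a + b) (x + (a + b) *\<^sub>R x1)))" by simp
  also have "\<dots> = ?P (x + (a + b) *\<^sub>R x1)"
    using J_commute[OF b h(2) h(3) ab] J_commute[OF a h(1) h(3) ab] by simp
  finally have 2: "J a (J b x) = ?P (x + (a + b) *\<^sub>R x1)" .
  have "J a (J b x) - J (a + b) x = - ((a * b) *\<^sub>R ?P x2)" unfolding 1 2 by (simp only: lin) simp
  then have "norm (J a (J b x) - J (a + b) x) = a * b * norm (?P x2)" using a b by simp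
  also have "norm (?P x2) \<le> norm x2"
    using J_norm[OF h(3) ab] J_norm[OF a h(1)] J_norm[OF b h(2)] order_trans by metis
  finally show ?thesis using a b by (simp add: mult_left_mono)
qed

lemma J_tendsto_id: "(\<lambda>n. J (h0 / real (Suc n)) x) \<longlonglongrightarrow> x"
proof (rule LIMSEQ_I)
  fix e :: real assume e: "0 < e"
  have hn: "0 \<le> h0 / real (Suc n)" "h0 / real (Suc n) \<le> h0" for n
    using h0 by (auto simp: field_simps)
  obtain y z where yz: "(y, z) \<in> C" "norm (y - x) < e / 4" using dense[of "e/4" x] e by auto
  have "(\<lambda>n. h0 / real (Suc n) * norm z) \<longlonglongrightarrow> 0" by real_asymp
  from order_tendstoD(2)[OF this, of "e / 2"] e
  obtain N where N: "\<And>n. n \<ge> N \<Longrightarrow> h0 / real (Suc n) * norm z < e / 2"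
    unfolding eventually_sequentially by auto
  show "\<exists>N. \<forall>n\<ge>N. norm (J (h0 / real (Suc n)) x - x) < e"
  proof (intro exI[of _ N] allI impI)
    fix n assume n: "n \<ge> N"
    let ?h = "h0 / real (Suc n)"
    interpret bounded_linear "J ?h" by (rule J_bounded_linear[OF hn])
    have "J ?h x - x = (J ?h y - y) + (y - x) - J ?h (y - x)" by (simp only: diff) simp
    then have "norm (J ?h x - x) \<le> norm (J ?h y - y) + norm (y - x) + norm (J ?h (y - x))"
      by (simp only: norm_add_add_diff_le)
    also have "\<dots> < e / 2 + e / 4 + e / 4"
      using J_diff_norm[OF yz(1) hn, of n] N[OF n] yz(2) J_norm[OF hn, of n "y - x"]
      by (intro add_strict_mono) linarith+
    finally show "norm (J ?h x - x) < e" by simp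
  qed
qed

text \<open>\<open>J_step\<close> costs two applications of \<open>C\<close>. Resolvents map the
  domain of \<open>C\<close> into that of its square and converge to the identity as
  \<open>h\<close> tends to zero, so density passes from one to the other.\<close>

lemma dense2:
  assumes e: "0 < e"
  shows "\<exists>y y1 y2. (y, y1) \<in> C \<and> (y1, y2) \<in> C \<and> norm (y - x) < e"
proof -
  obtain y z where yz: "(y, z) \<in> C" "norm (y - x) < e / 2" using dense[of "e/2" x] e by auto
  obtain n where n: "norm (J (h0 / real (Suc n)) y - y) < e / 2"
    using LIMSEQ_D[OF J_tendsto_id, of "e/2" y] e by auto
  let ?h = "h0 / real (Suc n)"
  have h: "0 \<le> ?h" "?h \<le> h0" "?h \<noteq> 0" using h0 by (auto simp: field_simps)
  obtain w where w: "(J ?h z, w) \<in> C" using J_C(2)[OF yz(1) h] by blast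
  have "norm (J ?h y - x) \<le> norm (J ?h y - y) + norm (y - x)"
    by (metis norm_triangle_ineq diff_add_cancel add_diff_eq)
  then have "norm (J ?h y - x) < e" using n yz by simp
  then show ?thesis using J_C(1)[OF yz(1) h(1,2)] w by blast
qed

text \<open>Backward Euler steps for \<open>C\<close>. With powers of two as step numbers,
  refinement means halving each step, which is \<open>J_step\<close> with
  \<open>a = b\<close>.\<close>

definition E :: "real \<Rightarrow> nat \<Rightarrow> 'a \<Rightarrow> 'a"
  where "E t k = J (t / 2 ^ k) ^^ (2 ^ k)"

definition W :: "real \<Rightarrow> 'a \<Rightarrow> 'a"
  where "W t x = lim (\<lambda>k. E t k x)"

lemma ev_small: "\<forall>\<^sub>F k in sequentially. t / 2 ^ k \<le> h0"
proof -
  have "(\<lambda>k. t / 2 ^ k) \<longlonglongrightarrow> 0" by real_asymp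
  then show ?thesis using h0 by (auto dest!: order_tendstoD(2)[where a = h0] elim!: eventually_mono)
qed

lemma E_bounded_linear: "0 \<le> t \<Longrightarrow> t / 2 ^ k \<le> h0 \<Longrightarrow> bounded_linear (E t k)"
  unfolding E_def by (intro funpow_bounded_linear J_bounded_linear) auto

lemma E_norm: "0 \<le> t \<Longrightarrow> t / 2 ^ k \<le> h0 \<Longrightarrow> norm (E t k x) \<le> norm x"
  unfolding E_def by (intro funpow_norm_le J_norm) auto

text \<open>There are \<open>2 ^ k\<close> steps, each with error \<open>s t / 4 ^ k\<close> times
  \<open>norm x2\<close>, so one factor \<open>2 ^ k\<close> survives in the denominator.\<close>

lemma E_mult_step:
  assumes x: "(x, x1) \<in> C" "(x1, x2) \<in> C" and st: "0 \<le> s" "0 \<le> t" and k: "(s + t) / 2 ^ k \<le> h0"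
  shows "norm (E s k (E t k x) - E (s + t) k x) \<le> s * t * norm x2 / 2 ^ k"
proof -
  let ?a = "s / 2 ^ k" and ?b = "t / 2 ^ k"
  have ab: "0 \<le> ?a" "0 \<le> ?b" "?a + ?b = (s + t) / 2 ^ k" using st by (auto simp: add_divide_distrib)
  have h: "?a \<le> h0" "?b \<le> h0" using ab k by linarith+
  let ?P = "\<lambda>x. J ?a (J ?b x)" and ?Q = "J (?a + ?b)"
  have Q: "0 \<le> ?a + ?b" "?a + ?b \<le> h0" using ab k by auto
  have "norm ((?P ^^ (2 ^ k)) x - (?Q ^^ (2 ^ k)) x) \<le> real (2 ^ k) * norm (?P x - ?Q x)"
  proof (rule commuting_contractions_funpow_diff)
    show "bounded_linear ?P" by (rule bounded_linear_compose[OF J_bounded_linear[OF ab(1) h(1)] J_bounded_linear[OF ab(2) h(2)]])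
    show "norm (?P x) \<le> norm x" for x
      using J_norm[OF ab(1) h(1)] J_norm[OF ab(2) h(2)] order_trans by metis
    show "?P (?Q x) = ?Q (?P x)" for x
      using J_commute[OF ab(2) h(2) Q] J_commute[OF ab(1) h(1) Q] by simp
  qed (auto intro: J_bounded_linear J_norm Q)
  also have "norm (?P x - ?Q x) \<le> ?a * ?b * norm x2" by (rule J_step[OF x ab(1,2) Q(2)])
  also have "(?P ^^ (2 ^ k)) x = E s k (E t k x)"
    unfolding E_def by (intro funpow_comp_commute J_commute ab h)
  also have "(?Q ^^ (2 ^ k)) x = E (s + t) k x" by (simp add: E_def ab)
  finally show ?thesis by (simp add: field_simps)
qed

text \<open>Makes the comparison of \<open>k\<close> and \<open>Suc k\<close> an instance of
  \<open>E_mult_step\<close> with both times equal to \<open>t / 2\<close>, which yields geometric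
  convergence.\<close>

lemma E_double: "E t (Suc k) = E (t / 2) k \<circ> E (t / 2) k"
proof -
  have "t / 2 ^ Suc k = t / 2 / 2 ^ k" "(2::nat) ^ Suc k = 2 ^ k + 2 ^ k" by auto
  then show ?thesis by (simp only: E_def funpow_add)
qed

lemma E_convergent: assumes t: "0 \<le> t" shows "convergent (\<lambda>k. E t k x)"
proof -
  obtain N where N: "\<And>k. N \<le> k \<Longrightarrow> t / 2 ^ k \<le> h0"
    using ev_small[of t] by (auto simp: eventually_sequentially)
  have conv2: "convergent (\<lambda>k. E t k y)" if y: "(y, y1) \<in> C" "(y1, y2) \<in> C" for y y1 y2
  proof (rule convergent_if_geometric_steps[where N = N])
    fix k assume k: "N \<le> k"
    have "norm (E (t/2) k (E (t/2) k y) - E (t/2 + t/2) k y) \<le> (t/2) * (t/2) * norm y2 / 2 ^ k"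
      using t N[OF k] by (intro E_mult_step[OF y]) auto
    then show "norm (E t (Suc k) y - E t k y) \<le> ((t/2) * (t/2) * norm y2) / 2 ^ k"
      by (simp add: E_double)
  qed
  have "Cauchy (\<lambda>k. E t k x)"
  proof (rule CauchyI)
    fix e :: real assume e: "0 < e"
    obtain y y1 y2 where y: "(y, y1) \<in> C" "(y1, y2) \<in> C" "norm (y - x) < e / 3"
      using dense2[of "e/3" x] e by auto
    have "Cauchy (\<lambda>k. E t k y)" using conv2[OF y(1,2)] by (simp add: Cauchy_convergent_iff)
    then obtain M where M: "\<And>m n. M \<le> m \<Longrightarrow> M \<le> n \<Longrightarrow> norm (E t m y - E t n y) < e / 3"
      using e by (metis CauchyD divide_pos_pos zero_less_numeral)
    show "\<exists>M. \<forall>m\<ge>M. \<forall>n\<ge>M. norm (E t m x - E t n x) < e"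
    proof (intro exI[of _ "max M N"] allI impI)
      fix m n assume mn: "max M N \<le> m" "max M N \<le> n"
      have d: "norm (E t k x - E t k y) < e / 3" if "max M N \<le> k" for k
      proof -
        have k: "t / 2 ^ k \<le> h0" using N that by simp
        interpret bounded_linear "E t k" by (rule E_bounded_linear[OF t k])
        have "norm (E t k x - E t k y) \<le> norm (x - y)" using E_norm[OF t k, of "x - y"] by (simp add: diff)
        then show ?thesis using y(3) by (simp add: norm_minus_commute)
      qed
      have "E t m x - E t n x = (E t m x - E t m y) + (E t m y - E t n y) - (E t n x - E t n y)" by simp
      then have "norm (E t m x - E t n x)
          \<le> norm (E t m x - E t m y) + norm (E t m y - E t n y) + norm (E t n x - E t n y)"
        by (simp only: norm_add_add_diff_le)
      also have "\<dots> < e / 3 + e / 3 + e / 3"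
        using d mn M[of m n] by (intro add_strict_mono) auto
      finally show "norm (E t m x - E t n x) < e" by simp
    qed
  qed
  then show ?thesis by (rule Cauchy_convergent)
qed

lemma W_lim: "0 \<le> t \<Longrightarrow> (\<lambda>k. E t k x) \<longlonglongrightarrow> W t x"
  unfolding W_def using E_convergent by (simp add: convergent_LIMSEQ_iff)

lemma W_norm: assumes "0 \<le> t" shows "norm (W t x) \<le> norm x"
proof (rule tendsto_upperbound[OF tendsto_norm[OF W_lim[OF assms]]])
  show "\<forall>\<^sub>F k in sequentially. norm (E t k x) \<le> norm x"
    using ev_small[of t] by eventually_elim (use E_norm assms in auto)
qed auto

lemma W_add: assumes t: "0 \<le> t" shows "W t (x + y) = W t x + W t y"
proof (rule LIMSEQ_unique[OF W_lim[OF t]])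
  have "\<forall>\<^sub>F k in sequentially. E t k x + E t k y = E t k (x + y)"
    using ev_small[of t] by eventually_elim
      (use E_bounded_linear[OF t] in \<open>auto simp: linear_add[OF bounded_linear.linear]\<close>)
  then show "(\<lambda>k. E t k (x + y)) \<longlonglongrightarrow> W t x + W t y"
    by (rule Lim_transform_eventually[OF tendsto_add[OF W_lim[OF t] W_lim[OF t]]])
qed

lemma W_scaleC: assumes t: "0 \<le> t" shows "W t (c *\<^sub>C x) = c *\<^sub>C W t x"
proof (rule LIMSEQ_unique[OF W_lim[OF t]])
  have sc: "(J h ^^ n) (c *\<^sub>C x) = c *\<^sub>C (J h ^^ n) x" if "0 \<le> h" "h \<le> h0" for h n
    by (induction n) (auto simp: J_scaleC that)
  have "\<forall>\<^sub>F k in sequentially. c *\<^sub>C E t k x = E t k (c *\<^sub>C x)"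
    using ev_small[of t] by eventually_elim (use t sc in \<open>auto simp: E_def\<close>)
  then show "(\<lambda>k. E t k (c *\<^sub>C x)) \<longlonglongrightarrow> c *\<^sub>C W t x"
    by (rule Lim_transform_eventually[OF bounded_linear.tendsto[OF bounded_linear_scaleC W_lim[OF t]]])
qed

lemma W_scaleR: "0 \<le> t \<Longrightarrow> W t (r *\<^sub>R x) = r *\<^sub>R W t x"
  using W_scaleC[of t "complex_of_real r" x] by (simp add: scaleC_of_real)

lemma W_bounded_linear: "0 \<le> t \<Longrightarrow> bounded_linear (W t)"
  by (rule bounded_linear_intro[where K = 1]) (auto simp: W_add W_scaleR W_norm)

lemma W_diff: "0 \<le> t \<Longrightarrow> W t (x - y) = W t x - W t y"
  using W_bounded_linear[of t] by (simp add: linear_diff bounded_linear.linear)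

lemma W_mult: assumes s: "0 \<le> s" and t: "0 \<le> t" shows "W (s + t) x = W s (W t x)"
proof -
  have 2: "W (s + t) y = W s (W t y)" if y: "(y, y1) \<in> C" "(y1, y2) \<in> C" for y y1 y2
  proof -
    have "(\<lambda>k. E s k (E t k y) - E (s + t) k y) \<longlonglongrightarrow> 0"
    proof (rule Lim_null_comparison)
      show "\<forall>\<^sub>F k in sequentially. norm (E s k (E t k y) - E (s + t) k y) \<le> s * t * norm y2 / 2 ^ k"
        using ev_small[of "s + t"] by eventually_elim (use E_mult_step[OF y s t] in auto)
      show "(\<lambda>k. s * t * norm y2 / 2 ^ k) \<longlonglongrightarrow> 0" by real_asymp
    qed
    moreover have "(\<lambda>k. E s k (E t k y) - E s k (W t y)) \<longlonglongrightarrow> 0"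
    proof (rule Lim_null_comparison)
      show "\<forall>\<^sub>F k in sequentially. norm (E s k (E t k y) - E s k (W t y)) \<le> norm (E t k y - W t y)"
        using ev_small[of s]
      proof eventually_elim
        fix k assume k: "s / 2 ^ k \<le> h0"
        interpret bounded_linear "E s k" by (rule E_bounded_linear[OF s k])
        show "norm (E s k (E t k y) - E s k (W t y)) \<le> norm (E t k y - W t y)"
          using E_norm[OF s k, of "E t k y - W t y"] by (simp add: diff)
      qed
      show "(\<lambda>k. norm (E t k y - W t y)) \<longlonglongrightarrow> 0"
        using W_lim[OF t, of y] by (simp add: tendsto_norm_zero LIM_zero)
    qed
    ultimately have "(\<lambda>k. (E s k (E t k y) - E s k (W t y)) - (E s k (E t k y) - E (s + t) k y)
        + E s k (W t y)) \<longlonglongrightarrow> 0 - 0 + W s (W t y)"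
      by (intro tendsto_intros W_lim s)
    then have "(\<lambda>k. E (s + t) k y) \<longlonglongrightarrow> W s (W t y)" by simp
    then show ?thesis using W_lim[of "s + t" y] s t LIMSEQ_unique by auto
  qed
  have "norm (W (s + t) x - W s (W t x)) \<le> 0"
  proof (rule field_le_epsilon)
    fix e :: real assume e: "0 < e"
    obtain y y1 y2 where y: "(y, y1) \<in> C" "(y1, y2) \<in> C" "norm (y - x) < e / 2"
      using dense2[of "e/2" x] e by auto
    have "W (s + t) x - W s (W t x) = W s (W t (y - x)) - W (s + t) (y - x)"
      using 2[OF y(1,2)] s t by (simp add: W_diff)
    then have "norm (W (s + t) x - W s (W t x)) \<le> norm (W s (W t (y - x))) + norm (W (s + t) (y - x))"
      by (simp add: norm_triangle_ineq4)
    also have "\<dots> \<le> norm (y - x) + norm (y - x)"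
      using W_norm s t by (intro add_mono order_trans[OF W_norm]) auto
    finally show "norm (W (s + t) x - W s (W t x)) \<le> 0 + e" using y(3) by simp
  qed
  then show ?thesis by simp
qed

lemma W_diff_norm: assumes xy: "(x, y) \<in> C" and t: "0 \<le> t" shows "norm (W t x - x) \<le> t * norm y"
proof (rule tendsto_upperbound)
  show "(\<lambda>k. norm (E t k x - x)) \<longlonglongrightarrow> norm (W t x - x)" by (intro tendsto_intros W_lim t)
  show "\<forall>\<^sub>F k in sequentially. norm (E t k x - x) \<le> t * norm y"
    using ev_small[of t]
  proof eventually_elim
    fix k assume k: "t / 2 ^ k \<le> h0"
    have k0: "0 \<le> t / 2 ^ k" using t by simp
    have "norm ((J (t / 2 ^ k) ^^ (2 ^ k)) x - ((\<lambda>x. x) ^^ (2 ^ k)) x)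
        \<le> real (2 ^ k) * norm (J (t / 2 ^ k) x - x)"
      by (rule commuting_contractions_funpow_diff) (auto intro: J_bounded_linear J_norm k k0 bounded_linear_ident)
    also have "((\<lambda>x::'a. x) ^^ (2 ^ k)) x = x" by (simp flip: id_def)
    also have "real (2 ^ k) * norm (J (t / 2 ^ k) x - x) \<le> real (2 ^ k) * (t / 2 ^ k * norm y)"
      by (intro mult_left_mono J_diff_norm[OF xy k0 k]) auto
    finally show "norm (E t k x - x) \<le> t * norm y" by (simp add: E_def)
  qed
qed auto

text \<open>Step \<open>j\<close> of length \<open>h\<close> adds an error of at most
  \<open>j h^2 norm x2\<close>, and \<open>n\<close> steps together at most
  \<open>(n h)^2 norm x2\<close>. With \<open>n = 2 ^ k\<close> and \<open>h = t / 2 ^ k\<close>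
  this is independent of \<open>k\<close>.\<close>

lemma W_taylor:
  assumes x: "(x, x1) \<in> C" "(x1, x2) \<in> C" and t: "0 \<le> t"
  shows "norm (W t x - x + t *\<^sub>R x1) \<le> t\<^sup>2 * norm x2"
proof (rule tendsto_upperbound)
  show "(\<lambda>k. norm (E t k x - x + t *\<^sub>R x1)) \<longlonglongrightarrow> norm (W t x - x + t *\<^sub>R x1)"
    by (intro tendsto_intros W_lim t)
  show "\<forall>\<^sub>F k in sequentially. norm (E t k x - x + t *\<^sub>R x1) \<le> t\<^sup>2 * norm x2"
    using ev_small[of t]
  proof eventually_elim
    fix k assume k: "t / 2 ^ k \<le> h0"
    define h where "h = t / 2 ^ k"
    have h: "0 \<le> h" "h \<le> h0" using t k by (auto simp: h_def)
    interpret bounded_linear "J h" by (rule J_bounded_linear[OF h])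
    have Jx: "J h x = x - h *\<^sub>R J h x1"
      using J_eq[OF x(1) h(1)] by (simp add: add scaleR algebra_simps)
    have "norm ((J h ^^ n) x - x + (real n * h) *\<^sub>R x1) \<le> (real n)\<^sup>2 * (h\<^sup>2 * norm x2)" for n
    proof (induction n)
      case (Suc n)
      let ?d = "J h x1 - x1"
      have "(J h ^^ Suc n) x - x + (real (Suc n) * h) *\<^sub>R x1
          = J h ((J h ^^ n) x - x + (real n * h) *\<^sub>R x1) + (- h *\<^sub>R ?d - (real n * h) *\<^sub>R ?d)"
        by (simp add: add diff scaleR Jx algebra_simps)
      also have "\<dots> = J h ((J h ^^ n) x - x + (real n * h) *\<^sub>R x1) - (real (Suc n) * h) *\<^sub>R ?d"
        by (simp add: algebra_simps)
      finally have "norm ((J h ^^ Suc n) x - x + (real (Suc n) * h) *\<^sub>R x1)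
          \<le> norm (J h ((J h ^^ n) x - x + (real n * h) *\<^sub>R x1)) + norm ((real (Suc n) * h) *\<^sub>R ?d)"
        by (metis norm_triangle_ineq4)
      also have "\<dots> \<le> (real n)\<^sup>2 * (h\<^sup>2 * norm x2) + (real (Suc n) * h) * (h * norm x2)"
        using Suc J_norm[OF h] J_diff_norm[OF x(2) h] h
        by (intro add_mono) (auto intro: order_trans mult_left_mono)
      also have "\<dots> = ((real n)\<^sup>2 + real (Suc n)) * (h\<^sup>2 * norm x2)"
        by (simp add: power2_eq_square algebra_simps)
      also have "\<dots> \<le> (real (Suc n))\<^sup>2 * (h\<^sup>2 * norm x2)"
      proof (rule mult_right_mono)
        show "(real n)\<^sup>2 + real (Suc n) \<le> (real (Suc n))\<^sup>2" by (simp add: power2_eq_square algebra_simps)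
      qed simp
      finally show ?case .
    qed simp
    from this[of "2 ^ k"] show "norm (E t k x - x + t *\<^sub>R x1) \<le> t\<^sup>2 * norm x2"
      by (simp add: E_def h_def power_divide)
  qed
qed auto

lemma W_contraction_semigroup: "contraction_semigroup W"
  unfolding contraction_semigroup_def C0_semigroup_def
proof (intro conjI allI impI)
  fix t :: real assume t: "0 \<le> t"
  show "bounded_clinear (W t)" using W_bounded_linear[OF t] W_scaleC[OF t] by (simp add: bounded_clinear_def)
  show "onorm (W t) \<le> 1" by (rule onorm_bound) (auto simp: W_norm t)
  show "W (s + t) = W s \<circ> W t" if "0 \<le> s" for s using W_mult[OF that t] by auto
next
  have E0: "E 0 k x = x" for k x unfolding E_def
  proof -
    have "(J 0 ^^ n) x = x" for n by (induction n) auto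
    then show "(J (0 / 2 ^ k) ^^ 2 ^ k) x = x" by simp
  qed
  have "W 0 x = x" for x
    using W_lim[of 0 x] LIMSEQ_unique[OF _ tendsto_const] by (simp add: E0)
  then show "W 0 = id" by auto
next
  fix x
  show "((\<lambda>t. W t x) \<longlongrightarrow> x) (at_right 0)"
  proof (rule tendstoI)
    fix e :: real assume e: "0 < e"
    obtain y z where yz: "(y, z) \<in> C" "norm (y - x) < e / 4" using dense[of "e/4" x] e by auto
    have "((\<lambda>t. t * norm z) \<longlongrightarrow> 0 * norm z) (at_right 0)" by (intro tendsto_intros)
    then have "\<forall>\<^sub>F t in at_right 0. t * norm z < e / 2" using e by (intro order_tendstoD) auto
    moreover have "\<forall>\<^sub>F t in at_right (0::real). 0 < t" by (simp add: eventually_at_right_less)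
    ultimately show "\<forall>\<^sub>F t in at_right 0. dist (W t x) x < e"
    proof eventually_elim
      case (elim t)
      have "W t x - x = (W t y - y) + (y - x) - W t (y - x)" using elim by (simp add: W_diff)
      then have "norm (W t x - x) \<le> norm (W t y - y) + norm (y - x) + norm (W t (y - x))"
        by (simp only: norm_add_add_diff_le)
      also have "\<dots> < e / 2 + e / 4 + e / 4"
        using elim yz W_diff_norm[OF yz(1), of t] W_norm[of t "y - x"] by (intro add_strict_mono) linarith+
      finally show ?case by (simp add: dist_norm)
    qed
  qed
qed

text \<open>On the domain of the square of \<open>C\<close>, \<open>W_taylor\<close> gives the
  derivative; resolvents and closedness extend this to \<open>C\<close>. Equality holds because the
  range condition leaves \<open>C\<close> no proper accretive extension.\<close>

lemma generator_W: "generator W = C"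
proof -
  interpret W: contraction_sg W by standard (rule W_contraction_semigroup)
  have 2: "(x, x1) \<in> W.G" if x: "(x, x1) \<in> C" "(x1, x2) \<in> C" for x x1 x2
    unfolding W.G_iff_eps
  proof (intro allI impI)
    fix e :: real assume e: "0 < e"
    define d where "d = e / (norm x2 + 1)"
    have d: "0 < d" using e by (auto simp: d_def add_nonneg_pos)
    have "norm (W h x - x + h *\<^sub>R x1) \<le> e * h" if h: "0 < h" "h < d" for h
    proof -
      have "h * norm x2 \<le> d * (norm x2 + 1)" using h by (intro mult_mono) auto
      also have "\<dots> = e" using add_nonneg_pos[OF norm_ge_zero zero_less_one, of x2] by (simp add: d_def)
      finally have "h * (h * norm x2) \<le> h * e" using h by (intro mult_left_mono) auto
      moreover have "norm (W h x - x + h *\<^sub>R x1) \<le> h * (h * norm x2)"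
        using W_taylor[OF x, of h] h by (simp add: power2_eq_square mult.assoc)
      ultimately show ?thesis by (simp add: mult.commute)
    qed
    then show "\<exists>d>0. \<forall>h. 0 < h \<longrightarrow> h < d \<longrightarrow> norm (W h x - x + h *\<^sub>R x1) \<le> e * h" using d by blast
  qed
  have 1: "(x, y) \<in> W.G" if xy: "(x, y) \<in> C" for x y
  proof (rule W.G_closed[OF J_tendsto_id J_tendsto_id])
    fix n
    let ?h = "h0 / real (Suc n)"
    have h: "0 \<le> ?h" "?h \<le> h0" "?h \<noteq> 0" using h0 by (auto simp: field_simps)
    show "(J ?h x, J ?h y) \<in> W.G" using J_C[OF xy h(1,2)] h(3) 2 by blast
  qed
  have "(x, y) \<in> C" if xy: "(x, y) \<in> W.G" for x y
  proof -
    obtain p q where pq: "(p, q) \<in> C" "p + h0 *\<^sub>R q = x + h0 *\<^sub>R y" using surj[OF h0 order_refl] by blast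
    have "(x - p, y - q) \<in> W.G" by (intro W.G_diff xy 1 pq)
    then have "inverse h0 * norm (x - p) \<le> norm (inverse h0 *\<^sub>R (x - p) + (y - q))"
      using h0 by (intro W.G_accretive) auto
    also have "inverse h0 *\<^sub>R (x - p) + (y - q) = inverse h0 *\<^sub>R ((x + h0 *\<^sub>R y) - (p + h0 *\<^sub>R q))"
      using h0 by (simp add: scaleR_right_diff_distrib scaleR_add_right)
    also have "\<dots> = 0" by (simp add: pq)
    finally have "x = p" using h0 by (simp add: mult_le_0_iff)
    moreover have "y = q" using pq(2) h0 by (simp add: \<open>x = p\<close>)
    ultimately show ?thesis using pq by simp
  qed
  with 1 show ?thesis by (auto simp: W.G_def)
qed

end

section \<open>Smoothing of holomorphic semigroups and the adjoint condition\<close>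

text \<open>The complex-linear functional \<open>u(x) - i u(i x)\<close> with real part
  \<open>u\<close>. It turns real norming functionals into the complex ones that Cauchy's estimate
  and the adjoints require.\<close>

definition complex_extension :: "('a::complex_banach \<Rightarrow> real) \<Rightarrow> 'a \<Rightarrow> complex"
  where "complex_extension u x = Complex (u x) (- u (\<i> *\<^sub>C x))"

lemma Re_complex_extension [simp]: "Re (complex_extension u x) = u x"
  by (simp add: complex_extension_def)

lemma complex_extension_bounded_clinear:
  assumes "bounded_linear u"
  shows "bounded_clinear (complex_extension u :: 'a::complex_banach \<Rightarrow> complex)"
proof -
  interpret u: bounded_linear u by (rule assms)
  interpret i: bounded_linear "(\<lambda>x. \<i> *\<^sub>C x) :: 'a \<Rightarrow> 'a" by (rule bounded_linear_scaleC)
  have "complex_extension u = (\<lambda>x. complex_of_real (u x) - \<i> * complex_of_real (u (\<i> *\<^sub>C x)))"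
    by (auto simp: complex_extension_def complex_eq_iff)
  moreover have "bounded_linear (\<lambda>x. complex_of_real (u x) - \<i> * complex_of_real (u (\<i> *\<^sub>C x)))"
    by (intro bounded_linear_sub bounded_linear_mult_right[THEN bounded_linear_compose]
        bounded_linear_of_real[THEN bounded_linear_compose] assms bounded_linear_compose[OF assms bounded_linear_scaleC])
  moreover have "complex_extension u (c *\<^sub>C x) = c * complex_extension u x" for c x
  proof -
    have 1: "c *\<^sub>C x = Re c *\<^sub>R x + Im c *\<^sub>R (\<i> *\<^sub>C x)"
    proof -
      have "c = complex_of_real (Re c) + complex_of_real (Im c) * \<i>" by (simp add: complex_eq_iff)
      then have "c *\<^sub>C x = (complex_of_real (Re c) + complex_of_real (Im c) * \<i>) *\<^sub>C x" by simp
      also have "\<dots> = Re c *\<^sub>R x + Im c *\<^sub>R (\<i> *\<^sub>C x)"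
        by (simp only: scaleC_add_left scaleC_of_real flip: scaleC_scaleC)
      finally show ?thesis .
    qed
    have ii: "\<i> *\<^sub>C \<i> *\<^sub>C x = - x"
    proof -
      have "\<i> *\<^sub>C \<i> *\<^sub>C x = complex_of_real (-1) *\<^sub>C x" by (simp add: scaleC_scaleC)
      also have "\<dots> = - x" by (subst scaleC_of_real) simp
      finally show ?thesis .
    qed
    show ?thesis unfolding 1
      by (auto simp: complex_extension_def complex_eq_iff u.add u.scaleR i.add i.scaleR ii u.neg u.diff algebra_simps)
  qed
  ultimately show ?thesis by (simp add: bounded_clinear_def scaleC_complex_def)
qed

text \<open>Sectors are invariant under positive dilations, so the radius can be proportional to
  \<open>t\<close>. The bound on the angle comes from halving an angle of at most
  \<open>pi / 2\<close> and keeps the tangent finite.\<close>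

lemma ball_subset_sector:
  assumes th: "0 < \<theta>" "\<theta> \<le> pi / 4"
  shows "\<exists>\<rho>>0. \<rho> < 1 \<and> (\<forall>t>0. ball (complex_of_real t) (\<rho> * t) \<subseteq> sector \<theta>)"
proof -
  define k where "k = tan \<theta>"
  have thpi: "\<theta> < pi / 2" using th pi_gt_zero by linarith
  have k: "0 < k" unfolding k_def using th thpi by (intro tan_gt_zero) auto
  \<comment> \<open>The solution of \<open>\<rho> = k * (1 - \<rho>)\<close>: the slope bound
    \<open>\<rho> t / ((1 - \<rho>) t)\<close> for points of the ball is then \<open>k\<close>, the
    slope of the edge of the sector.\<close>
  define \<rho> where "\<rho> = k / (1 + k)"
  have \<rho>: "0 < \<rho>" "\<rho> < 1" "\<rho> = k * (1 - \<rho>)" using k by (auto simp: \<rho>_def field_simps)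
  have "w \<in> sector \<theta>" if t: "0 < t" and w: "w \<in> ball (complex_of_real t) (\<rho> * t)" for t w
  proof -
    have n: "cmod (w - complex_of_real t) < \<rho> * t" using w by (simp add: dist_norm norm_minus_commute)
    have "\<bar>Re w - t\<bar> < \<rho> * t" using abs_Re_le_cmod[of "w - complex_of_real t"] n by simp
    then have re: "(1 - \<rho>) * t < Re w" by (simp add: algebra_simps)
    have im: "\<bar>Im w\<bar> < \<rho> * t" using abs_Im_le_cmod[of "w - complex_of_real t"] n by simp
    have pos: "0 < Re w" using re t \<rho> by (smt (verit) mult_pos_pos)
    have "\<bar>Im w\<bar> < k * ((1 - \<rho>) * t)" using im \<rho>(3) by (metis mult.assoc)
    also have "\<dots> < k * Re w" using re k by simp
    finally have "\<bar>Im w / Re w\<bar> < k" using pos by (simp add: abs_divide field_simps)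
    then have "- k < Im w / Re w" "Im w / Re w < k" by linarith+
    then have "arctan (- k) < arctan (Im w / Re w)" "arctan (Im w / Re w) < arctan k"
      using arctan_less_iff by auto
    moreover have "arctan k = \<theta>" unfolding k_def using th thpi by (intro arctan_tan) auto
    moreover have "Arg w = arctan (Im w / Re w)" using pos by (rule arg_conv_arctan)
    ultimately have "\<bar>Arg w\<bar> < \<theta>" by (simp add: arctan_minus)
    then show ?thesis using pos by (auto simp: sector_def)
  qed
  then show ?thesis using \<rho> by blast
qed

text \<open>Cauchy's estimate for the scalar function \<open>f (U w x)\<close> on a disc about
  \<open>t\<close> of radius proportional to \<open>t\<close>. A norming functional for the
  derivative \<open>D x\<close>, which is minus the generator at \<open>U t x\<close>, brings the
  bound back to norms.\<close>

theorem analytic_smoothing: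
  fixes U :: "complex \<Rightarrow> 'a::complex_banach \<Rightarrow> 'a"
  assumes hol: "holomorphic_contraction_semigroup \<theta> U"
  shows "\<exists>c\<ge>0. \<forall>t>0. \<forall>x. \<exists>y. (U (complex_of_real t) x, y) \<in> generator (\<lambda>t. U (complex_of_real t))
    \<and> norm y \<le> c / t * norm x"
proof -
  have b: "bounded_holomorphic_semigroup \<theta> U" and c: "contraction_semigroup (\<lambda>t. U (complex_of_real t))"
    using hol by (auto simp: holomorphic_contraction_semigroup_def)
  interpret contraction_sg "\<lambda>t. U (complex_of_real t)" by standard (rule c)
  have th: "0 < \<theta>" "\<theta> \<le> pi / 2" using b by (auto simp: bounded_holomorphic_semigroup_def)
  have "0 < \<theta> / 2 \<and> \<theta> / 2 < \<theta>" using th by simp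
  then obtain M0 where "\<forall>z\<in>sector (\<theta> - \<theta> / 2). onorm (U z) \<le> M0"
    using b unfolding bounded_holomorphic_semigroup_def by meson
  then have M0: "\<And>z. z \<in> sector (\<theta> / 2) \<Longrightarrow> onorm (U z) \<le> M0" by simp
  define M where "M = max M0 0"
  have sub: "sector (\<theta> / 2) \<subseteq> sector \<theta>" using th by (auto simp: sector_def)
  have Ulin: "bounded_clinear (U z)" if "z \<in> sector \<theta>" for z
    using b that by (auto simp: bounded_holomorphic_semigroup_def)
  have UM: "norm (U z x) \<le> M * norm x" if "z \<in> sector (\<theta> / 2)" for z x
  proof -
    have "norm (U z x) \<le> onorm (U z) * norm x"
      using Ulin that sub by (intro onorm) (auto simp: bounded_clinear_def)
    also have "\<dots> \<le> M * norm x" using M0[OF that] by (intro mult_right_mono) (auto simp: M_def)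
    finally show ?thesis .
  qed
  have holo: "\<exists>D. bounded_clinear D \<and>
      (\<forall>x. ((\<lambda>w. inverse (w - z) *\<^sub>C (U w x - U z x)) \<longlongrightarrow> D x) (at z within sector \<theta>))"
    if z: "z \<in> sector \<theta>" for z
  proof -
    obtain D where D: "bounded_clinear D"
      "((\<lambda>w. onorm (\<lambda>x. inverse (w - z) *\<^sub>C (U w x - U z x) - D x)) \<longlongrightarrow> 0) (at z within sector \<theta>)"
      using b z unfolding bounded_holomorphic_semigroup_def op_holomorphic_on_def by meson
    have "((\<lambda>w. inverse (w - z) *\<^sub>C (U w x - U z x)) \<longlongrightarrow> D x) (at z within sector \<theta>)" for x
    proof -
      have "((\<lambda>w. inverse (w - z) *\<^sub>C (U w x - U z x) - D x) \<longlongrightarrow> 0) (at z within sector \<theta>)"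
      proof (rule Lim_null_comparison)
        show "((\<lambda>w. onorm (\<lambda>x. inverse (w - z) *\<^sub>C (U w x - U z x) - D x) * norm x) \<longlongrightarrow> 0) (at z within sector \<theta>)"
          by (rule tendsto_mult_left_zero[OF D(2)])
        show "\<forall>\<^sub>F w in at z within sector \<theta>. norm (inverse (w - z) *\<^sub>C (U w x - U z x) - D x)
            \<le> onorm (\<lambda>x. inverse (w - z) *\<^sub>C (U w x - U z x) - D x) * norm x"
        proof (rule eventually_at_topological[THEN iffD2], intro exI[of _ UNIV] conjI ballI impI)
          fix w assume w: "w \<in> sector \<theta>"
          have "bounded_linear (\<lambda>x. inverse (w - z) *\<^sub>C (U w x - U z x) - D x)"
            using Ulin[OF w] Ulin[OF z] D(1)
            by (intro bounded_linear_sub bounded_linear_compose[OF bounded_linear_scaleC])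
              (auto simp: bounded_clinear_def)
          from onorm[OF this, of x]
          show "norm (inverse (w - z) *\<^sub>C (U w x - U z x) - D x)
            \<le> onorm (\<lambda>x. inverse (w - z) *\<^sub>C (U w x - U z x) - D x) * norm x" by simp
        qed auto
      qed
      then show ?thesis by (simp add: LIM_zero_iff)
    qed
    then show ?thesis using D(1) by blast
  qed
  obtain \<rho> where \<rho>: "0 < \<rho>" "\<rho> < 1" "\<And>t. 0 < t \<Longrightarrow> ball (complex_of_real t) (\<rho> * t) \<subseteq> sector (\<theta> / 2)"
    using ball_subset_sector[of "\<theta> / 2"] th by auto
  \<comment> \<open>One factor 2 is the crude bound \<open>f2\<close> of the complexified
    functional, the other comes from the radius \<open>\<rho> t / 2\<close>, which keeps the closed
    disc inside the sector.\<close>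
  define c where "c = 4 * M / \<rho>"
  have main: "\<exists>y. (U (complex_of_real t) x, y) \<in> G \<and> norm y \<le> c / t * norm x" if t: "0 < t" for t x
  proof -
    let ?z = "complex_of_real t"
    have z: "?z \<in> sector \<theta>" using t th by (auto simp: sector_def)
    obtain D where D: "bounded_clinear D"
      "\<And>x. ((\<lambda>w. inverse (w - ?z) *\<^sub>C (U w x - U ?z x)) \<longlongrightarrow> D x) (at ?z within sector \<theta>)"
      using holo[OF z] by blast
    have G: "(U ?z x, - D x) \<in> G"
    proof -
      \<comment> \<open>The complex derivative is taken along the real direction from the right,
        where the semigroup law turns it into the difference quotient of the generator.\<close>
      have f: "filterlim (\<lambda>h. complex_of_real (h + t)) (at ?z within sector \<theta>) (at_right 0)"
        unfolding filterlim_at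
      proof (intro conjI)
        show "\<forall>\<^sub>F h in at_right 0. complex_of_real (h + t) \<in> sector \<theta> \<and> complex_of_real (h + t) \<noteq> ?z"
          using eventually_at_right_less[of "0::real"]
          by eventually_elim (use t th in \<open>auto simp: sector_def simp del: of_real_add\<close>)
        have "((\<lambda>h. complex_of_real (h + t)) \<longlongrightarrow> complex_of_real (0 + t)) (at_right 0)"
          by (intro tendsto_intros)
        then show "((\<lambda>h. complex_of_real (h + t)) \<longlongrightarrow> ?z) (at_right 0)" by simp
      qed
      have "((\<lambda>h. inverse (complex_of_real (h + t) - ?z) *\<^sub>C (U (complex_of_real (h + t)) x - U ?z x)) \<longlongrightarrow> D x) (at_right 0)"
        by (rule filterlim_compose[OF D(2) f])
      moreover have "\<forall>\<^sub>F h in at_right 0. inverse (complex_of_real (h + t) - ?z) *\<^sub>C (U (complex_of_real (h + t)) x - U ?z x)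
          = (U (complex_of_real h) (U ?z x) - U ?z x) /\<^sub>R h"
        using eventually_at_right_less[of "0::real"]
      proof eventually_elim
        case (elim h)
        have "inverse (complex_of_real (h + t) - ?z) = complex_of_real (inverse h)" by simp
        then show ?case using add[of h t x] elim t by (simp only: scaleC_of_real less_imp_le)
      qed
      ultimately have "((\<lambda>h. (U (complex_of_real h) (U ?z x) - U ?z x) /\<^sub>R h) \<longlongrightarrow> D x) (at_right 0)"
        by (rule Lim_transform_eventually)
      then show ?thesis by (simp add: G_def generator_def)
    qed
    obtain u where u: "bounded_linear u" "\<And>y. \<bar>u y\<bar> \<le> norm y" "u (D x) = norm (D x)"
      using norming_functional[of "D x"] by blast
    define f where "f = (complex_extension u :: 'a \<Rightarrow> complex)"
    have f: "bounded_clinear f" unfolding f_def by (rule complex_extension_bounded_clinear[OF u(1)])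
    have fb: "bounded_linear f" and fc: "\<And>c y. f (c *\<^sub>C y) = c * f y"
      using f by (auto simp: bounded_clinear_def scaleC_complex_def)
    interpret f: bounded_linear f by (rule fb)
    have f2: "cmod (f y) \<le> 2 * norm y" for y
    proof -
      have "cmod (f y) \<le> \<bar>u y\<bar> + \<bar>u (\<i> *\<^sub>C y)\<bar>" using cmod_le[of "f y"] by (simp add: f_def complex_extension_def)
      also have "\<dots> \<le> norm y + norm (\<i> *\<^sub>C y)" by (intro add_mono u)
      finally show ?thesis by (simp add: norm_scaleC)
    qed
    define g where "g w = f (U w x)" for w
    have gder: "(g has_field_derivative f (D' x)) (at w within sector \<theta>)"
      if "\<And>x. ((\<lambda>v. inverse (v - w) *\<^sub>C (U v x - U w x)) \<longlongrightarrow> D' x) (at w within sector \<theta>)" for D' w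
    proof -
      have "((\<lambda>v. f (inverse (v - w) *\<^sub>C (U v x - U w x))) \<longlongrightarrow> f (D' x)) (at w within sector \<theta>)"
        by (rule f.tendsto[OF that])
      then show ?thesis
        by (simp add: has_field_derivative_iff fc f.diff g_def divide_inverse mult.commute)
    qed
    define r where "r = \<rho> * t / 2"
    have r: "0 < r" using \<rho> t by (simp add: r_def)
    have cb: "cball ?z r \<subseteq> sector (\<theta> / 2)"
      using \<rho>(3)[OF t] r by (fastforce simp: r_def)
    have "g holomorphic_on sector \<theta>"
      unfolding holomorphic_on_def field_differentiable_def using gder holo by blast
    then have gh: "g holomorphic_on cball ?z r" using cb sub holomorphic_on_subset by blast
    have "cmod ((deriv ^^ 1) g ?z) \<le> fact 1 * (2 * (M * norm x)) / r ^ 1"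
    proof (rule Cauchy_inequality[OF _ _ r])
      show "g holomorphic_on ball ?z r" using gh holomorphic_on_subset ball_subset_cball by blast
      show "continuous_on (cball ?z r) g" by (rule holomorphic_on_imp_continuous_on[OF gh])
      fix w assume w: "cmod (?z - w) = r"
      then have "w \<in> sector (\<theta> / 2)" using cb by (auto simp: dist_norm)
      then show "cmod (g w) \<le> 2 * (M * norm x)"
        using f2[of "U w x"] UM[of w x] by (simp add: g_def)
    qed
    moreover have "deriv g ?z = f (D x)"
    proof (rule DERIV_imp_deriv)
      have "(g has_field_derivative f (D x)) (at ?z within ball ?z r)"
        by (rule DERIV_subset[OF gder[OF D(2)]]) (rule order_trans[OF ball_subset_cball order_trans[OF cb sub]])
      then show "(g has_field_derivative f (D x)) (at ?z)" using r by (metis at_within_open centre_in_ball open_ball)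
    qed
    ultimately have "cmod (f (D x)) \<le> 2 * (M * norm x) / r" by simp
    moreover have "norm (D x) \<le> cmod (f (D x))"
      using complex_Re_le_cmod[of "f (D x)"] u(3) by (simp add: f_def)
    ultimately have "norm (- D x) \<le> c / t * norm x" by (simp add: c_def r_def field_simps)
    then show ?thesis using G by blast
  qed
  have "0 \<le> c" using \<rho> by (simp add: c_def M_def)
  then show ?thesis using main unfolding G_def by blast
qed

text \<open>For every functional \<open>f\<close>, \<open>f o R\<close> lies in the domain of the
  adjoint of the first generator, with image \<open>f - f o R\<close>, hence in the domain of the
  second adjoint. This bounds \<open>f (R z)\<close> over the graph of \<open>generator V\<close>
  above the unit ball, for each \<open>f\<close> separately. Uniform boundedness on the real dual
  makes the bound uniform, and norming functionals give \<open>norm (R z)\<close>.\<close>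

theorem resolvent_times_bounded:
  fixes S V :: "real \<Rightarrow> 'a::complex_banach \<Rightarrow> 'a"
  assumes S: "contraction_semigroup S" and V: "contraction_semigroup V"
    and adj: "Domain (adjoint_op (generator S)) \<subseteq> Domain (adjoint_op (generator V))"
    and R: "bounded_clinear R" "\<And>x y. (x, y) \<in> generator S \<Longrightarrow> R (x + y) = x"
  shows "\<exists>K\<ge>0. \<forall>(x, z)\<in>generator V. norm (R z) \<le> K * norm x"
proof -
  interpret V: contraction_sg V by standard (rule V)
  have Rb: "bounded_linear R" and Rc: "\<And>c x. R (c *\<^sub>C x) = c *\<^sub>C R x" using R(1) by (auto simp: bounded_clinear_def)
  interpret R: bounded_linear R by (rule Rb)
  \<comment> \<open>The graph over the unit ball is only an index set; the operators are the
    evaluations \<open>u \<mapsto> u (R z)\<close> on the dual space.\<close>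
  define I where "I = {p \<in> V.G. norm (fst p) \<le> 1}"
  have pw: "\<exists>M. \<forall>p\<in>I. norm (blinfun_apply u (R (snd p))) \<le> M" for u :: "'a \<Rightarrow>\<^sub>L real"
  proof -
    define f where "f = (complex_extension (blinfun_apply u) :: 'a \<Rightarrow> complex)"
    have f: "bounded_clinear f" unfolding f_def
      by (rule complex_extension_bounded_clinear) (rule blinfun.bounded_linear_right)
    have fb: "bounded_linear f" and fc: "\<And>c y. f (c *\<^sub>C y) = c *\<^sub>C f y"
      using f by (auto simp: bounded_clinear_def)
    interpret f: bounded_linear f by (rule fb)
    have 1: "bounded_clinear (\<lambda>x. f (R x))"
      unfolding bounded_clinear_def by (auto intro: bounded_linear_compose[OF fb Rb] simp: Rc fc)
    have 2: "bounded_clinear (\<lambda>x. f x - f (R x))"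
      unfolding bounded_clinear_def
      by (auto intro!: bounded_linear_sub fb bounded_linear_compose[OF fb Rb] simp: Rc fc)
         (simp add: scaleC_complex_def algebra_simps)
    have "f (R y) = f x - f (R x)" if "(x, y) \<in> generator S" for x y
      proof -
      have "R y = x - R x" using R(2)[OF that] by (simp add: R.add eq_diff_eq add.commute)
      then show ?thesis by (simp add: f.diff)
    qed
    then have "((\<lambda>x. f (R x)), (\<lambda>x. f x - f (R x))) \<in> adjoint_op (generator S)"
      using 1 2 by (auto simp: adjoint_op_def)
    then obtain k where k: "((\<lambda>x. f (R x)), k) \<in> adjoint_op (generator V)" using adj by blast
    then have kb: "bounded_linear k" by (auto simp: adjoint_op_def bounded_clinear_def)
    have "norm (blinfun_apply u (R (snd p))) \<le> onorm k" if p: "p \<in> I" for p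
    proof -
      have "f (R (snd p)) = k (fst p)" using k p by (auto simp: adjoint_op_def I_def V.G_def)
      then have "blinfun_apply u (R (snd p)) = Re (k (fst p))" by (metis Re_complex_extension f_def)
      then have "norm (blinfun_apply u (R (snd p))) \<le> cmod (k (fst p))" by (simp add: abs_Re_le_cmod)
      also have "\<dots> \<le> onorm k * norm (fst p)" by (rule onorm[OF kb])
      also have "\<dots> \<le> onorm k * 1" using p by (intro mult_left_mono onorm_pos_le[OF kb]) (auto simp: I_def)
      finally show ?thesis by simp
    qed
    then show ?thesis by blast
  qed
  have "\<exists>C\<ge>0. \<forall>p\<in>I. \<forall>u\<in>(UNIV :: ('a \<Rightarrow>\<^sub>L real) set). norm (blinfun_apply u (R (snd p))) \<le> C * norm u"
    using uniform_boundedness[where T = "\<lambda>p u. blinfun_apply u (R (snd p))" and G = UNIV and I = I,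
      OF closed_UNIV subspace_UNIV blinfun.bounded_linear_left pw] .
  then obtain K where K: "0 \<le> K" "\<And>p (u :: 'a \<Rightarrow>\<^sub>L real). p \<in> I \<Longrightarrow> norm (blinfun_apply u (R (snd p))) \<le> K * norm u" by blast
  have 1: "norm (R z) \<le> K" if "(x, z) \<in> V.G" "norm x \<le> 1" for x z
  proof -
    obtain u where u: "bounded_linear u" "\<And>y. \<bar>u y\<bar> \<le> norm y" "u (R z) = norm (R z)"
      using norming_functional[of "R z"] by blast
    have "norm (Blinfun u) \<le> 1"
      using u by (intro norm_blinfun_bound) (auto simp: bounded_linear_Blinfun_apply)
    have "norm (R z) = norm (blinfun_apply (Blinfun u) (R (snd (x, z))))"
      using u by (simp add: bounded_linear_Blinfun_apply)
    also have "\<dots> \<le> K * norm (Blinfun u)" using that by (intro K) (auto simp: I_def)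
    also have "\<dots> \<le> K * 1" using K \<open>norm (Blinfun u) \<le> 1\<close> by (intro mult_left_mono) auto
    finally show ?thesis by simp
  qed
  have "norm (R z) \<le> K * norm x" if xz: "(x, z) \<in> V.G" for x z
  proof (cases "x = 0")
    case True
    then have "z = 0" using V.G_unique[OF xz] V.G_zero by auto
    then show ?thesis using True by (simp add: R.zero)
  next
    case False
    have "norm (R (inverse (norm x) *\<^sub>R z)) \<le> K"
      by (rule 1[OF V.G_scaleR[OF xz]]) (use False in auto)
    then show ?thesis using False by (simp add: R.scaleR field_simps)
  qed
  then show ?thesis using K(1) by (auto simp: V.G_def)
qed

section \<open>The fractional power and relative boundedness\<close>

text \<open>The substitution \<open>u = l powr (1 - \<alpha>)\<close> removes the singularity at
  \<open>0\<close>: an antiderivative is \<open>Q (l powr (1 - \<alpha>))\<close> with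
  \<open>Q\<close> a primitive of a continuous function.\<close>

lemma integrable_powr_scaleR_continuous:
  fixes q :: "real \<Rightarrow> 'a::banach"
  assumes q: "continuous_on {0..b} q" and b: "0 \<le> b" and a: "\<alpha> < 1"
  shows "(\<lambda>l. l powr - \<alpha> *\<^sub>R q l) integrable_on {0..b}"
proof (cases "b = 0")
  case True then show ?thesis by (metis box_real(2) integrable_on_refl)
next
  case False
  then have b: "0 < b" using b by simp
  \<comment> \<open>The inverse exponent of the substitution, as \<open>pp\<close> records.\<close>
  define p where "p = 1 / (1 - \<alpha>)"
  define c where "c = b powr (1 - \<alpha>)"
  have p: "0 < p" using a by (simp add: p_def)
  have pp: "(l powr (1 - \<alpha>)) powr p = l" if "0 \<le> l" for l :: real
    using a that by (simp add: p_def powr_powr)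
  have cb: "c powr p = b" using pp b by (simp add: c_def)
  have cq: "continuous_on {0..c} (\<lambda>u. q (u powr p) /\<^sub>R (1 - \<alpha>))"
  proof -
    have "continuous_on {0..c} (\<lambda>u. u powr p)" using p by (intro continuous_on_powr' continuous_intros) auto
    moreover have "(\<lambda>u. u powr p) ` {0..c} \<subseteq> {0..b}"
      using p by (auto intro!: powr_mono2 simp flip: cb)
    ultimately have "continuous_on {0..c} (\<lambda>u. q (u powr p))" by (rule continuous_on_compose2[OF q])
    then show ?thesis by (intro continuous_intros)
  qed
  define Q where "Q v = integral {0..v} (\<lambda>u. q (u powr p) /\<^sub>R (1 - \<alpha>))" for v
  have Q: "(Q has_vector_derivative q (v powr p) /\<^sub>R (1 - \<alpha>)) (at v within {0..c})" if "v \<in> {0..c}" for v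
    unfolding Q_def by (rule integral_has_vector_derivative[OF cq that])
  have le: "l powr (1 - \<alpha>) \<le> c" if "0 \<le> l" "l \<le> b" for l
    unfolding c_def using that a by (intro powr_mono2) auto
  have "((\<lambda>l. l powr - \<alpha> *\<^sub>R q l) has_integral Q (b powr (1 - \<alpha>)) - Q (0 powr (1 - \<alpha>))) {0..b}"
  proof (rule fundamental_theorem_of_calculus_interior)
    have "continuous_on {0..c} Q"
      unfolding continuous_on_eq_continuous_within using Q has_vector_derivative_continuous by blast
    moreover have "continuous_on {0..b} (\<lambda>l. l powr (1 - \<alpha>))"
      using a by (intro continuous_on_powr' continuous_intros) auto
    ultimately show "continuous_on {0..b} (\<lambda>l. Q (l powr (1 - \<alpha>)))"
      by (rule continuous_on_compose2) (auto intro: le)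
    fix l assume l: "l \<in> {0<..<b}"
    have lt: "l powr (1 - \<alpha>) < c" unfolding c_def using l a by (intro powr_less_mono2) auto
    have "at (l powr (1 - \<alpha>)) within {0..c} = at (l powr (1 - \<alpha>))"
      using lt l by (intro at_within_interior) auto
    then have 1: "(Q has_vector_derivative q l /\<^sub>R (1 - \<alpha>)) (at (l powr (1 - \<alpha>)))"
      using Q[of "l powr (1 - \<alpha>)"] lt l pp[of l] by simp
    have "((\<lambda>l. l powr (1 - \<alpha>)) has_field_derivative (1 - \<alpha>) * l powr - \<alpha>) (at l)"
      using l by (auto intro!: derivative_eq_intros)
    then have 2: "((\<lambda>l. l powr (1 - \<alpha>)) has_vector_derivative (1 - \<alpha>) * l powr - \<alpha>) (at l)"
      by (simp add: has_real_derivative_iff_has_vector_derivative)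
    show "((\<lambda>l. Q (l powr (1 - \<alpha>))) has_vector_derivative l powr - \<alpha> *\<^sub>R q l) (at l)"
    proof -
      have "((1 - \<alpha>) * l powr - \<alpha>) *\<^sub>R (q l /\<^sub>R (1 - \<alpha>)) = ((1 - \<alpha>) / (1 - \<alpha>) * l powr - \<alpha>) *\<^sub>R q l"
        by (simp add: divide_inverse mult.commute mult.left_commute)
      also have "\<dots> = l powr - \<alpha> *\<^sub>R q l" using a by simp
      finally show ?thesis using vector_diff_chain_at[OF 2 1] by (simp only: o_def)
    qed
  qed (use b in auto)
  then show ?thesis by blast
qed

lemma subspace_closure:
  fixes P :: "'a::real_normed_vector set"
  assumes P: "subspace P"
  shows "subspace (closure P)"
  unfolding subspace_def
proof (intro conjI ballI allI)
  show "0 \<in> closure P" using closure_subset[of P] subspace_0[OF P] by blast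
  fix x assume "x \<in> closure P"
  then obtain X where X: "\<And>n. X n \<in> P" "X \<longlonglongrightarrow> x" by (auto simp: closure_sequential)
  show "c *\<^sub>R x \<in> closure P" for c
    unfolding closure_sequential
    using X(1) tendsto_scaleR[OF tendsto_const X(2)] subspace_scale[OF P]
    by (intro exI[of _ "\<lambda>n. c *\<^sub>R X n"]) auto
  fix y assume "y \<in> closure P"
  then obtain Y where Y: "\<And>n. Y n \<in> P" "Y \<longlonglongrightarrow> y" by (auto simp: closure_sequential)
  show "x + y \<in> closure P"
    unfolding closure_sequential
    using X Y tendsto_add[OF X(2) Y(2)] subspace_add[OF P]
    by (intro exI[of _ "\<lambda>n. X n + Y n"]) auto
qed

context contraction_sg
begin

text \<open>The integrand is cut at \<open>\<delta>\<close>: below, \<open>S l x - x\<close> is at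
  most \<open>l * norm y\<close>, which leaves the integrable \<open>l powr - \<alpha>\<close>;
  above, it is at most \<open>2 * norm x\<close>. The cut stays free so that it can be matched later
  to a time scale.\<close>

lemma frac_integral:
  assumes xy: "(x, y) \<in> G" and a: "0 < \<alpha>" "\<alpha> < 1"
  shows "\<exists>I. ((\<lambda>l. l powr (- \<alpha> - 1) *\<^sub>R (S l x - x)) has_integral I) {0<..} \<and>
    (\<forall>\<delta>>0. norm I \<le> \<delta> powr (1 - \<alpha>) / (1 - \<alpha>) * norm y + 2 * \<delta> powr - \<alpha> / \<alpha> * norm x)"
proof -
  define h where "h l = l powr (- \<alpha> - 1) *\<^sub>R (S l x - x)" for l
  define g where "g \<delta> l = (if l \<le> \<delta> then l powr - \<alpha> * norm y else l powr (- \<alpha> - 1) * (2 * norm x))" for \<delta> l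
  have hg: "norm (h l) \<le> g \<delta> l" if "0 < l" for \<delta> l
  proof -
    have 1: "norm (S l x - x) \<le> norm y * l" using norm_diff_le[OF xy] that by simp
    have 2: "norm (S l x - x) \<le> 2 * norm x"
      using norm_triangle_ineq4[of "S l x" x] norm_le[of l x] that by simp
    have "norm (h l) = l powr (- \<alpha> - 1) * norm (S l x - x)" by (simp add: h_def)
    moreover have "l powr (- \<alpha> - 1) * norm (S l x - x) \<le> l powr (- \<alpha> - 1) * (norm y * l)"
      by (intro mult_left_mono 1) auto
    moreover have "l powr (- \<alpha> - 1) * (norm y * l) = l powr - \<alpha> * norm y"
      using that by (simp add: powr_diff)
    moreover have "l powr (- \<alpha> - 1) * norm (S l x - x) \<le> l powr (- \<alpha> - 1) * (2 * norm x)"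
      by (intro mult_left_mono 2) auto
    ultimately show ?thesis by (auto simp: g_def)
  qed
  have gi: "(g \<delta> has_integral \<delta> powr (1 - \<alpha>) / (1 - \<alpha>) * norm y + 2 * \<delta> powr - \<alpha> / \<alpha> * norm x) {0<..}"
    if d: "0 < \<delta>" for \<delta>
  proof -
    have "((\<lambda>l. l powr - \<alpha> * norm y) has_integral (\<delta> powr (- \<alpha> + 1) / (- \<alpha> + 1)) * norm y) {0..\<delta>}"
      using a d by (intro has_integral_mult_left has_integral_powr_from_0) auto
    then have 1: "(g \<delta> has_integral (\<delta> powr (- \<alpha> + 1) / (- \<alpha> + 1)) * norm y) {0..\<delta>}"
      by (rule has_integral_eq[rotated]) (auto simp: g_def)
    have "((\<lambda>l. l powr (- \<alpha> - 1) * (2 * norm x)) has_integral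
        (- (\<delta> powr (- \<alpha> - 1 + 1)) / (- \<alpha> - 1 + 1)) * (2 * norm x)) {\<delta>..}"
      using a d by (intro has_integral_mult_left has_integral_powr_to_inf) auto
    then have 2: "(g \<delta> has_integral (- (\<delta> powr (- \<alpha> - 1 + 1)) / (- \<alpha> - 1 + 1)) * (2 * norm x)) {\<delta>..}"
      by (rule has_integral_spike[of "{\<delta>}", rotated 2]) (auto simp: g_def)
    have "{0..\<delta>} \<inter> {\<delta>..} = {\<delta>}" using d by auto
    then have "(g \<delta> has_integral (\<delta> powr (- \<alpha> + 1) / (- \<alpha> + 1)) * norm y
        + (- (\<delta> powr (- \<alpha> - 1 + 1)) / (- \<alpha> - 1 + 1)) * (2 * norm x)) ({0..\<delta>} \<union> {\<delta>..})"
      by (intro has_integral_Un 1 2) auto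
    then have "(g \<delta> has_integral (\<delta> powr (- \<alpha> + 1) / (- \<alpha> + 1)) * norm y
        + (- (\<delta> powr (- \<alpha> - 1 + 1)) / (- \<alpha> - 1 + 1)) * (2 * norm x)) {0<..}"
    proof (rule has_integral_spike_set_eq[THEN iffD1, rotated 2])
      have "({0..\<delta>} \<union> {\<delta>..} - {0<..}) \<subseteq> {0}" using d by auto
      then show "negligible {l \<in> {0..\<delta>} \<union> {\<delta>..} - {0<..}. g \<delta> l \<noteq> 0}"
        by (intro negligible_subset[OF negligible_sing[of 0]]) auto
      show "negligible {l \<in> {0<..} - ({0..\<delta>} \<union> {\<delta>..}). g \<delta> l \<noteq> 0}"
        by (rule negligible_subset[OF negligible_empty]) (use d in auto)
    qed
    then show ?thesis by (simp add: mult_ac)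
  qed
  have "h integrable_on {0<..}"
  proof (rule integrable_on_all_intervals_integrable_bound[OF _ hg])
    show "g 1 integrable_on {0<..}" using gi[of 1] by (auto simp: integrable_on_def)
    fix a' b' :: real
    define b where "b = max \<bar>a'\<bar> \<bar>b'\<bar>"
    have b: "0 \<le> b" by (simp add: b_def)
    \<comment> \<open>The difference quotient, continued by its limit \<open>- y\<close> at
      \<open>0\<close>; the integrand is \<open>l powr - \<alpha>\<close> times this continuous
      function.\<close>
    define q where "q l = (if l = 0 then - y else (S l x - x) /\<^sub>R l)" for l
    have cq: "continuous_on {0..b} q"
      unfolding continuous_on_eq_continuous_within
    proof
      fix l assume l: "l \<in> {0..b}"
      show "continuous (at l within {0..b}) q"
      proof (cases "l = 0")
        case True
        have "((\<lambda>t. (S t x - x) /\<^sub>R t) \<longlongrightarrow> - y) (at 0 within {0..})"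
          using xy by (simp add: G_def generator_def at_within_Ici_at_right)
        then have "((\<lambda>t. (S t x - x) /\<^sub>R t) \<longlongrightarrow> - y) (at 0 within {0..b})"
          by (rule tendsto_within_subset) auto
        then have "(q \<longlongrightarrow> - y) (at 0 within {0..b})"
          by (rule Lim_transform_within[where d = 1]) (auto simp: q_def)
        then show ?thesis using True by (simp add: continuous_within q_def)
      next
        case False
        then have l0: "0 < l" using l by auto
        have "continuous (at l) (\<lambda>t. S t x)"
          using has_vector_derivative_continuous[OF deriv_at[OF xy l0]] .
        then have "continuous (at l) (\<lambda>t. (S t x - x) /\<^sub>R t)"
          using l0 by (intro continuous_intros) auto
        then have c: "continuous (at l within {0..b}) (\<lambda>t. (S t x - x) /\<^sub>R t)"
          by (rule continuous_at_imp_continuous_within)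
        show ?thesis
          by (rule continuous_transform_within[OF c l0 l]) (auto simp: q_def dist_real_def)
      qed
    qed
    have "(\<lambda>l. l powr - \<alpha> *\<^sub>R q l) integrable_on {0..b}"
      by (rule integrable_powr_scaleR_continuous[OF cq b a(2)])
    then have 1: "(\<lambda>l. if l \<in> {0<..} then h l else 0) integrable_on {0..b}"
      by (rule integrable_spike[of _ _ "{0}"]) (auto simp: h_def q_def powr_diff divide_inverse)
    have 2: "(\<lambda>l. if l \<in> {0<..} then h l else 0) integrable_on {-b..0}"
      by (rule integrable_eq[OF integrable_0]) auto
    have "(\<lambda>l. if l \<in> {0<..} then h l else 0) integrable_on {-b..b}"
      using b by (intro Henstock_Kurzweil_Integration.integrable_combine[OF _ _ 2 1]) auto
    then show "(\<lambda>l. if l \<in> {0<..} then h l else 0) integrable_on cbox a' b'"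
      unfolding box_real by (rule integrable_subinterval_real) (auto simp: b_def)
  qed auto
  then obtain I where I: "(h has_integral I) {0<..}" by (auto simp: integrable_on_def)
  have "norm I \<le> \<delta> powr (1 - \<alpha>) / (1 - \<alpha>) * norm y + 2 * \<delta> powr - \<alpha> / \<alpha> * norm x" if "0 < \<delta>" for \<delta>
  proof -
    have "norm (integral {0<..} h) \<le> integral {0<..} (g \<delta>)"
      using I gi[OF that] hg by (intro Henstock_Kurzweil_Integration.integral_norm_bound_integral) (auto simp: integrable_on_def)
    then show ?thesis using integral_unique[OF I] integral_unique[OF gi[OF that]] by simp
  qed
  then show ?thesis using I by (auto simp: h_def[abs_def])
qed

lemma subspace_frac_power: "subspace (frac_power S \<alpha>)"
proof (cases "\<alpha> = 0")
  case True
  then show ?thesis by (auto simp: frac_power_def subspace_def zero_prod_def)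
next
  case False
  let ?P = "{(x, (1 / Gamma (- \<alpha>)) *\<^sub>R I) | x I. x \<in> Domain (generator S) \<and>
       ((\<lambda>l. l powr (- \<alpha> - 1) *\<^sub>R (S l x - x)) has_integral I) {0<..}}"
  have "subspace ?P"
    unfolding subspace_def
  proof (intro conjI ballI allI)
    have "((\<lambda>l. l powr (- \<alpha> - 1) *\<^sub>R (S l 0 - 0)) has_integral 0) {0<..}"
      by (rule has_integral_eq[OF _ has_integral_0]) (auto simp: linear_simps)
    then show "0 \<in> ?P" using G_zero by (force simp: G_def zero_prod_def)
  next
    fix p p' assume pp: "p \<in> ?P" "p' \<in> ?P"
    from pp(1) obtain x I where p: "p = (x, (1 / Gamma (- \<alpha>)) *\<^sub>R I)" "x \<in> Domain (generator S)"
      "((\<lambda>l. l powr (- \<alpha> - 1) *\<^sub>R (S l x - x)) has_integral I) {0<..}"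
      unfolding mem_Collect_eq by blast
    from pp(2) obtain x' I' where p': "p' = (x', (1 / Gamma (- \<alpha>)) *\<^sub>R I')" "x' \<in> Domain (generator S)"
      "((\<lambda>l. l powr (- \<alpha> - 1) *\<^sub>R (S l x' - x')) has_integral I') {0<..}"
      unfolding mem_Collect_eq by blast
    have "((\<lambda>l. l powr (- \<alpha> - 1) *\<^sub>R (S l (x + x') - (x + x'))) has_integral I + I') {0<..}"
      by (rule has_integral_eq[OF _ has_integral_add[OF p(3) p'(3)]]) (auto simp: linear_simps algebra_simps)
    moreover have "x + x' \<in> Domain (generator S)" using p(2) p'(2) by (auto intro: DomainI[OF G_add[unfolded G_def]])
    ultimately show "p + p' \<in> ?P" by (force simp: p(1) p'(1) algebra_simps)
  next
    fix c p assume "p \<in> ?P"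
    then obtain x I where p: "p = (x, (1 / Gamma (- \<alpha>)) *\<^sub>R I)" "x \<in> Domain (generator S)"
      "((\<lambda>l. l powr (- \<alpha> - 1) *\<^sub>R (S l x - x)) has_integral I) {0<..}"
      unfolding mem_Collect_eq by blast
    have "((\<lambda>l. l powr (- \<alpha> - 1) *\<^sub>R (S l (c *\<^sub>R x) - c *\<^sub>R x)) has_integral c *\<^sub>R I) {0<..}"
      by (rule has_integral_eq[OF _ has_integral_cmul[OF p(3)]]) (auto simp: linear_simps algebra_simps)
    moreover have "c *\<^sub>R x \<in> Domain (generator S)" using p(2) by (auto intro: DomainI[OF G_scaleR[unfolded G_def]])
    ultimately show "c *\<^sub>R p \<in> ?P" by (force simp: p(1))
  qed
  from subspace_closure[OF this] show ?thesis using False by (simp add: frac_power_def)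
qed

lemma closed_frac_power: "closed (frac_power S \<alpha>)"
proof (cases "\<alpha> = 0")
  case True
  have "(Id :: ('a \<times> 'a) set) = {p. fst p = snd p}" by auto
  moreover have "closed {p :: 'a \<times> 'a. fst p = snd p}" by (intro closed_Collect_eq continuous_intros)
  ultimately show ?thesis using True by (simp add: frac_power_def)
qed (simp add: frac_power_def)

text \<open>Interpolates the graph norm of the fractional power between \<open>x\<close> and the
  generator at \<open>x\<close>. The range \<open>\<delta> \<le> 1\<close> lets
  \<open>norm x\<close> be absorbed in \<open>\<delta> powr - \<alpha> * norm x\<close>.\<close>

lemma frac_power_interpolation:
  assumes a: "0 \<le> \<alpha>" "\<alpha> < 1"
  shows "\<exists>K\<ge>0. \<forall>(x, y)\<in>G. \<exists>z. (x, z) \<in> frac_power S \<alpha> \<and>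
    (\<forall>\<delta>. 0 < \<delta> \<and> \<delta> \<le> 1 \<longrightarrow> norm x + norm z \<le> K * (\<delta> powr (1 - \<alpha>) * norm y + \<delta> powr - \<alpha> * norm x))"
proof (cases "\<alpha> = 0")
  case True
  show ?thesis
  \<comment> \<open>For \<open>\<alpha> = 0\<close> the graph is the diagonal, so the left side is
    \<open>2 * norm x\<close>.\<close>
  proof (intro exI[of _ 2] conjI ballI, simp, clarify)
    fix x y assume "(x, y) \<in> G"
    show "\<exists>z. (x, z) \<in> frac_power S \<alpha> \<and>
      (\<forall>\<delta>. 0 < \<delta> \<and> \<delta> \<le> 1 \<longrightarrow> norm x + norm z \<le> 2 * (\<delta> powr (1 - \<alpha>) * norm y + \<delta> powr - \<alpha> * norm x))"
      by (rule exI[of _ x]) (use True in \<open>auto simp: frac_power_def\<close>)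
  qed
next
  case False
  then have a: "0 < \<alpha>" "\<alpha> < 1" using a by auto
  define k where "k = \<bar>1 / Gamma (- \<alpha>)\<bar>"
  define K where "K = max (k / (1 - \<alpha>)) (1 + k * (2 / \<alpha>))"
  have k: "0 \<le> k" by (simp add: k_def)
  have K: "k / (1 - \<alpha>) \<le> K" "1 + k * (2 / \<alpha>) \<le> K" by (auto simp: K_def)
  have "0 \<le> K" using K(1) k a by (meson divide_nonneg_pos diff_gt_0_iff_gt order_trans)
  moreover have "\<exists>z. (x, z) \<in> frac_power S \<alpha> \<and>
    (\<forall>\<delta>. 0 < \<delta> \<and> \<delta> \<le> 1 \<longrightarrow> norm x + norm z \<le> K * (\<delta> powr (1 - \<alpha>) * norm y + \<delta> powr - \<alpha> * norm x))"
    if xy: "(x, y) \<in> G" for x y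
  proof -
    obtain I where I: "((\<lambda>l. l powr (- \<alpha> - 1) *\<^sub>R (S l x - x)) has_integral I) {0<..}"
      "\<And>\<delta>. 0 < \<delta> \<Longrightarrow> norm I \<le> \<delta> powr (1 - \<alpha>) / (1 - \<alpha>) * norm y + 2 * \<delta> powr - \<alpha> / \<alpha> * norm x"
      using frac_integral[OF xy a] by blast
    have xD: "x \<in> Domain (generator S)" using xy by (auto simp: G_def)
    have "(x, (1 / Gamma (- \<alpha>)) *\<^sub>R I) \<in> frac_power S \<alpha>"
      unfolding frac_power_def using False xD I(1) by (auto intro!: closure_subset[THEN subsetD])
    moreover have "norm x + norm ((1 / Gamma (- \<alpha>)) *\<^sub>R I) \<le> K * (\<delta> powr (1 - \<alpha>) * norm y + \<delta> powr - \<alpha> * norm x)"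
      if d: "0 < \<delta>" "\<delta> \<le> 1" for \<delta>
    proof -
      have "1 \<le> \<delta> powr - \<alpha>" using d a by (simp add: powr_minus one_le_inverse powr_le1)
      then have 1: "norm x \<le> \<delta> powr - \<alpha> * norm x" using mult_right_mono[of 1 "\<delta> powr - \<alpha>" "norm x"] by simp
      have "norm ((1 / Gamma (- \<alpha>)) *\<^sub>R I) = k * norm I" by (simp add: k_def)
      also have "\<dots> \<le> k * (\<delta> powr (1 - \<alpha>) / (1 - \<alpha>) * norm y + 2 * \<delta> powr - \<alpha> / \<alpha> * norm x)"
        using I(2)[OF d(1)] k by (rule mult_left_mono)
      finally have "norm x + norm ((1 / Gamma (- \<alpha>)) *\<^sub>R I)
          \<le> (k / (1 - \<alpha>)) * (\<delta> powr (1 - \<alpha>) * norm y) + (1 + k * (2 / \<alpha>)) * (\<delta> powr - \<alpha> * norm x)"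
        using 1 by (simp add: algebra_simps)
      also have "\<dots> \<le> K * (\<delta> powr (1 - \<alpha>) * norm y) + K * (\<delta> powr - \<alpha> * norm x)"
        using K by (intro add_mono mult_right_mono) auto
      finally show ?thesis by (simp add: algebra_simps)
    qed
    ultimately show ?thesis by blast
  qed
  ultimately show ?thesis by blast
qed

text \<open>The difference quotients of \<open>V\<close> are bounded operators on the product space
  and, by the domain hypothesis, converge at every point of the graph of the fractional power. Their
  uniform bound passes to the limit, the generator of \<open>V\<close>, and
  \<open>frac_power_interpolation\<close> rewrites it.\<close>

theorem relative_bound:
  assumes V: "contraction_semigroup V" and a: "0 \<le> \<alpha>" "\<alpha> < 1"
    and dom: "Domain (frac_power S \<alpha>) \<subseteq> Domain (generator V)"
  shows "\<exists>K\<ge>0. \<forall>(x, y)\<in>G. \<exists>z. (x, z) \<in> generator V \<and>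
    (\<forall>\<delta>. 0 < \<delta> \<and> \<delta> \<le> 1 \<longrightarrow> norm z \<le> K * (\<delta> powr (1 - \<alpha>) * norm y + \<delta> powr - \<alpha> * norm x))"
proof -
  interpret V: contraction_sg V by standard (rule V)
  define T where "T n p = real (Suc n) *\<^sub>R (V (inverse (real (Suc n))) (fst p) - fst p)" for n and p :: "'a \<times> 'a"
  have lim: "(\<lambda>n. T n (x, w)) \<longlonglongrightarrow> - z" if "(x, z) \<in> generator V" for x z w
  proof -
    have f: "filterlim (\<lambda>n. inverse (real (Suc n))) (at_right 0) sequentially"
      using LIMSEQ_inverse_real_of_nat by (auto simp: filterlim_at)
    have "((\<lambda>t. (V t x - x) /\<^sub>R t) \<longlongrightarrow> - z) (at_right 0)" using that by (simp add: generator_def)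
    from filterlim_compose[OF this f] show ?thesis by (simp add: T_def)
  qed
  have "\<exists>C\<ge>0. \<forall>n\<in>UNIV. \<forall>p\<in>frac_power S \<alpha>. norm (T n p) \<le> C * norm p"
  proof (rule uniform_boundedness[OF closed_frac_power subspace_frac_power])
    show "bounded_linear (T n)" for n unfolding T_def
      by (intro bounded_linear_compose[OF bounded_linear_scaleR_right] bounded_linear_sub bounded_linear_fst
          bounded_linear_compose[OF V.bdd_linear bounded_linear_fst]) auto
    fix p assume p: "p \<in> frac_power S \<alpha>"
    then obtain z where "(fst p, z) \<in> generator V" using dom by (metis Domain.simps prod.collapse subsetD)
    from lim[OF this, of "snd p"] have "convergent (\<lambda>n. T n p)" by (auto simp: convergent_def)
    then have "Bseq (\<lambda>n. T n p)" by (rule convergent_imp_Bseq)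
    then show "\<exists>M. \<forall>n\<in>UNIV. norm (T n p) \<le> M" by (auto simp: Bseq_def)
  qed
  then obtain C where C: "0 \<le> C" "\<And>n p. p \<in> frac_power S \<alpha> \<Longrightarrow> norm (T n p) \<le> C * norm p" by auto
  obtain K where K: "0 \<le> K" "\<And>x y. (x, y) \<in> G \<Longrightarrow> \<exists>z. (x, z) \<in> frac_power S \<alpha> \<and>
    (\<forall>\<delta>. 0 < \<delta> \<and> \<delta> \<le> 1 \<longrightarrow> norm x + norm z \<le> K * (\<delta> powr (1 - \<alpha>) * norm y + \<delta> powr - \<alpha> * norm x))"
    using frac_power_interpolation[OF a] by blast
  have "\<exists>z. (x, z) \<in> generator V \<and>
    (\<forall>\<delta>. 0 < \<delta> \<and> \<delta> \<le> 1 \<longrightarrow> norm z \<le> (C * K) * (\<delta> powr (1 - \<alpha>) * norm y + \<delta> powr - \<alpha> * norm x))"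
    if xy: "(x, y) \<in> G" for x y
  proof -
    obtain w where w: "(x, w) \<in> frac_power S \<alpha>"
      "\<And>\<delta>. 0 < \<delta> \<Longrightarrow> \<delta> \<le> 1 \<Longrightarrow> norm x + norm w \<le> K * (\<delta> powr (1 - \<alpha>) * norm y + \<delta> powr - \<alpha> * norm x)"
      using K(2)[OF xy] by blast
    obtain z where z: "(x, z) \<in> generator V" using dom w(1) by blast
    have "norm (- z) \<le> C * norm (x, w)"
      by (rule tendsto_upperbound[OF tendsto_norm[OF lim[OF z, of w]]]) (auto intro!: always_eventually C w)
    also have "\<dots> \<le> C * (norm x + norm w)" by (intro mult_left_mono norm_Pair_le C)
    finally have 1: "norm z \<le> C * (norm x + norm w)" by simp
    have "norm z \<le> (C * K) * (\<delta> powr (1 - \<alpha>) * norm y + \<delta> powr - \<alpha> * norm x)" if "0 < \<delta>" "\<delta> \<le> 1" for \<delta>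
      using order_trans[OF 1 mult_left_mono[OF w(2)[OF that] C(1)]] by (simp add: mult.assoc)
    then show ?thesis using z by blast
  qed
  then show ?thesis using C(1) K(1) by (intro exI[of _ "C * K"]) auto
qed

end

section \<open>The semigroup generated by the sum\<close>

context contraction_sg
begin

definition dom where "dom = Domain G"
definition gen where "gen x = (THE y. (x, y) \<in> G)"

lemma gen_eq: "(x, y) \<in> G \<Longrightarrow> gen x = y"
  unfolding gen_def by (rule the_equality) (auto intro: G_unique)

lemma gen_mem: "x \<in> dom \<Longrightarrow> (x, gen x) \<in> G"
  using gen_eq by (auto simp: dom_def)

lemma G_iff: "(x, y) \<in> G \<longleftrightarrow> x \<in> dom \<and> y = gen x"
  using gen_eq gen_mem by (auto simp: dom_def)

lemma dom_simps: "x \<in> dom \<Longrightarrow> y \<in> dom \<Longrightarrow> x + y \<in> dom" "x \<in> dom \<Longrightarrow> y \<in> dom \<Longrightarrow> x - y \<in> dom"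
    "x \<in> dom \<Longrightarrow> r *\<^sub>R x \<in> dom" "x \<in> dom \<Longrightarrow> k *\<^sub>C x \<in> dom" "0 \<le> t \<Longrightarrow> x \<in> dom \<Longrightarrow> S t x \<in> dom"
  using G_add[of x "gen x" y "gen y"] G_diff[of x "gen x" y "gen y"] G_scaleR[of x "gen x" r]
    G_scaleC[of x "gen x" k] G_invariant[of x "gen x" t] by (auto simp: G_iff)

lemma gen_simps: "x \<in> dom \<Longrightarrow> y \<in> dom \<Longrightarrow> gen (x + y) = gen x + gen y"
    "x \<in> dom \<Longrightarrow> y \<in> dom \<Longrightarrow> gen (x - y) = gen x - gen y"
    "x \<in> dom \<Longrightarrow> gen (r *\<^sub>R x) = r *\<^sub>R gen x" "x \<in> dom \<Longrightarrow> gen (k *\<^sub>C x) = k *\<^sub>C gen x"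
    "0 \<le> t \<Longrightarrow> x \<in> dom \<Longrightarrow> gen (S t x) = S t (gen x)"
  using G_add[of x "gen x" y "gen y"] G_diff[of x "gen x" y "gen y"] G_scaleR[of x "gen x" r]
    G_scaleC[of x "gen x" k] G_invariant[of x "gen x" t] by (auto simp: G_iff)

lemma cont_product:
  assumes y: "continuous_on T y" and T: "T \<subseteq> {0..}"
  shows "continuous_on T (\<lambda>r. S r (y r))"
  unfolding continuous_on_def
proof
  fix r0 assume r0: "r0 \<in> T"
  have "((\<lambda>r. S r (y r - y r0)) \<longlongrightarrow> 0) (at r0 within T)"
  proof (rule Lim_null_comparison)
    have "((\<lambda>r. y r - y r0) \<longlongrightarrow> y r0 - y r0) (at r0 within T)"
      using y r0 by (intro tendsto_intros) (auto simp: continuous_on_def)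
    then show "((\<lambda>r. norm (y r - y r0)) \<longlongrightarrow> 0) (at r0 within T)" by (simp add: tendsto_norm_zero)
    show "\<forall>\<^sub>F r in at r0 within T. norm (S r (y r - y r0)) \<le> norm (y r - y r0)"
      using T by (auto simp: eventually_at_filter intro!: always_eventually norm_le)
  qed
  moreover have "((\<lambda>r. S r (y r0)) \<longlongrightarrow> S r0 (y r0)) (at r0 within T)"
    using continuous_on_subset[OF cont T, of "y r0"] r0 by (auto simp: continuous_on_def)
  ultimately have "((\<lambda>r. S r (y r - y r0) + S r (y r0)) \<longlongrightarrow> 0 + S r0 (y r0)) (at r0 within T)"
    by (rule tendsto_add)
  moreover have "\<forall>\<^sub>F r in at r0 within T. S r (y r - y r0) + S r (y r0) = S r (y r)"
    using T by (auto simp: eventually_at_filter linear_simps subset_iff)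
  ultimately show "((\<lambda>r. S r (y r)) \<longlongrightarrow> S r0 (y r0)) (at r0 within T)"
    by (auto intro: Lim_transform_eventually)
qed

text \<open>\<open>y\<close> is required to meet the domain only at \<open>r0\<close>. So
  \<open>y r\<close> is split into \<open>y r0\<close>, whose orbit is differentiable, and an
  increment vanishing at \<open>r0\<close>, for which strong continuity is enough. The shift by
  \<open>e\<close> leaves room for a factor \<open>S e\<close> that can absorb the
  generator.\<close>

lemma deriv_product:
  assumes y: "(y has_vector_derivative y') (at r0)" and d: "y r0 \<in> dom" and e: "e < r0"
  shows "((\<lambda>r. S (r - e) (y r)) has_vector_derivative S (r0 - e) (y' - gen (y r0))) (at r0)"
proof -
  have sh: "((\<lambda>r. r - e) has_vector_derivative 1) (at r0)"
    by (auto intro!: derivative_eq_intros)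
  have "((\<lambda>t. S t (y r0)) has_vector_derivative - S (r0 - e) (gen (y r0))) (at (r0 - e))"
    using e by (intro deriv_at gen_mem d) auto
  from vector_diff_chain_at[OF sh this]
  have 1: "((\<lambda>r. S (r - e) (y r0)) has_vector_derivative - S (r0 - e) (gen (y r0))) (at r0)"
    by (simp add: o_def)
  have 2: "((\<lambda>r. S (r - e) (y r - y r0)) has_vector_derivative S (r0 - e) y') (at r0)"
    unfolding has_vector_derivative_def has_derivative_within_alt
  proof (intro conjI allI impI)
    fix \<epsilon> :: real assume "0 < \<epsilon>"
    then have ep: "0 < \<epsilon> / 2" by simp
    obtain d1 where d1: "0 < d1" "\<And>r. \<bar>r - r0\<bar> < d1 \<Longrightarrow> norm (y r - y r0 - (r - r0) *\<^sub>R y') \<le> \<epsilon> / 2 * \<bar>r - r0\<bar>"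
      using y ep unfolding has_vector_derivative_def has_derivative_within_alt real_norm_def by blast
    obtain d2 where d2: "0 < d2" "\<And>h. 0 \<le> h \<Longrightarrow> h < d2 \<Longrightarrow> norm (S h y' - y') < \<epsilon> / 2"
      using near_0[OF ep] by blast
    show "\<exists>d>0. \<forall>r\<in>UNIV. norm (r - r0) < d \<longrightarrow> norm (S (r - e) (y r - y r0) - S (r0 - e) (y r0 - y r0)
        - (r - r0) *\<^sub>R S (r0 - e) y') \<le> \<epsilon> * norm (r - r0)"
    proof (intro exI[of _ "min (min d1 d2) (r0 - e)"] conjI ballI impI)
      fix r assume r: "norm (r - r0) < min (min d1 d2) (r0 - e)"
      then have re: "0 \<le> r - e" "0 \<le> r0 - e" using e by auto
      have "S (r - e) (y r - y r0) - S (r0 - e) (y r0 - y r0) - (r - r0) *\<^sub>R S (r0 - e) y'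
          = S (r - e) (y r - y r0 - (r - r0) *\<^sub>R y') + (r - r0) *\<^sub>R (S (r - e) y' - S (r0 - e) y')"
        using re by (simp add: linear_simps algebra_simps)
      then have "norm (S (r - e) (y r - y r0) - S (r0 - e) (y r0 - y r0) - (r - r0) *\<^sub>R S (r0 - e) y')
          \<le> norm (S (r - e) (y r - y r0 - (r - r0) *\<^sub>R y')) + \<bar>r - r0\<bar> * norm (S (r - e) y' - S (r0 - e) y')"
        by (simp only: norm_triangle_ineq flip: norm_scaleR)
      also have "\<dots> \<le> \<epsilon> / 2 * \<bar>r - r0\<bar> + \<bar>r - r0\<bar> * (\<epsilon> / 2)"
      proof (intro add_mono mult_left_mono)
        show "norm (S (r - e) (y r - y r0 - (r - r0) *\<^sub>R y')) \<le> \<epsilon> / 2 * \<bar>r - r0\<bar>"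
          by (rule order_trans[OF norm_le[OF re(1)] d1(2)]) (use r in auto)
        have "norm (S (r - e) y' - S (r0 - e) y') \<le> norm (S \<bar>(r - e) - (r0 - e)\<bar> y' - y')"
          by (rule diff_le) (use re in auto)
        also have "\<dots> \<le> \<epsilon> / 2" using d2(2)[of "\<bar>r - r0\<bar>"] r by simp
        finally show "norm (S (r - e) y' - S (r0 - e) y') \<le> \<epsilon> / 2" .
      qed auto
      finally show "norm (S (r - e) (y r - y r0) - S (r0 - e) (y r0 - y r0)
        - (r - r0) *\<^sub>R S (r0 - e) y') \<le> \<epsilon> * norm (r - r0)" by (simp add: algebra_simps)
    qed (use d1 d2 e in auto)
  qed (rule bounded_linear_scaleR_left)
  have "((\<lambda>r. S (r - e) (y r0) + S (r - e) (y r - y r0)) has_vector_derivative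
      - S (r0 - e) (gen (y r0)) + S (r0 - e) y') (at r0)"
    by (rule has_vector_derivative_add[OF 1 2])
  moreover have "- S (r0 - e) (gen (y r0)) + S (r0 - e) y' = S (r0 - e) (y' - gen (y r0))"
    using e by (simp add: linear_simps)
  ultimately have "((\<lambda>r. S (r - e) (y r0) + S (r - e) (y r - y r0)) has_vector_derivative
      S (r0 - e) (y' - gen (y r0))) (at r0)" by simp
  then show ?thesis
  proof (rule has_vector_derivative_transform_within_open[where S = "{e<..}"])
    show "S (r - e) (y r0) + S (r - e) (y r - y r0) = S (r - e) (y r)" if "r \<in> {e<..}" for r
      using that by (simp add: linear_simps)
  qed (use e in auto)
qed

end

lemma powr_one_minus: "0 < (r::real) \<Longrightarrow> r powr (1 - a) = r powr - a * r"
  using powr_add[of r "- a" 1] by simp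

text \<open>\<open>rel\<close> is the interpolation inequality behind the domain condition: a small
  \<open>\<delta>\<close> makes the coefficient of \<open>A.gen x\<close> small, while a
  \<open>\<delta>\<close> equal to a small time \<open>t\<close> makes \<open>B S(t)\<close> of
  order \<open>t powr - \<alpha>\<close>.\<close>

locale perturbation = A: contraction_sg S + B: contraction_sg V
  for S V :: "real \<Rightarrow> 'a::complex_banach \<Rightarrow> 'a" +
  fixes \<alpha> c K :: real
  assumes alpha: "0 \<le> \<alpha>" "\<alpha> < 1" and c: "0 \<le> c" and K: "0 \<le> K"
    and smooth_dom: "\<And>t x. 0 < t \<Longrightarrow> S t x \<in> A.dom"
    and smooth: "\<And>t x. 0 < t \<Longrightarrow> norm (A.gen (S t x)) \<le> c / t * norm x"
    and rel_dom: "\<And>x. x \<in> A.dom \<Longrightarrow> x \<in> B.dom"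
    and rel: "\<And>x \<delta>. x \<in> A.dom \<Longrightarrow> 0 < \<delta> \<Longrightarrow> \<delta> \<le> 1 \<Longrightarrow>
      norm (B.gen x) \<le> K * (\<delta> powr (1 - \<alpha>) * norm (A.gen x) + \<delta> powr - \<alpha> * norm x)"
begin

lemma small_powr:
  assumes "0 < (\<epsilon>::real)" "0 \<le> M"
  shows "\<exists>\<delta>. 0 < \<delta> \<and> \<delta> \<le> 1 \<and> M * \<delta> powr (1 - \<alpha>) \<le> \<epsilon>"
proof -
  \<comment> \<open>\<open>M + 1\<close> covers \<open>M = 0\<close>, and the minimum with 1 keeps
    \<open>\<delta>\<close> in the range of \<open>rel\<close>.\<close>
  define \<delta> where "\<delta> = min 1 ((\<epsilon> / (M + 1)) powr (1 / (1 - \<alpha>)))"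
  have d: "0 < \<delta>" "\<delta> \<le> 1" using assms by (auto simp: \<delta>_def)
  have "\<delta> powr (1 - \<alpha>) \<le> ((\<epsilon> / (M + 1)) powr (1 / (1 - \<alpha>))) powr (1 - \<alpha>)"
    using d alpha by (intro powr_mono2) (auto simp: \<delta>_def)
  also have "\<dots> = \<epsilon> / (M + 1)" using assms alpha by (simp add: powr_powr)
  finally have "M * \<delta> powr (1 - \<alpha>) \<le> M * (\<epsilon> / (M + 1))" using assms by (intro mult_left_mono)
  also have "\<dots> \<le> \<epsilon>" using assms by (simp add: field_simps)
  finally show ?thesis using d by blast
qed

lemma rel_small:
  assumes "0 < (\<epsilon>::real)"
  shows "\<exists>M\<ge>0. \<forall>x\<in>A.dom. norm (B.gen x) \<le> \<epsilon> * norm (A.gen x) + M * norm x"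
proof -
  obtain \<delta> where d: "0 < \<delta>" "\<delta> \<le> 1" "K * \<delta> powr (1 - \<alpha>) \<le> \<epsilon>" using small_powr[OF assms K] by blast
  have "norm (B.gen x) \<le> \<epsilon> * norm (A.gen x) + (K * \<delta> powr - \<alpha>) * norm x" if "x \<in> A.dom" for x
  proof -
    have "norm (B.gen x) \<le> (K * \<delta> powr (1 - \<alpha>)) * norm (A.gen x) + (K * \<delta> powr - \<alpha>) * norm x"
      using rel[OF that d(1,2)] by (simp add: algebra_simps)
    also have "\<dots> \<le> \<epsilon> * norm (A.gen x) + (K * \<delta> powr - \<alpha>) * norm x"
      using d by (intro add_right_mono mult_right_mono) auto
    finally show ?thesis .
  qed
  then show ?thesis using K by (intro exI[of _ "K * \<delta> powr - \<alpha>"]) auto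
qed

definition C where "C = op_sum A.G B.G"

lemma C_iff: "(x, w) \<in> C \<longleftrightarrow> x \<in> A.dom \<and> w = A.gen x + B.gen x"
  using rel_dom by (auto simp: C_def op_sum_def A.G_iff B.G_iff)

lemma A_dense: "0 < e \<Longrightarrow> \<exists>y\<in>A.dom. norm (y - x) < e"
proof -
  assume "0 < e"
  then obtain d where "0 < d" "\<And>h. 0 \<le> h \<Longrightarrow> h < d \<Longrightarrow> norm (S h x - x) < e" using A.near_0 by blast
  then show ?thesis using smooth_dom[of "d/2" x] by (intro bexI[of _ "S (d/2) x"]) auto
qed

lemma A_dense_sequence: "\<exists>X. (\<forall>n. X n \<in> A.dom) \<and> X \<longlonglongrightarrow> x"
proof -
  have "\<exists>y\<in>A.dom. norm (y - x) < 1 / real (Suc n)" for n by (rule A_dense) simp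
  then obtain X where X: "\<And>n. X n \<in> A.dom" "\<And>n. norm (X n - x) < 1 / real (Suc n)" by metis
  have "(\<lambda>n. X n - x) \<longlonglongrightarrow> 0"
    by (rule Lim_null_comparison[OF always_eventually LIMSEQ_inverse_real_of_nat])
      (use X(2) in \<open>auto simp: inverse_eq_divide intro: less_imp_le\<close>)
  then show ?thesis using X(1) by (auto simp: LIM_zero_iff)
qed

text \<open>To first order \<open>V t (S t x)\<close> is \<open>x - t (A x + B x)\<close>, and
  \<open>V t S t\<close> is a contraction; so the argument of \<open>G_accretive\<close> works
  although no semigroup for the sum exists yet.\<close>

lemma C_accretive:
  assumes x: "x \<in> A.dom" and h: "0 \<le> h"
  shows "norm x \<le> norm (x + h *\<^sub>R (A.gen x + B.gen x))"
proof (cases "h = 0")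
  case False
  then have h: "0 < h" using h by simp
  let ?a = "A.gen x" and ?b = "B.gen x"
  show ?thesis
  proof (rule field_le_epsilon)
    fix \<epsilon> :: real assume ep: "0 < \<epsilon>"
    \<comment> \<open>Three error terms of size \<open>e * t\<close> have to fit into
      \<open>t / h * \<epsilon>\<close>.\<close>
    define e where "e = \<epsilon> / (3 * h)"
    have e: "0 < e" using ep h by (simp add: e_def)
    obtain d1 where d1: "0 < d1" "\<And>t. 0 < t \<Longrightarrow> t < d1 \<Longrightarrow> norm (S t x - x + t *\<^sub>R ?a) \<le> e * t"
      using A.gen_mem[OF x] e unfolding A.G_iff_eps by meson
    obtain d2 where d2: "0 < d2" "\<And>t. 0 < t \<Longrightarrow> t < d2 \<Longrightarrow> norm (V t x - x + t *\<^sub>R ?b) \<le> e * t"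
      using B.gen_mem[OF rel_dom[OF x]] e unfolding B.G_iff_eps by meson
    obtain d3 where d3: "0 < d3" "\<And>t. 0 \<le> t \<Longrightarrow> t < d3 \<Longrightarrow> norm (V t ?a - ?a) < e"
      using B.near_0[OF e] by blast
    define t where "t = min (min d1 d2) d3 / 2"
    have t: "0 < t" "t < d1" "t < d2" "t < d3" using d1(1) d2(1) d3(1) by (auto simp: t_def)
    let ?err = "V t (S t x - x + t *\<^sub>R ?a) + (V t x - x + t *\<^sub>R ?b) - t *\<^sub>R (V t ?a - ?a)"
    have eq: "V t (S t x) = x - t *\<^sub>R (?a + ?b) + ?err"
      using t by (simp add: B.linear_simps algebra_simps)
    have "norm ?err \<le> norm (V t (S t x - x + t *\<^sub>R ?a)) + norm (V t x - x + t *\<^sub>R ?b) + norm (t *\<^sub>R (V t ?a - ?a))"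
      by (rule norm_add_add_diff_le)
    also have "\<dots> \<le> e * t + e * t + t * e"
      using t d1(2)[of t] d2(2)[of t] d3(2)[of t] B.norm_le[of t "S t x - x + t *\<^sub>R ?a"]
      by (intro add_mono) auto
    finally have err: "norm ?err \<le> 3 * e * t" by simp
    have "(1 + t / h) *\<^sub>R x = V t (S t x) + (t / h) *\<^sub>R (x + h *\<^sub>R (?a + ?b)) - ?err"
      using h unfolding eq by (simp add: algebra_simps)
    then have "norm ((1 + t / h) *\<^sub>R x) \<le> norm (V t (S t x)) + norm ((t / h) *\<^sub>R (x + h *\<^sub>R (?a + ?b))) + norm ?err"
      by (simp only: norm_add_add_diff_le)
    also have "\<dots> \<le> norm x + t / h * norm (x + h *\<^sub>R (?a + ?b)) + 3 * e * t"
      using t h err B.norm_le[of t "S t x"] A.norm_le[of t x] by (intro add_mono) auto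
    finally have "(1 + t / h) * norm x \<le> norm x + t / h * norm (x + h *\<^sub>R (?a + ?b)) + 3 * e * t"
      using t h by simp
    then have "t / h * norm x \<le> t / h * (norm (x + h *\<^sub>R (?a + ?b)) + \<epsilon>)"
      using h by (simp add: e_def algebra_simps)
    then show "norm x \<le> norm (x + h *\<^sub>R (?a + ?b)) + \<epsilon>"
      using t h by (simp only: mult_le_cancel_left_pos divide_pos_pos)
  qed
qed simp

text \<open>With \<open>r\<close> the resolvent of \<open>A\<close> at \<open>l = 1 / h\<close>, the
  equation becomes the fixed point problem \<open>v = l x - B (r v)\<close>. A small relative bound
  and a large \<open>l\<close> make \<open>B r\<close> Lipschitz with constant
  \<open>1/8 * 2 + 1/4 = 1/2\<close>.\<close>

lemma C_surj: "\<exists>h0>0. \<forall>h x. 0 < h \<and> h \<le> h0 \<longrightarrow> (\<exists>y\<in>A.dom. y + h *\<^sub>R (A.gen y + B.gen y) = x)"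
proof -
  obtain M where M: "0 \<le> M" "\<And>x. x \<in> A.dom \<Longrightarrow> norm (B.gen x) \<le> 1/8 * norm (A.gen x) + M * norm x"
    using rel_small[of "1/8"] by auto
  \<comment> \<open>Chosen so that \<open>M / l \<le> 1/4\<close> whenever
    \<open>h \<le> h0\<close>.\<close>
  define h0 where "h0 = 1 / (4 * (M + 1))"
  have h0: "0 < h0" using M by (simp add: h0_def)
  have "\<exists>y\<in>A.dom. y + h *\<^sub>R (A.gen y + B.gen y) = x" if h: "0 < h" "h \<le> h0" for h x
  proof -
    define l where "l = 1 / h"
    have l: "0 < l" "l * h = 1" using h by (auto simp: l_def)
    have lM: "M * inverse l \<le> 1/4"
    proof -
      have "M * inverse l \<le> M * h0" using h M by (auto simp: l_def intro: mult_left_mono)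
      also have "\<dots> \<le> 1/4" using M by (simp add: h0_def field_simps)
      finally show ?thesis .
    qed
    have "\<exists>p. p \<in> A.dom \<and> l *\<^sub>R p + A.gen p = v" for v
      using A.G_surj[OF l(1), of v] by (auto simp: A.G_iff)
    then obtain r where r: "\<And>v. r v \<in> A.dom" "\<And>v. l *\<^sub>R r v + A.gen (r v) = v" by metis
    have Q: "norm (B.gen (r v) - B.gen (r w)) \<le> 1/2 * norm (v - w)" for v w
    proof -
      let ?p = "r v - r w"
      have p: "?p \<in> A.dom" by (intro A.dom_simps r)
      have e: "l *\<^sub>R ?p + A.gen ?p = v - w"
      proof -
        have "l *\<^sub>R ?p + A.gen ?p = (l *\<^sub>R r v + A.gen (r v)) - (l *\<^sub>R r w + A.gen (r w))"
          by (simp add: A.gen_simps r(1) algebra_simps)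
        then show ?thesis by (simp add: r(2))
      qed
      have 1: "l * norm ?p \<le> norm (v - w)"
        using A.G_accretive[OF A.gen_mem[OF p], of l] l by (simp add: e)
      have "A.gen ?p = (v - w) - l *\<^sub>R ?p" using e by (simp add: algebra_simps)
      then have "norm (A.gen ?p) \<le> norm (v - w) + l * norm ?p"
        using norm_triangle_ineq4[of "v - w" "l *\<^sub>R ?p"] l by simp
      then have 2: "norm (A.gen ?p) \<le> 2 * norm (v - w)" using 1 by simp
      have "norm ?p \<le> inverse l * norm (v - w)" using 1 l by (simp add: field_simps)
      then have 3: "M * norm ?p \<le> 1/4 * norm (v - w)"
        using mult_left_mono[of "norm ?p" "inverse l * norm (v - w)" M] M mult_right_mono[OF lM, of "norm (v - w)"]
        by (simp add: mult.assoc)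
      have "B.gen (r v) - B.gen (r w) = B.gen ?p" by (simp add: B.gen_simps rel_dom r(1))
      then have "norm (B.gen (r v) - B.gen (r w)) \<le> 1/8 * norm (A.gen ?p) + M * norm ?p"
        using M(2)[OF p] by simp
      also have "\<dots> \<le> 1/8 * (2 * norm (v - w)) + 1/4 * norm (v - w)"
        using 2 3 by (intro add_mono mult_left_mono) auto
      finally show ?thesis by simp
    qed
    have "\<exists>!v. l *\<^sub>R x - B.gen (r v) = v"
    proof (rule banach_fix_type[of "1/2"])
      show "\<forall>v w. dist (l *\<^sub>R x - B.gen (r v)) (l *\<^sub>R x - B.gen (r w)) \<le> 1/2 * dist v w"
        using Q by (simp add: dist_norm norm_minus_commute)
    qed auto
    then obtain v where v: "l *\<^sub>R x - B.gen (r v) = v" by blast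
    have "l *\<^sub>R x = l *\<^sub>R r v + A.gen (r v) + B.gen (r v)" using v r(2)[of v] by (metis diff_add_cancel)
    then have "h *\<^sub>R (l *\<^sub>R x) = h *\<^sub>R (l *\<^sub>R r v + (A.gen (r v) + B.gen (r v)))" by (simp add: add.assoc)
    then have "x = r v + h *\<^sub>R (A.gen (r v) + B.gen (r v))"
      using l(2) by (simp add: scaleR_add_right mult.commute)
    then show ?thesis using r(1) by metis
  qed
  then show ?thesis using h0 by blast
qed

theorem sum_generates: "\<exists>W. contraction_semigroup W \<and> generator W = C"
proof -
  obtain h0 where h0: "0 < h0" "\<And>h x. 0 < h \<Longrightarrow> h \<le> h0 \<Longrightarrow> \<exists>y\<in>A.dom. y + h *\<^sub>R (A.gen y + B.gen y) = x"
    using C_surj by blast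
  interpret m_accretive C h0
  proof
    fix x y x' y' assume "(x, y) \<in> C" "(x', y') \<in> C"
    then show "(x + x', y + y') \<in> C"
      by (auto simp: C_iff A.dom_simps A.gen_simps B.gen_simps rel_dom)
  next
    fix x y k assume "(x, y) \<in> C"
    then show "(k *\<^sub>C x, k *\<^sub>C y) \<in> C"
      by (auto simp: C_iff A.dom_simps A.gen_simps B.gen_simps rel_dom scaleC_add_right)
  next
    fix x y h assume "(x, y) \<in> C" "0 \<le> (h::real)"
    then show "norm x \<le> norm (x + h *\<^sub>R y)" using C_accretive by (auto simp: C_iff)
  next
    fix h x assume "0 < h" "h \<le> h0"
    then show "\<exists>y z. (y, z) \<in> C \<and> y + h *\<^sub>R z = x" using h0(2) by (fastforce simp: C_iff)
  next
    fix x :: 'a and e :: real assume "0 < e"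
    then show "\<exists>y z. (y, z) \<in> C \<and> norm (y - x) < e" using A_dense[of e x] by (auto simp: C_iff)
  qed (rule h0)
  show ?thesis using W_contraction_semigroup generator_W by blast
qed

end

section \<open>Smoothing of the semigroup generated by the sum\<close>

locale perturbed_semigroup = perturbation S V \<alpha> c K + W: contraction_sg W
  for S V W :: "real \<Rightarrow> 'a::complex_banach \<Rightarrow> 'a" and \<alpha> c K +
  assumes W_G: "W.G = C"
begin

lemma W_dom: "W.dom = A.dom"
  using W.G_iff unfolding W_G C_iff by (auto simp: W.dom_def W_G C_iff)

lemma W_gen: "x \<in> A.dom \<Longrightarrow> W.gen x = A.gen x + B.gen x"
  by (rule W.gen_eq) (simp add: W_G C_iff)

text \<open>With relative bound \<open>1/2\<close> for \<open>B\<close>, half of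
  \<open>norm (A.gen x)\<close> is absorbed on the left; this is the factor 2.\<close>

lemma A_bound: "\<exists>M\<ge>0. \<forall>x\<in>A.dom. norm (A.gen x) \<le> 2 * norm (W.gen x) + M * norm x"
proof -
  obtain M where M: "0 \<le> M" "\<And>x. x \<in> A.dom \<Longrightarrow> norm (B.gen x) \<le> 1/2 * norm (A.gen x) + M * norm x"
    using rel_small[of "1/2"] by auto
  have "norm (A.gen x) \<le> 2 * norm (W.gen x) + (2 * M) * norm x" if x: "x \<in> A.dom" for x
  proof -
    have "A.gen x = W.gen x - B.gen x" using W_gen[OF x] by simp
    then have "norm (A.gen x) \<le> norm (W.gen x) + norm (B.gen x)" by (simp add: norm_triangle_ineq4)
    then show ?thesis using M(2)[OF x] by linarith
  qed
  then show ?thesis using M(1) by (intro exI[of _ "2 * M"]) auto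
qed

lemma W_invariant: "0 \<le> t \<Longrightarrow> x \<in> A.dom \<Longrightarrow> W t x \<in> A.dom"
  using W.dom_simps W_dom by auto

text \<open>By \<open>A_bound\<close> the graph norm of \<open>W.gen\<close>, in which orbits are
  continuous, dominates that of \<open>A\<close>. The continuity is needed because
  \<open>deriv_commutator\<close> will be integrated down to \<open>r = 0\<close>.\<close>

lemma cont_A_W: assumes x: "x \<in> A.dom" shows "continuous_on {0..} (\<lambda>t. A.gen (W t x))"
proof -
  obtain M where M: "0 \<le> M" "\<And>x. x \<in> A.dom \<Longrightarrow> norm (A.gen x) \<le> 2 * norm (W.gen x) + M * norm x"
    using A_bound by blast
  show ?thesis
    unfolding continuous_on_def
  proof
    fix t :: real assume t: "t \<in> {0..}"
    have "((\<lambda>s. A.gen (W s x) - A.gen (W t x)) \<longlongrightarrow> 0) (at t within {0..})"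
    proof (rule Lim_null_comparison)
      have "((\<lambda>s. 2 * norm (W s (W.gen x) - W t (W.gen x)) + M * norm (W s x - W t x)) \<longlongrightarrow>
        2 * norm (W t (W.gen x) - W t (W.gen x)) + M * norm (W t x - W t x)) (at t within {0..})"
        using W.cont t by (intro tendsto_intros) (auto simp: continuous_on_def)
      then show "((\<lambda>s. 2 * norm (W s (W.gen x) - W t (W.gen x)) + M * norm (W s x - W t x)) \<longlongrightarrow> 0) (at t within {0..})"
        by simp
      have "norm (A.gen (W s x) - A.gen (W t x)) \<le> 2 * norm (W s (W.gen x) - W t (W.gen x)) + M * norm (W s x - W t x)"
        if "0 \<le> s" for s
        using M(2)[of "W s x - W t x"] that t x
        by (simp add: A.gen_simps W.gen_simps A.dom_simps W_invariant W_dom)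
      then show "\<forall>\<^sub>F s in at t within {0..}. norm (A.gen (W s x) - A.gen (W t x))
          \<le> 2 * norm (W s (W.gen x) - W t (W.gen x)) + M * norm (W s x - W t x)"
        by (auto simp: eventually_at_filter)
    qed
    then show "((\<lambda>s. A.gen (W s x)) \<longlongrightarrow> A.gen (W t x)) (at t within {0..})" by (simp add: LIM_zero_iff)
  qed
qed

lemma A_S_bounded_linear: "0 < e \<Longrightarrow> bounded_linear (\<lambda>z. A.gen (S e z))"
  using smooth by (intro bounded_linear_intro[where K = "c / e"])
    (auto simp: A.linear_simps A.gen_simps smooth_dom mult.commute)

text \<open>The commutation identity behind the smoothing estimate: the singular term
  \<open>A S(r) B W(t)x\<close> integrates exactly, and what remains carries the increment
  \<open>W(t - r)x - W(t)x\<close>, which compensates the singularity \<open>1/r\<close> of \<open>A S(r)\<close>.\<close>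

lemma deriv_commutator:
  assumes x: "x \<in> A.dom" and r: "0 < r" "r < t"
  shows "((\<lambda>r. S r (A.gen (W (t - r) x)) + S r z) has_vector_derivative
    A.gen (S r (B.gen (W (t - r) x) - z))) (at r)"
proof -
  \<comment> \<open>\<open>S r = S e S (r - e)\<close> lets the unbounded \<open>A\<close> enter
    through the bounded operator \<open>A S(e)\<close>, which may be interchanged with
    differentiation.\<close>
  define e where "e = r / 2"
  have e: "0 < e" "e < r" using r by (auto simp: e_def)
  interpret D: bounded_linear "\<lambda>z. A.gen (S e z)" by (rule A_S_bounded_linear[OF e(1)])
  let ?y = "\<lambda>r. W (t - r) x"
  have yd: "?y r \<in> A.dom" using r by (intro W_invariant x) auto
  have sh: "((\<lambda>r. t - r) has_vector_derivative - 1) (at r)" by (auto intro!: derivative_eq_intros)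
  have "((\<lambda>s. W s x) has_vector_derivative - W (t - r) (W.gen x)) (at (t - r))"
    using r x by (intro W.deriv_at W.gen_mem) (auto simp: W_dom)
  from vector_diff_chain_at[OF sh this]
  have y: "(?y has_vector_derivative W (t - r) (W.gen x)) (at r)" by (simp add: o_def)
  have gy: "W (t - r) (W.gen x) - A.gen (?y r) = B.gen (?y r)"
    using W_gen[OF yd] W.gen_simps(5)[of "t - r" x] r x by (simp add: W_dom)
  have 1: "((\<lambda>r. S (r - e) (?y r)) has_vector_derivative S (r - e) (B.gen (?y r))) (at r)"
    using A.deriv_product[OF y yd e(2)] by (simp add: gy)
  have c0: "((\<lambda>r. S e z) has_vector_derivative 0) (at r)" by (rule has_vector_derivative_const)
  have "((\<lambda>r. S (r - e) (S e z)) has_vector_derivative S (r - e) (0 - A.gen (S e z))) (at r)"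
    by (rule A.deriv_product[OF c0 smooth_dom[OF e(1)] e(2)])
  then have 2: "((\<lambda>r. S (r - e) (S e z)) has_vector_derivative - A.gen (S r z)) (at r)"
    using e A.gen_simps(5)[OF _ smooth_dom[OF e(1)], of "r - e" z] A.add[of "r - e" e z]
    by (simp add: A.linear_simps)
  have "((\<lambda>r. A.gen (S e (S (r - e) (?y r))) + S (r - e) (S e z)) has_vector_derivative
     A.gen (S e (S (r - e) (B.gen (?y r)))) + - A.gen (S r z)) (at r)"
    by (intro has_vector_derivative_add D.has_vector_derivative 1 2)
  moreover have "A.gen (S e (S (r - e) (B.gen (?y r)))) + - A.gen (S r z) = A.gen (S r (B.gen (W (t - r) x) - z))"
    using e r A.add[of e "r - e"] by (simp add: A.linear_simps A.gen_simps smooth_dom)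
  ultimately have "((\<lambda>r. A.gen (S e (S (r - e) (?y r))) + S (r - e) (S e z)) has_vector_derivative
     A.gen (S r (B.gen (W (t - r) x) - z))) (at r)" by simp
  then show ?thesis
  proof (rule has_vector_derivative_transform_within_open[where S = "{e<..<t}"])
    fix r' assume r': "r' \<in> {e<..<t}"
    have "A.gen (S e (S (r' - e) (?y r'))) = A.gen (S r' (?y r'))" using r' e A.add[of e "r' - e"] by simp
    also have "\<dots> = S r' (A.gen (?y r'))" using r' e x by (intro A.gen_simps W_invariant) auto
    finally show "A.gen (S e (S (r' - e) (?y r'))) + S (r' - e) (S e z) = S r' (A.gen (W (t - r') x)) + S r' z"
      using r' e A.add[of "r' - e" e z] by simp
  qed (use e r in auto)
qed

text \<open>For fixed \<open>x\<close> in the domain the supremum \<open>N\<close> of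
  \<open>s * norm (W.gen (W s x))\<close> is finite a priori. Integrating
  \<open>deriv_commutator\<close> bounds it by \<open>2 c norm x + 1/2 (N + norm x)\<close> for
  small \<open>t0\<close>; absorbing \<open>N\<close> leaves the constant \<open>4 * c + 1\<close>,
  independent of \<open>x\<close>, which permits the later extension by density.\<close>

lemma W_smooth_near_0:
  "\<exists>t0 N. 0 < t0 \<and> t0 \<le> 1 \<and> 0 \<le> N \<and>
    (\<forall>x\<in>A.dom. \<forall>t. 0 < t \<and> t \<le> t0 \<longrightarrow> norm (W.gen (W t x)) \<le> N / t * norm x)"
proof -
  obtain M where M: "0 \<le> M" "\<And>x. x \<in> A.dom \<Longrightarrow> norm (A.gen x) \<le> 2 * norm (W.gen x) + M * norm x"
    using A_bound by blast
  \<comment> \<open>Collects the coefficients of \<open>t powr (1 - \<alpha>)\<close> below: the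
    first part comes from the term with \<open>B W(t) x\<close> at the endpoint, the second from the
    integral; \<open>M\<close> enters through \<open>A_bound\<close>.\<close>
  define Q where "Q = K * (3 + M) + 5 * c * K * (2 + M) / (1 - \<alpha>)"
  have Q: "0 \<le> Q" unfolding Q_def using K c M alpha by auto
  obtain t0 where t0: "0 < t0" "t0 \<le> 1" "Q * t0 powr (1 - \<alpha>) \<le> 1/2" using small_powr[of "1/2" Q] Q by auto
  have "norm (W.gen (W t x)) \<le> (4 * c + 1) / t * norm x" if x: "x \<in> A.dom" and tt: "0 < t" "t \<le> t0" for x t
  proof -
    define f where "f s = s * norm (W.gen (W s x))" for s
    define N where "N = (SUP s\<in>{0<..t0}. f s)"
    have bdd: "bdd_above (f ` {0<..t0})"
    proof (rule bdd_aboveI2)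
      fix s assume s: "s \<in> {0<..t0}"
      have "norm (W.gen (W s x)) \<le> norm (W.gen x)"
        using s x W.gen_simps(5)[of s x] W.norm_le[of s "W.gen x"] by (simp add: W_dom)
      then show "f s \<le> t0 * norm (W.gen x)" unfolding f_def using s by (intro mult_mono) auto
    qed
    have fN: "f s \<le> N" if "0 < s" "s \<le> t0" for s
      unfolding N_def by (rule cSUP_upper[OF _ bdd]) (use that in auto)
    have N0: "0 \<le> N" using fN[of t0] t0 by (auto simp: f_def intro: order_trans[rotated])
    \<comment> \<open>Dominates \<open>s\<close> times the norm of either generator,
      \<open>A.gen\<close> or \<open>W.gen\<close>, at \<open>W s x\<close> for
      \<open>s \<le> t0\<close>.\<close>
    define P where "P = 2 * N + M * norm x"
    have P0: "0 \<le> P" "N \<le> P" using N0 M by (auto simp: P_def)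
    have CW: "norm (W.gen (W s x)) \<le> N / s" if "0 < s" "s \<le> t0" for s
      using fN[OF that] that by (simp add: f_def field_simps)
    have AW: "norm (A.gen (W s x)) \<le> P / s" if s: "0 < s" "s \<le> t0" for s
    proof -
      have "norm (A.gen (W s x)) \<le> 2 * (N / s) + M * norm x"
        using M(2)[OF W_invariant[OF _ x], of s] CW[OF s] s W.norm_le[of s x] M(1)
          mult_left_mono[of "norm (W s x)" "norm x" M] by linarith
      also have "M * norm x \<le> M * norm x / s" using s t0 M(1) by (simp add: le_divide_eq mult_left_le)
      finally show ?thesis by (simp add: P_def add_divide_distrib)
    qed
    have main: "f t \<le> 2 * c * norm x + Q * t powr (1 - \<alpha>) * (N + norm x)" if t: "0 < t" "t \<le> t0" for t
    proof -
      let ?z = "B.gen (W t x)"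
      define k where "k r = S r (A.gen (W (t - r) x)) + S r ?z" for r
      define \<phi> where "\<phi> r = 5 * c * K * P / t * (r powr (1 - \<alpha>) / (1 - \<alpha>))" for r
      have t1: "t \<le> 1" using t t0 by simp
      have Wd: "W s x \<in> A.dom" if "0 \<le> s" for s using W_invariant[OF that x] .
      \<comment> \<open>\<open>k 0\<close> is \<open>W.gen (W t x)\<close>, while at
        \<open>t/2\<close> the factor \<open>S (t/2)\<close> smooths. Stopping there keeps
        \<open>t - r\<close> comparable with \<open>t\<close>.\<close>
      have "norm (k (t/2) - k 0) \<le> \<phi> (t/2) - \<phi> 0"
      proof (rule differentiable_bound_general)
        have "continuous_on {0..t/2} (\<lambda>r. A.gen (W (t - r) x))"
          by (rule continuous_on_compose2[OF cont_A_W[OF x]]) (auto intro!: continuous_intros)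
        then show "continuous_on {0..t/2} k"
          unfolding k_def by (intro continuous_intros A.cont_product continuous_on_subset[OF A.cont]) auto
        show "continuous_on {0..t/2} \<phi>"
          unfolding \<phi>_def using alpha by (intro continuous_intros continuous_on_powr') auto
        fix r assume r: "0 < r" "r < t/2"
        show "(k has_vector_derivative A.gen (S r (B.gen (W (t - r) x) - ?z))) (at r)"
          unfolding k_def[abs_def] using r by (intro deriv_commutator x) auto
        have "(\<phi> has_field_derivative 5 * c * K * P / t * r powr - \<alpha>) (at r)"
          unfolding \<phi>_def using r alpha by (auto intro!: derivative_eq_intros)
        then show "(\<phi> has_vector_derivative 5 * c * K * P / t * r powr - \<alpha>) (at r)"
          by (simp add: has_real_derivative_iff_has_vector_derivative)
        let ?d = "W (t - r) x - W t x"
        have dd: "?d \<in> A.dom" using r by (intro A.dom_simps Wd) auto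
        have tr: "0 < t - r" "t - r \<le> t0" "t \<le> 2 * (t - r)" using r t by auto
        have tri: "1 / (t - r) \<le> 2 / t" using tr t by (simp add: field_simps)
        have "norm ?d \<le> norm (W.gen (W (t - r) x)) * r"
        proof -
          have "W t x = W r (W (t - r) x)" using W.add[of r "t - r" x] r by simp
          then have "norm ?d = norm (W r (W (t - r) x) - W (t - r) x)" by (simp add: norm_minus_commute)
          also have "\<dots> \<le> norm (W.gen (W (t - r) x)) * r"
            using r by (intro W.norm_diff_le W.gen_mem) (auto simp: W_dom intro!: Wd)
          finally show ?thesis .
        qed
        also have "\<dots> \<le> N / (t - r) * r" using CW[OF tr(1,2)] r by (intro mult_right_mono) auto
        also have "\<dots> \<le> N * (2 / t) * r"
          using mult_left_mono[OF tri N0] r by (intro mult_right_mono) auto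
        also have "\<dots> \<le> P / t * r" using N0 M(1) t r by (intro mult_right_mono) (auto simp: P_def divide_right_mono)
        finally have d1: "norm ?d \<le> P / t * r" .
        have "norm (A.gen ?d) \<le> norm (A.gen (W (t - r) x)) + norm (A.gen (W t x))"
          using r Wd[of "t - r"] Wd[of t] by (simp add: A.gen_simps norm_triangle_ineq4)
        also have "\<dots> \<le> P * (2 / t) + P / t"
          using AW[OF tr(1,2)] AW[OF t] mult_left_mono[OF tri P0(1)] by (intro add_mono) auto
        also have "\<dots> \<le> 4 * (P / t)" using P0 t by (simp add: field_simps)
        finally have d2: "norm (A.gen ?d) \<le> 4 * (P / t)" .
        have r1: "r \<le> 1" using r t1 by simp
        \<comment> \<open>With \<open>\<delta> = r\<close> both terms are of order
          \<open>r powr (1 - \<alpha>)\<close>, since \<open>?d\<close> is of order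
          \<open>r\<close>; multiplied by \<open>c / r\<close> the singularity stays integrable. The
          5 below is 4 + 1 from \<open>d2\<close> and \<open>d1\<close>.\<close>
        have "norm (B.gen ?d) \<le> K * (r powr (1 - \<alpha>) * norm (A.gen ?d) + r powr - \<alpha> * norm ?d)"
          by (rule rel[OF dd r(1) r1])
        also have "\<dots> \<le> K * (r powr (1 - \<alpha>) * (4 * (P / t)) + r powr - \<alpha> * (P / t * r))"
          using d1 d2 by (intro mult_left_mono add_mono K) auto
        also have "\<dots> = 5 * K * P / t * r powr (1 - \<alpha>)"
        proof -
          have "r powr (1 - \<alpha>) = r powr - \<alpha> * r" using r by (intro powr_one_minus) auto
          then show ?thesis by (simp add: algebra_simps)
        qed
        finally have Bd: "norm (B.gen ?d) \<le> 5 * K * P / t * r powr (1 - \<alpha>)" .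
        have "B.gen (W (t - r) x) - ?z = B.gen ?d" using r by (simp add: B.gen_simps rel_dom Wd)
        then have "norm (A.gen (S r (B.gen (W (t - r) x) - ?z))) \<le> c / r * norm (B.gen ?d)"
          using smooth[OF r(1)] by simp
        also have "\<dots> \<le> c / r * (5 * K * P / t * r powr (1 - \<alpha>))"
          using Bd c r by (intro mult_left_mono) auto
        also have "\<dots> = 5 * c * K * P / t * r powr - \<alpha>"
          using r by (simp add: powr_one_minus)
        finally show "norm (A.gen (S r (B.gen (W (t - r) x) - ?z))) \<le> 5 * c * K * P / t * r powr - \<alpha>" .
      qed (use t in auto)
      moreover have "\<phi> 0 = 0" by (simp add: \<phi>_def)
      moreover have "\<phi> (t/2) \<le> 5 * c * K * P / t * (t powr (1 - \<alpha>) / (1 - \<alpha>))"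
        unfolding \<phi>_def using t alpha c K P0 by (intro mult_left_mono divide_right_mono powr_mono2) auto
      moreover have "k 0 = W.gen (W t x)" using W_gen[OF Wd[of t]] t by (simp add: k_def)
      moreover have "norm (k (t/2)) \<le> 2 * c / t * norm x + K * (t powr (1 - \<alpha>) * (P / t) + t powr - \<alpha> * norm x)"
      proof -
        have "norm (k (t/2)) \<le> norm (S (t/2) (A.gen (W (t/2) x))) + norm (S (t/2) ?z)"
          by (simp add: k_def norm_triangle_ineq)
        also have "S (t/2) (A.gen (W (t/2) x)) = A.gen (S (t/2) (W (t/2) x))"
          using t by (intro A.gen_simps(5)[symmetric] Wd) auto
        also have "norm \<dots> \<le> c / (t/2) * norm (W (t/2) x)" using t by (intro smooth) auto
        also have "\<dots> \<le> c / (t/2) * norm x" using t c W.norm_le[of "t/2" x] by (intro mult_left_mono) auto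
        also have "norm (S (t/2) ?z) \<le> norm ?z" using t by (intro A.norm_le) auto
        also have "\<dots> \<le> K * (t powr (1 - \<alpha>) * norm (A.gen (W t x)) + t powr - \<alpha> * norm (W t x))"
          using t by (intro rel Wd t1) auto
        also have "\<dots> \<le> K * (t powr (1 - \<alpha>) * (P / t) + t powr - \<alpha> * norm x)"
          using AW[OF t] W.norm_le[of t x] t by (intro mult_left_mono add_mono K) auto
        finally show ?thesis by (simp add: mult_ac)
      qed
      ultimately have "norm (W.gen (W t x)) \<le> 2 * c / t * norm x + K * (t powr (1 - \<alpha>) * (P / t) + t powr - \<alpha> * norm x)
          + 5 * c * K * P / t * (t powr (1 - \<alpha>) / (1 - \<alpha>))"
        using norm_triangle_ineq3[of "k (t/2)" "k 0"] by simp
      then have "f t \<le> t * (2 * c / t * norm x + K * (t powr (1 - \<alpha>) * (P / t) + t powr - \<alpha> * norm x)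
          + 5 * c * K * P / t * (t powr (1 - \<alpha>) / (1 - \<alpha>)))"
        unfolding f_def using t by (intro mult_left_mono) auto
      also have "\<dots> = 2 * c * norm x + t powr (1 - \<alpha>) * (K * (P + norm x) + 5 * c * K / (1 - \<alpha>) * P)"
      proof -
        have "t * (2 * c / t * nx + K * (X * t * (P / t) + X * nx) + 5 * c * K * P / t * (X * t * q))
            = 2 * c * nx + X * t * (K * (P + nx) + 5 * c * K * q * P)" for nx X q
          using t by (simp add: field_simps)
        from this[of "norm x" "t powr - \<alpha>" "inverse (1 - \<alpha>)"] show ?thesis
          using powr_one_minus[OF t(1), of \<alpha>] by (simp only: divide_inverse)
      qed
      also have "\<dots> \<le> 2 * c * norm x + t powr (1 - \<alpha>) * (Q * (N + norm x))"
      proof -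
        have p1: "P \<le> (2 + M) * (N + norm x)" unfolding P_def using N0 M by (simp add: algebra_simps)
        have p2: "P + norm x \<le> (3 + M) * (N + norm x)" using p1 N0 by (simp add: algebra_simps)
        have "K * (P + norm x) + 5 * c * K / (1 - \<alpha>) * P
          \<le> K * ((3 + M) * (N + norm x)) + 5 * c * K / (1 - \<alpha>) * ((2 + M) * (N + norm x))"
          using p1 p2 K c alpha by (intro add_mono mult_left_mono) auto
        also have "\<dots> = Q * (N + norm x)" by (simp add: Q_def algebra_simps add_divide_distrib)
        finally show ?thesis by (intro add_left_mono mult_left_mono) auto
      qed
      finally show ?thesis by (simp add: mult_ac)
    qed
    have "N \<le> 2 * c * norm x + 1/2 * (N + norm x)"
      unfolding N_def
    proof (rule cSUP_least, use t0 in simp, fold N_def)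
      fix s assume s: "s \<in> {0<..t0}"
      have "f s \<le> 2 * c * norm x + Q * s powr (1 - \<alpha>) * (N + norm x)" using main s by auto
      also have "Q * s powr (1 - \<alpha>) \<le> Q * t0 powr (1 - \<alpha>)"
        using s alpha Q by (intro mult_left_mono powr_mono2) auto
      also have "\<dots> \<le> 1/2" by (rule t0)
      finally show "f s \<le> 2 * c * norm x + 1/2 * (N + norm x)" using N0 by (simp add: mult_right_mono)
    qed
    then have "N \<le> (4 * c + 1) * norm x" by (simp add: field_simps)
    then show ?thesis using CW[OF tt] tt by (simp add: field_simps)
  qed
  then show ?thesis using t0 c by (intro exI[of _ t0] exI[of _ "4 * c + 1"]) auto
qed

text \<open>Density and closedness remove the condition on \<open>x\<close>. Beyond
  \<open>t0\<close> the factor \<open>W t0\<close> does the smoothing, so the bound no longer decays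
  and takes the form \<open>1 + 1 / t\<close>.\<close>

theorem W_smooth:
  "\<exists>N\<ge>0. \<forall>t x. 0 < t \<longrightarrow> W t x \<in> A.dom \<and> norm (A.gen (W t x)) \<le> N * (1 + 1 / t) * norm x"
proof -
  obtain t0 N where t0: "0 < t0" "t0 \<le> 1" and N: "0 \<le> N"
    and bd: "\<And>x t. x \<in> A.dom \<Longrightarrow> 0 < t \<Longrightarrow> t \<le> t0 \<Longrightarrow> norm (W.gen (W t x)) \<le> N / t * norm x"
    using W_smooth_near_0 by blast
  obtain M where M: "0 \<le> M" "\<And>x. x \<in> A.dom \<Longrightarrow> norm (A.gen x) \<le> 2 * norm (W.gen x) + M * norm x"
    using A_bound by blast
  have small: "W t x \<in> A.dom \<and> norm (W.gen (W t x)) \<le> N / t * norm x" if t: "0 < t" "t \<le> t0" for t x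
  proof -
    obtain X where X: "\<And>n. X n \<in> A.dom" and Xl: "X \<longlonglongrightarrow> x" using A_dense_sequence by blast
    have WX: "(\<lambda>n. W t (X n)) \<longlonglongrightarrow> W t x"
      using t by (intro bounded_linear.tendsto[OF W.bdd_linear Xl]) auto
    have dif: "norm (W.gen (W t (X m)) - W.gen (W t (X n))) \<le> N / t * norm (X m - X n)" for m n
      using bd[of "X m - X n" t] X t
      by (simp add: A.dom_simps W.linear_simps W.gen_simps W_dom W_invariant)
    have "Cauchy (\<lambda>n. W.gen (W t (X n)))"
    proof (rule CauchyI)
      fix e :: real assume e: "0 < e"
      define e' where "e' = e / (N / t + 1)"
      have Nt: "0 \<le> N / t" using N t by simp
      then have e': "0 < e'" using e by (simp add: e'_def)
      obtain k where k: "\<And>m n. m \<ge> k \<Longrightarrow> n \<ge> k \<Longrightarrow> norm (X m - X n) < e'"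
        using CauchyD[OF LIMSEQ_imp_Cauchy[OF Xl] e'] by blast
      have "norm (W.gen (W t (X m)) - W.gen (W t (X n))) < e" if "m \<ge> k" "n \<ge> k" for m n
      proof -
        have "norm (W.gen (W t (X m)) - W.gen (W t (X n))) \<le> N / t * norm (X m - X n)" by (rule dif)
        also have "\<dots> \<le> N / t * e'" using k[OF that] Nt by (intro mult_left_mono) auto
        also have "\<dots> < (N / t + 1) * e'" using e' by (simp add: distrib_right)
        also have "\<dots> = e" using Nt by (simp add: e'_def)
        finally show ?thesis .
      qed
      then show "\<exists>k. \<forall>m\<ge>k. \<forall>n\<ge>k. norm (W.gen (W t (X m)) - W.gen (W t (X n))) < e" by blast
    qed
    then obtain w where w: "(\<lambda>n. W.gen (W t (X n))) \<longlonglongrightarrow> w" using Cauchy_convergent convergent_def by blast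
    have "(W t x, w) \<in> W.G"
      using X t by (intro W.G_closed[OF WX w] W.gen_mem) (auto simp: W_dom intro!: W_invariant)
    then have wd: "W t x \<in> A.dom" "w = W.gen (W t x)" by (auto simp: W.G_iff W_dom)
    have "norm w \<le> N / t * norm x"
    proof (rule LIMSEQ_le[OF tendsto_norm[OF w]])
      show "(\<lambda>n. N / t * norm (X n)) \<longlonglongrightarrow> N / t * norm x" by (intro tendsto_intros Xl)
    qed (use bd X t in auto)
    then show ?thesis using wd by simp
  qed
  have all: "W t x \<in> A.dom \<and> norm (W.gen (W t x)) \<le> (N / t0) * (1 + 1 / t) * norm x" if t: "0 < t" for t x
  proof (cases "t \<le> t0")
    case True
    have "N / t \<le> N / (t0 * t)" using N t0 t by (intro divide_left_mono) (auto simp: mult_le_cancel_right1)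
    also have "\<dots> \<le> (N / t0) * (1 + 1 / t)" using N t0 t by (simp add: algebra_simps)
    finally have "N / t * norm x \<le> (N / t0) * (1 + 1 / t) * norm x" by (rule mult_right_mono) simp
    then show ?thesis using small[OF t True, of x] by linarith
  next
    case False
    then have e: "W t x = W t0 (W (t - t0) x)" using W.add[of t0 "t - t0" x] t0 by simp
    have "norm (W.gen (W t x)) \<le> N / t0 * norm (W (t - t0) x)" unfolding e using small[OF t0(1) order_refl] by blast
    also have "\<dots> \<le> N / t0 * norm x" using False N t0 W.norm_le[of "t - t0" x] by (intro mult_left_mono) auto
    also have "\<dots> \<le> (N / t0) * (1 + 1 / t) * norm x"
      using mult_left_mono[of 1 "1 + 1 / t" "N / t0"] N t0 t by (intro mult_right_mono) auto
    finally show ?thesis using small[OF t0(1) order_refl] e by simp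
  qed
  have "norm (A.gen (W t x)) \<le> (2 * (N / t0) + M) * (1 + 1 / t) * norm x" if t: "0 < t" for t x
  proof -
    have "norm (A.gen (W t x)) \<le> 2 * ((N / t0) * (1 + 1 / t) * norm x) + M * norm x"
      using M(2)[of "W t x"] all[OF t, of x] W.norm_le[of t x] t mult_left_mono[of "norm (W t x)" "norm x" M] M(1)
      by linarith
    also have "M * norm x \<le> M * (1 + 1 / t) * norm x"
      using M(1) t by (intro mult_right_mono) (auto simp: mult_le_cancel_left1)
    finally show ?thesis by (simp add: algebra_simps add_divide_distrib)
  qed
  then show ?thesis using all N t0 M(1) by (intro exI[of _ "2 * (N / t0) + M"]) auto
qed

end

section \<open>The error estimate\<close>

text \<open>No commutation is assumed, so the order matters: powers of \<open>F\<close> on the left,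
  powers of \<open>G\<close> on the right. It serves twice, with \<open>G\<close> from the semigroup
  of \<open>A\<close> and from that of the sum.\<close>

lemma funpow_diff_telescope:
  fixes F G :: "'a::real_vector \<Rightarrow> 'a"
  assumes "linear F"
  shows "(F ^^ m) x - (G ^^ m) x = (\<Sum>j<m. (F ^^ (m - 1 - j)) (F ((G ^^ j) x) - G ((G ^^ j) x)))"
proof (induction m)
  case (Suc m)
  have "(F ^^ Suc m) x - (G ^^ Suc m) x = F ((F ^^ m) x - (G ^^ m) x) + (F ((G ^^ m) x) - G ((G ^^ m) x))"
    by (simp add: linear_diff[OF assms])
  also have "F ((F ^^ m) x - (G ^^ m) x) = (\<Sum>j<m. F ((F ^^ (m - 1 - j)) (F ((G ^^ j) x) - G ((G ^^ j) x))))"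
    unfolding Suc by (rule linear_sum[OF assms])
  also have "\<dots> = (\<Sum>j<m. (F ^^ (Suc m - 1 - j)) (F ((G ^^ j) x) - G ((G ^^ j) x)))"
  proof (rule sum.cong)
    fix j assume "j \<in> {..<m}"
    then have "Suc m - 1 - j = Suc (m - 1 - j)" by auto
    then show "F ((F ^^ (m - 1 - j)) (F ((G ^^ j) x) - G ((G ^^ j) x)))
        = (F ^^ (Suc m - 1 - j)) (F ((G ^^ j) x) - G ((G ^^ j) x))" by simp
  qed simp
  finally show ?case by simp
qed simp

lemma harm_le_ln: assumes "0 < n" shows "harm n \<le> 1 + ln (real n)"
proof -
  obtain m where m: "n = Suc m" using assms by (cases n) auto
  have "harm (Suc m) - ln (real (Suc m)) \<le> harm (Suc 0) - ln (real (Suc 0))"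
    using decseqD[OF decseq_harm_diff_ln, of 0 m] by simp
  then show ?thesis by (simp add: m harm_def)
qed

text \<open>Partial fractions, then the reflection \<open>k \<mapsto> n - 1 - k\<close>. This
  convolution of the two smoothing singularities is the source of \<open>ln n / n\<close>.\<close>

lemma sum_inverse_mult_reflect:
  assumes "2 \<le> n"
  shows "(\<Sum>k=1..n-2. 1 / (real (n - 1 - k) * real k)) = 2 * harm (n - 2) / real (n - 1)"
proof -
  have "(\<Sum>k=1..n-2. 1 / (real (n - 1 - k) * real k))
      = (\<Sum>k=1..n-2. inverse (real (n - 1)) * (inverse (real k) + inverse (real (n - 1 - k))))"
  proof (rule sum.cong)
    fix k assume k: "k \<in> {1..n-2}"
    have "n - 1 = k + (n - 1 - k)" using k assms by auto
    then have "real (n - 1) = real k + real (n - 1 - k)" by (metis of_nat_add)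
    moreover have "real k \<noteq> 0" "real (n - 1 - k) \<noteq> 0" using k assms by auto
    moreover have "real k + real (n - 1 - k) \<noteq> 0" using k by (auto simp: add_nonneg_eq_0_iff)
    ultimately show "1 / (real (n - 1 - k) * real k)
        = inverse (real (n - 1)) * (inverse (real k) + inverse (real (n - 1 - k)))"
      by (simp add: divide_simps)
  qed simp
  also have "\<dots> = inverse (real (n - 1)) * ((\<Sum>k=1..n-2. inverse (real k)) + (\<Sum>k=1..n-2. inverse (real (n - 1 - k))))"
    by (simp add: sum.distrib flip: sum_distrib_left)
  also have "(\<Sum>k=1..n-2. inverse (real (n - 1 - k))) = (\<Sum>k=1..n-2. inverse (real k))"
    by (rule sum.reindex_bij_witness[of _ "\<lambda>k. n - 1 - k" "\<lambda>k. n - 1 - k"]) auto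
  finally show ?thesis by (simp add: harm_def divide_inverse)
qed

context contraction_sg
begin

lemma funpow_eq: "0 \<le> t \<Longrightarrow> (S t ^^ k) x = S (real k * t) x"
proof (induction k)
  case (Suc k)
  then have "S (real (Suc k) * t) x = S t (S (real k * t) x)"
    using add[of t "real k * t" x] by (simp add: algebra_simps)
  then show ?case using Suc by simp
qed simp

end

text \<open>\<open>R\<close> absorbs the generator from the left, so the increment is of first order
  in time relative to \<open>norm x\<close> alone; this form extends by density to all
  vectors.\<close>

lemma (in contraction_sg) diff_bound:
  assumes R: "bounded_linear R" and bd: "\<And>x. x \<in> dom \<Longrightarrow> norm (R (gen x)) \<le> M * norm x"
    and M: "0 \<le> M" and x: "x \<in> dom" and t: "0 \<le> t"
  shows "norm (R (S t x - x)) \<le> M * t * norm x"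
proof -
  have "norm (R (S t x - x)) \<le> (M * norm x) * t"
  proof (rule mean_value0[OF gen_mem[OF x] t R])
    fix s :: real assume s: "0 \<le> s"
    have "norm (R (S s (gen x))) \<le> M * norm (S s x)" using bd[of "S s x"] s x by (simp add: gen_simps dom_simps)
    also have "\<dots> \<le> M * norm x" using norm_le s M by (intro mult_left_mono) auto
    finally show "norm (R (S s (gen x))) \<le> M * norm x" .
  qed
  then show ?thesis by (simp add: mult_ac)
qed

text \<open>A second-order remainder without squares of generators: one power of \<open>t\<close> is
  due to \<open>R\<close> on the left, the other to \<open>gen x\<close> on the right.\<close>

lemma (in contraction_sg) taylor_bound:
  assumes R: "bounded_linear R" and bd: "\<And>s y. 0 \<le> s \<Longrightarrow> norm (R (S s y - y)) \<le> M * s * norm y"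
    and M: "0 \<le> M" and x: "x \<in> dom" and t: "0 \<le> t" and g: "norm (gen x) \<le> g"
  shows "norm (R (S t x - x + t *\<^sub>R gen x)) \<le> M * t\<^sup>2 * g"
proof -
  have "norm (R (S t x - x + t *\<^sub>R gen x)) \<le> (M * t * g) * t"
  proof (rule mean_value[OF gen_mem[OF x] t R])
    fix s assume s: "0 \<le> s" "s \<le> t"
    have "norm (R (S s (gen x) - gen x)) \<le> M * s * norm (gen x)" by (rule bd[OF s(1)])
    also have "\<dots> \<le> M * t * g" using M s t g by (intro mult_mono) auto
    finally show "norm (R (S s (gen x) - gen x)) \<le> M * t * g" .
  qed
  then show ?thesis by (simp add: power2_eq_square mult_ac)
qed

section \<open>One-step errors and smoothing for the product formula\<close>

locale trotter = perturbed_semigroup S V W \<alpha> c K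
  for S V W :: "real \<Rightarrow> 'a::complex_banach \<Rightarrow> 'a" and \<alpha> c K +
  fixes R :: "'a \<Rightarrow> 'a" and L N :: real
  assumes R_bounded_linear: "bounded_linear R"
    and R_dom: "\<And>x. R x \<in> A.dom" and R_right: "\<And>x. R x + A.gen (R x) = x"
    and R_left: "\<And>x. x \<in> A.dom \<Longrightarrow> R (x + A.gen x) = x"
    and L: "0 \<le> L" and RB: "\<And>x. x \<in> B.dom \<Longrightarrow> norm (R (B.gen x)) \<le> L * norm x"
    and N: "0 \<le> N" and WS_dom: "\<And>t x. 0 < t \<Longrightarrow> W t x \<in> A.dom"
    and WS: "\<And>t x. 0 < t \<Longrightarrow> norm (A.gen (W t x)) \<le> N * (1 + 1 / t) * norm x"
begin

sublocale R: bounded_linear R by (rule R_bounded_linear)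

lemma R_norm: "norm (R x) \<le> norm x"
  using A.G_accretive[OF A.gen_mem[OF R_dom], of 1 x] R_right[of x] by simp

lemma A_R_norm: "norm (A.gen (R x)) \<le> 2 * norm x"
proof -
  have "A.gen (R x) = x - R x" using R_right[of x] by (metis add_diff_cancel_left')
  then show ?thesis using norm_triangle_ineq4[of x "R x"] R_norm[of x] by simp
qed

lemma R_A: "x \<in> A.dom \<Longrightarrow> R (A.gen x) = x - R x"
  using R_left[of x] by (simp add: R.add eq_diff_eq add.commute)

lemma R_A_norm: "x \<in> A.dom \<Longrightarrow> norm (R (A.gen x)) \<le> 2 * norm x"
  using R_A[of x] norm_triangle_ineq4[of x "R x"] R_norm[of x] by simp

lemma B_R_norm: "norm (B.gen (R x)) \<le> 3 * K * norm x"
proof -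
  have "norm (B.gen (R x)) \<le> K * (1 powr (1 - \<alpha>) * norm (A.gen (R x)) + 1 powr - \<alpha> * norm (R x))"
    by (rule rel[OF R_dom]) auto
  also have "\<dots> \<le> K * (2 * norm x + norm x)"
    using A_R_norm[of x] R_norm[of x] by (intro mult_left_mono K) auto
  finally show ?thesis by simp
qed

lemma W_R_norm: "norm (W.gen (R x)) \<le> (2 + 3 * K) * norm x"
  using W_gen[OF R_dom, of x] A_R_norm[of x] B_R_norm[of x] norm_triangle_ineq[of "A.gen (R x)" "B.gen (R x)"]
  by (simp add: algebra_simps)

lemma R_W_norm: assumes x: "x \<in> A.dom" shows "norm (R (W.gen x)) \<le> (2 + L) * norm x"
proof -
  have "R (W.gen x) = R (A.gen x) + R (B.gen x)" by (simp add: W_gen x R.add)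
  then show ?thesis
    using R_A_norm[OF x] RB[OF rel_dom[OF x]] norm_triangle_ineq[of "R (A.gen x)" "R (B.gen x)"]
    by (simp add: algebra_simps)
qed

lemma dense_bound:
  assumes T: "bounded_linear T" and bd: "\<And>x. x \<in> A.dom \<Longrightarrow> norm (T x) \<le> M * norm x"
  shows "norm (T x) \<le> M * norm x"
proof -
  obtain X where X: "\<And>n. X n \<in> A.dom" and Xl: "X \<longlonglongrightarrow> x" using A_dense_sequence by blast
  show ?thesis
  proof (rule LIMSEQ_le)
    show "(\<lambda>n. norm (T (X n))) \<longlonglongrightarrow> norm (T x)" by (intro tendsto_intros bounded_linear.tendsto[OF T] Xl)
    show "(\<lambda>n. M * norm (X n)) \<longlonglongrightarrow> M * norm x" by (intro tendsto_intros Xl)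
  qed (use bd X in auto)
qed

lemma R_V_diff: assumes t: "0 \<le> t" shows "norm (R (V t x - x)) \<le> L * t * norm x"
  by (rule dense_bound[OF bounded_linear_compose[OF R_bounded_linear
        bounded_linear_sub[OF B.bdd_linear[OF t] bounded_linear_ident]]])
    (rule B.diff_bound[OF R_bounded_linear RB L rel_dom t])

lemma R_S_diff: assumes t: "0 \<le> t" shows "norm (R (S t x - x)) \<le> 2 * t * norm x"
  by (rule dense_bound[OF bounded_linear_compose[OF R_bounded_linear
        bounded_linear_sub[OF A.bdd_linear[OF t] bounded_linear_ident]]])
    (rule A.diff_bound[OF R_bounded_linear R_A_norm zero_le_numeral _ t])

lemma R_W_diff: assumes t: "0 \<le> t" shows "norm (R (W t x - x)) \<le> (2 + L) * t * norm x"
  by (rule dense_bound[OF bounded_linear_compose[OF R_bounded_linear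
        bounded_linear_sub[OF W.bdd_linear[OF t] bounded_linear_ident]]])
    (rule W.diff_bound[OF R_bounded_linear R_W_norm _ _ t], use L in \<open>auto simp: W_dom\<close>)

definition F where "F t x = V t (S t x)"
definition \<Delta> where "\<Delta> t x = F t x - W t x"

lemma F_bounded_linear: "0 \<le> t \<Longrightarrow> bounded_linear (F t)"
  unfolding F_def[abs_def] by (intro bounded_linear_compose[OF B.bdd_linear A.bdd_linear])

lemma F_norm: "0 \<le> t \<Longrightarrow> norm (F t x) \<le> norm x"
  unfolding F_def using B.norm_le A.norm_le order_trans by blast

lemma R_\<Delta>: assumes t: "0 \<le> t" shows "norm (R (\<Delta> t x)) \<le> (4 + 2 * L) * t * norm x"
proof -
  have "R (\<Delta> t x) = R (V t (S t x) - S t x) + R (S t x - x) - R (W t x - x)"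
    by (simp add: \<Delta>_def F_def R.diff)
  then have "norm (R (\<Delta> t x)) \<le> norm (R (V t (S t x) - S t x)) + norm (R (S t x - x)) + norm (R (W t x - x))"
    by (simp only: norm_add_add_diff_le)
  also have "\<dots> \<le> L * t * norm x + 2 * t * norm x + (2 + L) * t * norm x"
  proof (intro add_mono R_S_diff R_W_diff t)
    have "norm (R (V t (S t x) - S t x)) \<le> L * t * norm (S t x)" by (rule R_V_diff[OF t])
    also have "\<dots> \<le> L * t * norm x" using L t A.norm_le by (intro mult_left_mono) auto
    finally show "norm (R (V t (S t x) - S t x)) \<le> L * t * norm x" .
  qed
  finally show ?thesis by (simp add: algebra_simps)
qed

lemma \<Delta>_R: assumes t: "0 \<le> t" shows "norm (\<Delta> t (R x)) \<le> (4 + 6 * K) * t * norm x"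
proof -
  let ?y = "R x"
  have "\<Delta> t ?y = V t (S t ?y - ?y) + (V t ?y - ?y) - (W t ?y - ?y)"
    using t by (simp add: \<Delta>_def F_def B.linear_simps)
  then have "norm (\<Delta> t ?y) \<le> norm (V t (S t ?y - ?y)) + norm (V t ?y - ?y) + norm (W t ?y - ?y)"
    by (simp only: norm_add_add_diff_le)
  also have "\<dots> \<le> norm (A.gen ?y) * t + norm (B.gen ?y) * t + norm (W.gen ?y) * t"
  proof (intro add_mono)
    show "norm (V t (S t ?y - ?y)) \<le> norm (A.gen ?y) * t"
      by (rule order_trans[OF B.norm_le[OF t] A.norm_diff_le[OF A.gen_mem[OF R_dom] t]])
    show "norm (V t ?y - ?y) \<le> norm (B.gen ?y) * t"
      by (rule B.norm_diff_le[OF B.gen_mem[OF rel_dom[OF R_dom]] t])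
    show "norm (W t ?y - ?y) \<le> norm (W.gen ?y) * t"
      by (rule W.norm_diff_le[OF W.gen_mem t]) (simp add: W_dom R_dom)
  qed
  also have "\<dots> \<le> (2 * norm x) * t + (3 * K * norm x) * t + ((2 + 3 * K) * norm x) * t"
    by (intro add_mono mult_right_mono A_R_norm B_R_norm W_R_norm t)
  finally show ?thesis by (simp add: algebra_simps)
qed

text \<open>The terms linear in \<open>t\<close> cancel because \<open>W.gen\<close> is the sum of
  the two generators on the domain. What remains are three Taylor remainders and a mixed
  term.\<close>

lemma R_\<Delta>_R:
  assumes t: "0 \<le> t"
  shows "norm (R (\<Delta> t (R x))) \<le> (2 * L + 3 * K * L + 4 + (2 + L) * (2 + 3 * K)) * t\<^sup>2 * norm x"
proof -
  let ?y = "R x"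
  define a b where "a = A.gen ?y" and "b = B.gen ?y"
  have w: "W.gen ?y = a + b" by (simp add: a_def b_def W_gen R_dom)
  \<comment> \<open>The mixed term \<open>(V t - 1)(S t - 1)\<close>: \<open>R\<close> gains a power
    of \<open>t\<close> from the first increment, the domain vector from the second.\<close>
  define T1 where "T1 = R (V t (S t ?y - ?y) - (S t ?y - ?y))"
  define T2 where "T2 = R (V t ?y - ?y + t *\<^sub>R b)"
  define T3 where "T3 = R (S t ?y - ?y + t *\<^sub>R a)"
  define T4 where "T4 = R (W t ?y - ?y + t *\<^sub>R (a + b))"
  have 1: "norm T1 \<le> 2 * L * t\<^sup>2 * norm x"
  proof -
    have "norm T1 \<le> L * t * norm (S t ?y - ?y)" unfolding T1_def by (rule R_V_diff[OF t])
    also have "\<dots> \<le> L * t * (norm a * t)"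
      unfolding a_def using L t by (intro mult_left_mono A.norm_diff_le A.gen_mem R_dom) auto
    also have "\<dots> \<le> L * t * (2 * norm x * t)"
      unfolding a_def using L t by (intro mult_left_mono mult_right_mono A_R_norm) auto
    finally show ?thesis by (simp add: power2_eq_square mult_ac)
  qed
  have 2: "norm T2 \<le> L * t\<^sup>2 * (3 * K * norm x)"
    unfolding T2_def b_def by (rule B.taylor_bound[OF R_bounded_linear R_V_diff L rel_dom[OF R_dom] t B_R_norm])
  have 3: "norm T3 \<le> 2 * t\<^sup>2 * (2 * norm x)"
    unfolding T3_def a_def by (rule A.taylor_bound[OF R_bounded_linear R_S_diff _ R_dom t A_R_norm]) simp_all
  have 4: "norm T4 \<le> (2 + L) * t\<^sup>2 * ((2 + 3 * K) * norm x)"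
    unfolding T4_def w[symmetric]
    by (rule W.taylor_bound[OF R_bounded_linear R_W_diff _ _ t W_R_norm]) (use L in \<open>auto simp: W_dom R_dom\<close>)
  have "\<Delta> t ?y = (V t (S t ?y - ?y) - (S t ?y - ?y)) + (V t ?y - ?y + t *\<^sub>R b)
      + (S t ?y - ?y + t *\<^sub>R a) - (W t ?y - ?y + t *\<^sub>R (a + b))"
    using t by (simp add: \<Delta>_def F_def B.linear_simps algebra_simps)
  then have "R (\<Delta> t ?y) = (T1 + T2) + T3 - T4" unfolding T1_def T2_def T3_def T4_def by (simp only: R.add R.diff)
  then have "norm (R (\<Delta> t ?y)) \<le> norm (T1 + T2) + norm T3 + norm T4" by (simp only: norm_add_add_diff_le)
  also have "norm (T1 + T2) \<le> norm T1 + norm T2" by (rule norm_triangle_ineq)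
  finally show ?thesis using 1 2 3 4 by (simp add: algebra_simps)
qed

lemma B_S_norm: assumes h: "0 < h" shows "norm (B.gen (S h x)) \<le> K * (c + 1) * (1 + h powr - \<alpha>) * norm x"
proof -
  \<comment> \<open>The interpolation parameter matched to the time \<open>h\<close>, capped at 1 as
    \<open>rel\<close> demands.\<close>
  define d where "d = min h 1"
  have d: "0 < d" "d \<le> 1" "d \<le> h" using h by (auto simp: d_def)
  have "d powr (1 - \<alpha>) * norm (A.gen (S h x)) \<le> d powr - \<alpha> * (c * norm x)"
  proof -
    have "d * (c / h) \<le> c" using d c h by (simp add: field_simps mult_left_mono)
    then have "d powr - \<alpha> * (d * (c / h)) * norm x \<le> d powr - \<alpha> * c * norm x"
      by (intro mult_right_mono mult_left_mono) auto
    moreover have "d powr (1 - \<alpha>) * norm (A.gen (S h x)) \<le> d powr (1 - \<alpha>) * (c / h * norm x)"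
      by (intro mult_left_mono smooth h) auto
    ultimately show ?thesis using powr_one_minus[OF d(1), of \<alpha>] by (simp add: mult_ac)
  qed
  moreover have "d powr - \<alpha> * norm (S h x) \<le> d powr - \<alpha> * norm x"
    using A.norm_le[of h x] h by (intro mult_left_mono) auto
  ultimately have "d powr (1 - \<alpha>) * norm (A.gen (S h x)) + d powr - \<alpha> * norm (S h x) \<le> (c + 1) * norm x * d powr - \<alpha>"
    by (simp add: algebra_simps)
  also have "\<dots> \<le> (c + 1) * norm x * (1 + h powr - \<alpha>)"
    using c by (intro mult_left_mono) (auto simp: d_def min_def)
  finally have "K * (d powr (1 - \<alpha>) * norm (A.gen (S h x)) + d powr - \<alpha> * norm (S h x))
      \<le> K * ((c + 1) * norm x * (1 + h powr - \<alpha>))" by (rule mult_left_mono[OF _ K])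
  with rel[OF smooth_dom[OF h] d(1,2), of x] show ?thesis by (simp add: mult_ac)
qed

text \<open>Expresses without domains that \<open>S s (1 + A)\<close> has norm at most
  \<open>1 + c / s\<close>: \<open>x\<close> is \<open>(1 + A) R x\<close>, and \<open>A\<close>
  moves through \<open>S s\<close>.\<close>

lemma S_R_norm: assumes s: "0 < s" shows "norm (S s x) \<le> (1 + c / s) * norm (R x)"
proof -
  have "S s x = S s (R x) + S s (A.gen (R x))" using R_right[of x] s A.linear_simps(1)[of s "R x" "A.gen (R x)"] by simp
  also have "S s (A.gen (R x)) = A.gen (S s (R x))" using s by (intro A.gen_simps(5)[symmetric] R_dom) auto
  finally have "norm (S s x) \<le> norm (S s (R x)) + norm (A.gen (S s (R x)))" by (metis norm_triangle_ineq)
  also have "\<dots> \<le> norm (R x) + c / s * norm (R x)"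
    using s by (intro add_mono A.norm_le smooth) auto
  finally show ?thesis by (simp add: algebra_simps)
qed

text \<open>The time \<open>s\<close> is spent in two halves: one smooths for \<open>B\<close>, at
  cost \<open>s powr - \<alpha>\<close>, the other for \<open>1 + A\<close>, at cost
  \<open>1 / s\<close>.\<close>

lemma V_diff_S_norm:
  assumes s: "0 < s" "s \<le> t" and tau: "0 \<le> \<tau>"
  shows "norm (V \<tau> (S s x) - S s x)
    \<le> 8 * K * (c + 1)\<^sup>2 * (1 + t)\<^sup>2 * \<tau> * s powr (- 1 - \<alpha>) * norm (R x)"
proof -
  define h where "h = s / 2"
  have h: "0 < h" "s = h + h" "h \<le> t" using s by (auto simp: h_def)
  have S2: "S s x = S h (S h x)" using A.add[of h h x] h by simp
  have "norm (V \<tau> (S s x) - S s x) \<le> norm (B.gen (S s x)) * \<tau>"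
    using tau s by (intro B.norm_diff_le B.gen_mem rel_dom smooth_dom)
  also have "norm (B.gen (S s x)) \<le> K * (c + 1) * (1 + h powr - \<alpha>) * norm (S h x)"
    unfolding S2 by (rule B_S_norm[OF h(1)])
  also have "\<dots> \<le> K * (c + 1) * (1 + h powr - \<alpha>) * ((1 + c / h) * norm (R x))"
    using K c by (intro mult_left_mono S_R_norm h) auto
  \<comment> \<open>The nonsingular constants are absorbed into the singular terms by
    \<open>h \<le> t\<close>, at the price of one factor \<open>1 + t\<close> each.\<close>
  also have "\<dots> \<le> K * (c + 1) * (2 * (1 + t) * h powr - \<alpha>) * (((c + 1) * (1 + t) / h) * norm (R x))"
  proof (intro mult_mono mult_left_mono mult_right_mono)
    have "h powr \<alpha> \<le> 1 + h"
    proof (cases "h \<le> 1")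
      case True
      then have "h powr \<alpha> \<le> 1" using h alpha by (intro powr_le1) auto
      then show ?thesis using h by simp
    next
      case False
      then have "h powr \<alpha> \<le> h powr 1" using alpha by (intro powr_mono) auto
      then show ?thesis using h by simp
    qed
    then have "h powr \<alpha> + 1 \<le> 2 * (1 + t)" using h by simp
    then have "(h powr \<alpha> + 1) * h powr - \<alpha> \<le> 2 * (1 + t) * h powr - \<alpha>" by (intro mult_right_mono) auto
    moreover have "h powr \<alpha> * h powr - \<alpha> = 1" using h by (simp flip: powr_add)
    ultimately show "1 + h powr - \<alpha> \<le> 2 * (1 + t) * h powr - \<alpha>" by (simp add: algebra_simps)
    have "h + c \<le> (c + 1) * (1 + t)"
    proof -
      have "0 \<le> c * t" using c h by simp
      then show ?thesis using h by (simp add: algebra_simps)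
    qed
    then have "(h + c) / h \<le> (c + 1) * (1 + t) / h" using h by (intro divide_right_mono) auto
    then show "1 + c / h \<le> (c + 1) * (1 + t) / h" using h by (simp add: add_divide_distrib)
  qed (use K c h s in auto)
  also have "\<dots> = 2 * K * (c + 1)\<^sup>2 * (1 + t)\<^sup>2 * (h powr - \<alpha> / h) * norm (R x)"
  proof -
    have "K * a * (2 * T * p) * ((a * T / h) * y) = 2 * K * a\<^sup>2 * T\<^sup>2 * (p / h) * y" for a T p y
      by (simp add: power2_eq_square mult_ac)
    then show ?thesis .
  qed
  \<comment> \<open>Passing from \<open>h = s / 2\<close> back to \<open>s\<close> costs
    \<open>2 powr (1 + \<alpha>)\<close>, at most 4; with the factor 2 already present this makes
    the 8.\<close>
  also have "h powr - \<alpha> / h \<le> 4 * s powr (- 1 - \<alpha>)"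
  proof -
    have "h powr - \<alpha> / h = h powr (- 1 - \<alpha>)"
      using powr_add[of h "- \<alpha>" "- 1"] h by (simp add: powr_minus divide_inverse add.commute)
    also have "\<dots> = s powr (- 1 - \<alpha>) / 2 powr (- 1 - \<alpha>)" unfolding h_def by (simp add: powr_divide)
    also have "\<dots> = s powr (- 1 - \<alpha>) * 2 powr (1 + \<alpha>)"
      using powr_minus[of "2::real" "- 1 - \<alpha>"] by (simp add: divide_inverse add.commute)
    also have "2 powr (1 + \<alpha>) \<le> (2::real) powr 2" using alpha by (intro powr_mono) auto
    finally show ?thesis by (simp add: mult_left_mono)
  qed
  finally show ?thesis using K c s tau
    by (simp add: mult_left_mono mult_right_mono mult_ac)
qed

definition D where "D = (1 + c) + 8 * K * (c + 1)\<^sup>2"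

lemma D_nonneg: "0 \<le> D" using K c by (simp add: D_def)

text \<open>In the expansion around \<open>S\<close> the powers of \<open>F\<close> serve only as
  contractions; all smoothing comes from \<open>S\<close>. Term \<open>j\<close> costs
  \<open>\<tau> * (Suc j * \<tau>) powr (- 1 - \<alpha>)\<close>. Keeping a bound \<open>H\<close>
  of the partial sums as a parameter treats \<open>\<alpha> > 0\<close> and
  \<open>\<alpha> = 0\<close> together.\<close>

lemma F_pow_R:
  assumes tau: "0 < \<tau>" and m: "0 < m" "real m * \<tau> \<le> t"
    and H: "0 \<le> H" "(\<Sum>j<m. real (Suc j) powr (- 1 - \<alpha>)) \<le> H"
  shows "norm ((F \<tau> ^^ m) x) \<le> D * (1 + t)\<^sup>2 * (1 / (real m * \<tau>) + \<tau> powr - \<alpha> * H) * norm (R x)"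
proof -
  have t: "0 < t" using mult_pos_pos[of "real m" \<tau>] tau m by linarith
  define q where "q = 8 * K * (c + 1)\<^sup>2 * (1 + t)\<^sup>2"
  have q: "0 \<le> q" using K by (simp add: q_def)
  have Fl: "linear (F \<tau>)" using F_bounded_linear tau by (simp add: bounded_linear.linear)
  have "(F \<tau> ^^ m) x = (S \<tau> ^^ m) x + ((F \<tau> ^^ m) x - (S \<tau> ^^ m) x)" by simp
  also have "(F \<tau> ^^ m) x - (S \<tau> ^^ m) x
      = (\<Sum>j<m. (F \<tau> ^^ (m - 1 - j)) (F \<tau> ((S \<tau> ^^ j) x) - S \<tau> ((S \<tau> ^^ j) x)))"
    by (rule funpow_diff_telescope[OF Fl])
  finally have "(F \<tau> ^^ m) x = (S \<tau> ^^ m) x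
      + (\<Sum>j<m. (F \<tau> ^^ (m - 1 - j)) (F \<tau> ((S \<tau> ^^ j) x) - S \<tau> ((S \<tau> ^^ j) x)))" .
  then have "norm ((F \<tau> ^^ m) x) \<le> norm ((S \<tau> ^^ m) x)
      + (\<Sum>j<m. norm ((F \<tau> ^^ (m - 1 - j)) (F \<tau> ((S \<tau> ^^ j) x) - S \<tau> ((S \<tau> ^^ j) x))))"
    by (simp only:) (intro order_trans[OF norm_triangle_ineq] add_left_mono norm_sum)
  also have "norm ((S \<tau> ^^ m) x) \<le> (1 + c) * (1 + t)\<^sup>2 * (1 / (real m * \<tau>)) * norm (R x)"
  proof -
    let ?s = "real m * \<tau>"
    have s: "0 < ?s" using m tau by simp
    have "norm ((S \<tau> ^^ m) x) \<le> (1 + c / ?s) * norm (R x)"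
      using A.funpow_eq[of \<tau> m x] tau S_R_norm[OF s, of x] by simp
    also have "1 + c / ?s \<le> (1 + c) * (1 + t)\<^sup>2 * (1 / ?s)"
    proof -
      have ct: "0 \<le> c * t" using c t by simp
      have "?s + c \<le> (1 + c) * (1 + t)" using ct m(2) by (simp add: algebra_simps)
      also have "\<dots> \<le> (1 + c) * (1 + t)\<^sup>2" using c t by (intro mult_left_mono) (auto simp: power2_eq_square)
      finally have "(?s + c) / ?s \<le> (1 + c) * (1 + t)\<^sup>2 / ?s" using s by (intro divide_right_mono) auto
      moreover have "1 + c / s = (s + c) / s" if "0 < s" for s using that by (simp add: add_divide_distrib)
      ultimately show ?thesis using s by simp
    qed
    finally show ?thesis by (simp add: mult_right_mono)
  qed
  also have "(\<Sum>j<m. norm ((F \<tau> ^^ (m - 1 - j)) (F \<tau> ((S \<tau> ^^ j) x) - S \<tau> ((S \<tau> ^^ j) x))))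
      \<le> (\<Sum>j<m. q * \<tau> powr - \<alpha> * norm (R x) * real (Suc j) powr (- 1 - \<alpha>))"
  proof (rule sum_mono)
    fix j assume j: "j \<in> {..<m}"
    let ?s = "real (Suc j) * \<tau>"
    have "?s \<le> real m * \<tau>" using j tau by (intro mult_right_mono) auto
    then have s: "0 < ?s" "?s \<le> t" using tau by (simp_all only: order_trans[OF _ m(2)]) simp
    \<comment> \<open>The \<open>S \<tau>\<close> inside \<open>F \<tau>\<close> adds one step, so
      the smoothing time is at least \<open>\<tau>\<close> even for \<open>j = 0\<close>.\<close>
    have e: "S \<tau> ((S \<tau> ^^ j) x) = S ?s x" using A.funpow_eq[of \<tau> "Suc j" x] tau by simp
    have "norm ((F \<tau> ^^ (m - 1 - j)) (F \<tau> ((S \<tau> ^^ j) x) - S \<tau> ((S \<tau> ^^ j) x)))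
        \<le> norm (F \<tau> ((S \<tau> ^^ j) x) - S \<tau> ((S \<tau> ^^ j) x))"
      using tau by (intro funpow_norm_le F_norm) auto
    also have "\<dots> = norm (V \<tau> (S ?s x) - S ?s x)" by (simp only: F_def e)
    also have "\<dots> \<le> q * \<tau> * ?s powr (- 1 - \<alpha>) * norm (R x)"
      unfolding q_def using V_diff_S_norm[OF s, of \<tau> x] tau by simp
    also have "\<tau> * ?s powr (- 1 - \<alpha>) = \<tau> powr - \<alpha> * real (Suc j) powr (- 1 - \<alpha>)"
    proof -
      have "\<tau> * \<tau> powr (- 1 - \<alpha>) = \<tau> powr - \<alpha>"
        using powr_add[of \<tau> 1 "- 1 - \<alpha>"] tau by simp
      then show ?thesis using tau by (simp add: powr_mult mult_ac)
    qed
    then have "q * \<tau> * ?s powr (- 1 - \<alpha>) * norm (R x) = q * \<tau> powr - \<alpha> * norm (R x) * real (Suc j) powr (- 1 - \<alpha>)"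
      by (metis (no_types, opaque_lifting) mult.assoc mult.commute)
    finally show "norm ((F \<tau> ^^ (m - 1 - j)) (F \<tau> ((S \<tau> ^^ j) x) - S \<tau> ((S \<tau> ^^ j) x)))
        \<le> q * \<tau> powr - \<alpha> * norm (R x) * real (Suc j) powr (- 1 - \<alpha>)" .
  qed
  also have "\<dots> = q * \<tau> powr - \<alpha> * norm (R x) * (\<Sum>j<m. real (Suc j) powr (- 1 - \<alpha>))"
    by (simp add: sum_distrib_left)
  also have "\<dots> \<le> q * \<tau> powr - \<alpha> * norm (R x) * H"
    using q by (intro mult_left_mono H) auto
  also have "(1 + c) * (1 + t)\<^sup>2 * (1 / (real m * \<tau>)) * norm (R x) + q * \<tau> powr - \<alpha> * norm (R x) * H
      \<le> D * (1 + t)\<^sup>2 * (1 / (real m * \<tau>)) * norm (R x) + D * (1 + t)\<^sup>2 * \<tau> powr - \<alpha> * norm (R x) * H"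
  proof (intro add_mono mult_right_mono)
    show "1 + c \<le> D" "q \<le> D * (1 + t)\<^sup>2" using K c unfolding D_def q_def by (auto intro!: mult_right_mono)
  qed (use tau H in auto)
  finally show ?thesis by (simp add: algebra_simps)
qed

definition \<kappa> where "\<kappa> = 2 * L + 3 * K * L + 4 + (2 + L) * (2 + 3 * K)"
text \<open>Adds the prefactors of the first, the middle and the last summands of the telescoped
  error, so that one constant serves all three.\<close>

definition E where "E = D * (4 + 2 * L + \<kappa> * (1 + N)) + (4 + 6 * K) * (1 + N)"

lemma E_nonneg: "0 \<le> E"
  unfolding E_def \<kappa>_def using D_nonneg K L N by (intro add_nonneg_nonneg mult_nonneg_nonneg) auto

text \<open>Places a resolvent on the right of the one-step error; the vector is
  \<open>(1 + A) W(s) x\<close>, controlled by the smoothing of \<open>W\<close>.\<close>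

lemma W_as_R:
  assumes s: "0 < s" "s \<le> t"
  shows "\<exists>y. W s x = R y \<and> norm y \<le> (1 + N) * (1 + t) / s * norm x"
proof (intro exI conjI)
  let ?y = "W s x + A.gen (W s x)"
  show "W s x = R ?y" by (rule R_left[OF WS_dom[OF s(1)], symmetric])
  have "norm ?y \<le> norm x + N * (1 + 1 / s) * norm x"
    using norm_triangle_ineq[of "W s x" "A.gen (W s x)"] W.norm_le[of s x] WS[OF s(1), of x] s by linarith
  also have "\<dots> \<le> (1 + 1 / s) * norm x + N * (1 + 1 / s) * norm x"
    using s by (intro add_right_mono) (simp add: mult_le_cancel_right1)
  also have "\<dots> = (1 + N) * (s + 1) / s * norm x" using s by (simp add: field_simps)
  also have "\<dots> \<le> (1 + N) * (1 + t) / s * norm x"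
    using s N by (intro mult_right_mono divide_right_mono mult_left_mono) auto
  finally show "norm ?y \<le> (1 + N) * (1 + t) / s * norm x" .
qed

theorem trotter_estimate:
  assumes t: "0 < t" and n: "3 \<le> n"
    and H: "1 \<le> H" "\<And>m. m \<le> n \<Longrightarrow> (\<Sum>j<m. real (Suc j) powr (- 1 - \<alpha>)) \<le> H"
  shows "norm ((F (t / real n) ^^ n) x - W t x)
    \<le> E * (1 + t) ^ 3 * (12 + 3 * H * t powr (1 - \<alpha>)) * (ln (real n) / real n powr (1 - \<alpha>)) * norm x"
proof -
  define \<tau> where "\<tau> = t / real n"
  have tau: "0 < \<tau>" "real n * \<tau> = t" using t n by (auto simp: \<tau>_def)
  have T1: "1 \<le> 1 + t" "0 \<le> 1 + t" using t by auto
  have le: "real k * \<tau> \<le> t" if "k \<le> n" for k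
    using mult_right_mono[of "real k" "real n" \<tau>] that tau by simp
  define g where "g m = 1 / (real m * \<tau>) + \<tau> powr - \<alpha> * H" for m
  have g0: "0 \<le> g m" for m unfolding g_def using tau H by auto
  have FR: "norm ((F \<tau> ^^ m) y) \<le> D * (1 + t)\<^sup>2 * g m * norm (R y)" if "0 < m" "m \<le> n" for m y
    unfolding g_def using that H by (intro F_pow_R tau le) auto
  define Ek where "Ek = E * (1 + t) ^ 3 * norm x"
  have Ek: "0 \<le> Ek" using E_nonneg T1 by (simp add: Ek_def)
  have k0: "0 \<le> \<kappa>" using K L by (simp add: \<kappa>_def)
  have Efac: "M * (1 + t) ^ i * norm x \<le> Ek" if "M \<le> E" "0 \<le> M" "i \<le> 3" for M i
    unfolding Ek_def using that T1 E_nonneg by (intro mult_right_mono mult_mono power_increasing) auto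
  have E1: "D * (4 + 2 * L) \<le> E" "D * (\<kappa> * (1 + N)) \<le> E" "(4 + 6 * K) * (1 + N) \<le> E"
    using D_nonneg K L N k0 by (auto simp: E_def distrib_left)
  define trm where "trm k = norm ((F \<tau> ^^ (n - 1 - k)) (\<Delta> \<tau> ((W \<tau> ^^ k) x)))" for k
  have Wk: "(W \<tau> ^^ k) x = W (real k * \<tau>) x" for k using W.funpow_eq tau by simp
  \<comment> \<open>At time 0 there is no smoothing on the right: the resolvent from the left gives
    one power of \<open>\<tau>\<close>, and the power \<open>n - 1\<close> of \<open>F\<close> makes
    up for the rest.\<close>
  have t0: "trm 0 \<le> Ek * (1 / real (n - 1) + \<tau> powr (1 - \<alpha>) * H)"
  proof -
    have "trm 0 \<le> D * (1 + t)\<^sup>2 * g (n - 1) * norm (R (\<Delta> \<tau> x))"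
      unfolding trm_def using FR[of "n - 1" "\<Delta> \<tau> x"] n by simp
    also have "\<dots> \<le> D * (1 + t)\<^sup>2 * g (n - 1) * ((4 + 2 * L) * \<tau> * norm x)"
      using tau D_nonneg g0 by (intro mult_left_mono R_\<Delta>) auto
    also have "\<dots> = (D * (4 + 2 * L) * (1 + t)\<^sup>2 * norm x) * (g (n - 1) * \<tau>)" by (simp add: mult_ac)
    also have "\<dots> \<le> Ek * (g (n - 1) * \<tau>)"
      using D_nonneg L g0 tau by (intro mult_right_mono Efac E1) auto
    also have "g (n - 1) * \<tau> = 1 / real (n - 1) + \<tau> powr (1 - \<alpha>) * H"
      using tau powr_one_minus[OF tau(1), of \<alpha>] by (simp add: g_def algebra_simps)
    finally show ?thesis .
  qed
  \<comment> \<open>Both resolvents are available: of \<open>\<tau>^2\<close>, one power cancels the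
    singularity \<open>1 / (k \<tau>)\<close> of \<open>W\<close> and the other multiplies
    \<open>g\<close>.\<close>
  have tk: "trm k \<le> Ek * (1 / (real (n - 1 - k) * real k) + \<tau> powr (1 - \<alpha>) * H / real k)"
    if k: "k \<in> {1..n-2}" for k
  proof -
    have s: "0 < real k * \<tau>" "real k * \<tau> \<le> t" using k tau le[of k] by auto
    obtain y where y: "W (real k * \<tau>) x = R y" "norm y \<le> (1 + N) * (1 + t) / (real k * \<tau>) * norm x"
      using W_as_R[OF s] by blast
    have m: "0 < n - 1 - k" "n - 1 - k \<le> n" using k n by auto
    have "trm k \<le> D * (1 + t)\<^sup>2 * g (n - 1 - k) * norm (R (\<Delta> \<tau> (R y)))"
      unfolding trm_def Wk y(1) by (rule FR[OF m])
    also have "\<dots> \<le> D * (1 + t)\<^sup>2 * g (n - 1 - k) * (\<kappa> * \<tau>\<^sup>2 * ((1 + N) * (1 + t) / (real k * \<tau>) * norm x))"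
    proof (intro mult_left_mono)
      have "norm (R (\<Delta> \<tau> (R y))) \<le> \<kappa> * \<tau>\<^sup>2 * norm y" unfolding \<kappa>_def using tau by (intro R_\<Delta>_R) auto
      also have "\<dots> \<le> \<kappa> * \<tau>\<^sup>2 * ((1 + N) * (1 + t) / (real k * \<tau>) * norm x)"
        using k0 by (intro mult_left_mono y) auto
      finally show "norm (R (\<Delta> \<tau> (R y))) \<le> \<kappa> * \<tau>\<^sup>2 * ((1 + N) * (1 + t) / (real k * \<tau>) * norm x)" .
    qed (use D_nonneg g0 in auto)
    also have "\<dots> = (D * (\<kappa> * (1 + N)) * (1 + t) ^ 3 * norm x) * (g (n - 1 - k) * \<tau> / real k)"
      using tau k by (simp add: power2_eq_square power3_eq_cube)
    also have "\<dots> \<le> Ek * (g (n - 1 - k) * \<tau> / real k)"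
      using D_nonneg k0 N g0 tau by (intro mult_right_mono Efac E1) auto
    also have "g (n - 1 - k) * \<tau> / real k = 1 / (real (n - 1 - k) * real k) + \<tau> powr (1 - \<alpha>) * H / real k"
    proof -
      have "g (n - 1 - k) * \<tau> = 1 / real (n - 1 - k) + \<tau> powr (1 - \<alpha>) * H"
        using tau powr_one_minus[OF tau(1), of \<alpha>] by (simp add: g_def algebra_simps)
      then show ?thesis by (simp add: add_divide_distrib)
    qed
    finally show ?thesis .
  qed
  \<comment> \<open>No power of \<open>F\<close> is left here; the resolvent comes from the right
    alone, at a time close to \<open>t\<close>.\<close>
  have tn: "trm (n - 1) \<le> Ek * (1 / real (n - 1))"
  proof -
    have s: "0 < real (n - 1) * \<tau>" "real (n - 1) * \<tau> \<le> t" using n tau le[of "n - 1"] by auto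
    obtain y where y: "W (real (n - 1) * \<tau>) x = R y" "norm y \<le> (1 + N) * (1 + t) / (real (n - 1) * \<tau>) * norm x"
      using W_as_R[OF s] by blast
    have "trm (n - 1) = norm (\<Delta> \<tau> (R y))" unfolding trm_def Wk y(1) by simp
    also have "\<dots> \<le> (4 + 6 * K) * \<tau> * norm y" using tau by (intro \<Delta>_R) auto
    also have "\<dots> \<le> (4 + 6 * K) * \<tau> * ((1 + N) * (1 + t) / (real (n - 1) * \<tau>) * norm x)"
      using K tau by (intro mult_left_mono y) auto
    also have "\<dots> = ((4 + 6 * K) * (1 + N) * (1 + t) ^ 1 * norm x) * (1 / real (n - 1))"
      using tau by simp
    also have "\<dots> \<le> Ek * (1 / real (n - 1))"
      using K N by (intro mult_right_mono Efac E1) auto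
    finally show ?thesis .
  qed
  define h where "h = (harm (n - 2) :: real)"
  \<comment> \<open>Since \<open>exp 1 \<le> 3\<close>, additive constants can be absorbed in the
    logarithm: \<open>2 + 2 h \<le> 6 ln n\<close> and \<open>1 + h \<le> 3 ln n\<close>.\<close>
  have ln1: "1 \<le> ln (real n)"
  proof -
    have "exp 1 \<le> real n" using exp_le n by linarith
    then show ?thesis using n by (subst ln_ge_iff) auto
  qed
  have h: "0 \<le> h" "h \<le> 1 + ln (real n)"
    using harm_nonneg harm_mono[of "n - 2" n, where 'a = real] harm_le_ln[of n] n by (auto simp: h_def)
  have Fl: "linear (F \<tau>)" using F_bounded_linear tau by (simp add: bounded_linear.linear)
  have "(F \<tau> ^^ n) x - (W \<tau> ^^ n) x = (\<Sum>k<n. (F \<tau> ^^ (n - 1 - k)) (\<Delta> \<tau> ((W \<tau> ^^ k) x)))"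
    unfolding \<Delta>_def by (rule funpow_diff_telescope[OF Fl])
  then have "norm ((F \<tau> ^^ n) x - W t x) \<le> (\<Sum>k<n. trm k)"
    unfolding trm_def Wk[of n] tau(2) by (metis norm_sum)
  also have "{..<n} = insert 0 (insert (n - 1) {1..n-2})" using n by auto
  also have "sum trm \<dots> = trm 0 + (trm (n - 1) + sum trm {1..n-2})"
  proof -
    have "0 \<notin> insert (n - 1) {1..n-2}" "n - 1 \<notin> {1..n-2}" using n by (simp_all, arith)
    then show ?thesis by (simp only: sum.insert finite_insert finite_atLeastAtMost not_False_eq_True)
  qed
  also have "\<dots> \<le> Ek * (1 / real (n - 1) + \<tau> powr (1 - \<alpha>) * H) + (Ek * (1 / real (n - 1))
      + (\<Sum>k=1..n-2. Ek * (1 / (real (n - 1 - k) * real k) + \<tau> powr (1 - \<alpha>) * H / real k)))"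
    by (intro add_mono t0 tn sum_mono tk)
  also have "(\<Sum>k=1..n-2. Ek * (1 / (real (n - 1 - k) * real k) + \<tau> powr (1 - \<alpha>) * H / real k))
      = Ek * (2 * h / real (n - 1) + \<tau> powr (1 - \<alpha>) * H * h)"
  proof -
    have 1: "(\<Sum>k=1..n-2. X / real k) = X * h" for X
      by (simp add: h_def harm_def sum_distrib_left divide_inverse)
    have 2: "(\<Sum>k=1..n-2. 1 / (real (n - 1 - k) * real k)) = 2 * h / real (n - 1)"
      unfolding h_def by (rule sum_inverse_mult_reflect) (use n in simp)
    show ?thesis by (simp only: sum.distrib 1 2 flip: sum_distrib_left)
  qed
  also have "Ek * (1 / real (n - 1) + \<tau> powr (1 - \<alpha>) * H) + (Ek * (1 / real (n - 1))
      + Ek * (2 * h / real (n - 1) + \<tau> powr (1 - \<alpha>) * H * h))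
      = Ek * ((2 + 2 * h) * (1 / real (n - 1)) + \<tau> powr (1 - \<alpha>) * H * (1 + h))"
    by (simp add: algebra_simps add_divide_distrib)
  also have "\<dots> \<le> Ek * ((6 * ln (real n)) * (2 / real n) + \<tau> powr (1 - \<alpha>) * H * (3 * ln (real n)))"
  proof (intro mult_left_mono add_mono mult_mono Ek)
    show "1 / real (n - 1) \<le> 2 / real n" using n by (simp add: field_simps of_nat_diff)
  qed (use h ln1 H in auto)
  also have "\<dots> \<le> Ek * ((12 + 3 * H * t powr (1 - \<alpha>)) * (ln (real n) / real n powr (1 - \<alpha>)))"
  proof (intro mult_left_mono Ek)
    have "real n powr (1 - \<alpha>) \<le> real n powr 1" using n alpha by (intro powr_mono) auto
    then have "1 / real n \<le> 1 / real n powr (1 - \<alpha>)" using n by (intro divide_left_mono) auto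
    then have "12 * ln (real n) * (1 / real n) \<le> 12 * ln (real n) * (1 / real n powr (1 - \<alpha>))"
      using ln1 by (intro mult_left_mono) auto
    moreover have "\<tau> powr (1 - \<alpha>) = t powr (1 - \<alpha>) / real n powr (1 - \<alpha>)"
      unfolding \<tau>_def by (rule powr_divide)
    ultimately show "(6 * ln (real n)) * (2 / real n) + \<tau> powr (1 - \<alpha>) * H * (3 * ln (real n))
        \<le> (12 + 3 * H * t powr (1 - \<alpha>)) * (ln (real n) / real n powr (1 - \<alpha>))"
      by (simp add: algebra_simps)
  qed
  finally show ?thesis by (simp add: Ek_def \<tau>_def mult_ac)
qed

text \<open>The polynomial growth is absorbed by \<open>1 + t \<le> exp t\<close>, hence the
  exponent 3. Time zero, which the smoothing bounds do not reach, is exact.\<close>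

lemma trotter_onorm:
  assumes t: "0 \<le> t" and n: "3 \<le> n"
    and H: "1 \<le> H" "\<And>m. m \<le> n \<Longrightarrow> (\<Sum>j<m. real (Suc j) powr (- 1 - \<alpha>)) \<le> H"
  shows "onorm (\<lambda>x. (F (t / real n) ^^ n) x - W t x)
    \<le> exp (3 * t) * (E * (12 + 3 * H * t powr (1 - \<alpha>)) * (ln (real n) / real n powr (1 - \<alpha>)))"
    (is "_ \<le> _ * ?b")
proof (rule onorm_bound)
  have b: "0 \<le> ?b" using E_nonneg H n by (intro mult_nonneg_nonneg divide_nonneg_nonneg add_nonneg_nonneg) auto
  show b': "0 \<le> exp (3 * t) * ?b" by (rule mult_nonneg_nonneg[OF exp_ge_zero b])
  fix x
  show "norm ((F (t / real n) ^^ n) x - W t x) \<le> exp (3 * t) * ?b * norm x"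
  proof (cases "t = 0")
    case True
    have "F 0 = id" by (auto simp: F_def)
    then have z: "(F (t / real n) ^^ n) x - W t x = 0" using True by simp
    show ?thesis using mult_nonneg_nonneg[OF b' norm_ge_zero[of x]] by (simp only: z norm_zero)
  next
    case False
    then have "norm ((F (t / real n) ^^ n) x - W t x) \<le> (1 + t) ^ 3 * ?b * norm x"
      using trotter_estimate[OF _ n H, of t x] t by (simp add: mult_ac)
    also have "\<dots> \<le> exp (3 * t) * ?b * norm x"
    proof (intro mult_right_mono b norm_ge_zero)
      have "(1 + t) ^ 3 \<le> exp t ^ 3" using t by (intro power_mono exp_ge_add_one_self) auto
      also have "\<dots> = exp (3 * t)" using exp_of_nat_mult[of 3 t] by simp
      finally show "(1 + t) ^ 3 \<le> exp (3 * t)" .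
    qed
    finally show ?thesis .
  qed
qed

text \<open>The choice of \<open>H\<close> separates the cases: for \<open>\<alpha> > 0\<close> the
  series converges, for \<open>\<alpha> = 0\<close> the partial sums are harmonic numbers and
  contribute the second logarithm.\<close>

theorem trotter_convergence:
  "\<exists>M1>0. \<exists>M2>0. \<exists>M2'>0. \<exists>\<eta>>0. \<forall>t\<ge>0. \<forall>n::nat. n > 2 \<longrightarrow>
      (\<alpha> > 0 \<longrightarrow> onorm (\<lambda>x. (F (t / real n) ^^ n) x - W t x)
          \<le> exp (\<eta> * t) * (M1 + M2 * t powr (1 - \<alpha>)) * (ln (real n) / real n powr (1 - \<alpha>))) \<and>
      (\<alpha> = 0 \<longrightarrow> onorm (\<lambda>x. (F (t / real n) ^^ n) x - W t x)
          \<le> exp (\<eta> * t) * (M1 + M2' * t) * (2 * (ln (real n))\<^sup>2 / real n))"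
proof -
  have ln1: "1 \<le> ln (real n)" if "2 < n" for n :: nat
  proof -
    have "exp 1 \<le> real n" using exp_le that by linarith
    then show ?thesis using that by (subst ln_ge_iff) auto
  qed
  show ?thesis
  proof (cases "\<alpha> = 0")
    case True
    \<comment> \<open>The factor 2 in the target rate halves the constants 12 and 6 of the estimate;
      the added 1 gives strict positivity from \<open>E_nonneg\<close> alone.\<close>
    have "onorm (\<lambda>x. (F (t / real n) ^^ n) x - W t x)
        \<le> exp (3 * t) * ((6 * E + 1) + (3 * E + 1) * t) * (2 * (ln (real n))\<^sup>2 / real n)"
      if t: "0 \<le> t" and n: "2 < n" for t and n :: nat
    proof -
      define l where "l = ln (real n)"
      have l: "1 \<le> l" unfolding l_def by (rule ln1[OF n])
      have "onorm (\<lambda>x. (F (t / real n) ^^ n) x - W t x)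
        \<le> exp (3 * t) * (E * (12 + 3 * (1 + l) * t powr (1 - \<alpha>)) * (l / real n powr (1 - \<alpha>)))"
        unfolding l_def
      proof (rule trotter_onorm[OF t])
        fix m assume m: "m \<le> n"
        have "(\<Sum>j<m. real (Suc j) powr (- 1 - \<alpha>)) = harm m"
          unfolding harm_altdef by (intro sum.cong) (auto simp: True powr_minus)
        also have "\<dots> \<le> harm n" by (rule harm_mono[OF m])
        also have "\<dots> \<le> 1 + ln (real n)" using n by (intro harm_le_ln) auto
        finally show "(\<Sum>j<m. real (Suc j) powr (- 1 - \<alpha>)) \<le> 1 + ln (real n)" .
      qed (use n l l_def in auto)
      also have "E * (12 + 3 * (1 + l) * t powr (1 - \<alpha>)) * (l / real n powr (1 - \<alpha>))
          \<le> ((6 * E + 1) + (3 * E + 1) * t) * (2 * l\<^sup>2 / real n)"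
      proof -
        have "E * (12 + 3 * (1 + l) * t) \<le> E * ((12 + 6 * t) * l)"
        proof (rule mult_left_mono[OF _ E_nonneg])
          have "3 * (1 + l) * t \<le> 6 * l * t" using l t by (intro mult_right_mono) auto
          then show "12 + 3 * (1 + l) * t \<le> (12 + 6 * t) * l" using l by (simp add: algebra_simps)
        qed
        also have "\<dots> \<le> (2 * ((6 * E + 1) + (3 * E + 1) * t)) * l"
          using t l E_nonneg unfolding mult.assoc[symmetric] by (intro mult_right_mono) (auto simp: algebra_simps)
        finally have "E * (12 + 3 * (1 + l) * t) * (l / real n) \<le> (2 * ((6 * E + 1) + (3 * E + 1) * t)) * l * (l / real n)"
          using l by (intro mult_right_mono) auto
        moreover have "t powr (1 - \<alpha>) = t" "real n powr (1 - \<alpha>) = real n" using t n True by auto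
        ultimately show ?thesis by (simp add: power2_eq_square mult_ac)
      qed
      finally show ?thesis by (simp add: l_def mult.assoc)
    qed
    then show ?thesis using E_nonneg True
      by (intro exI[of _ "6 * E + 1"] exI[of _ 1] exI[of _ "3 * E + 1"] exI[of _ 3] conjI) auto
  next
    case False
    then have a: "0 < \<alpha>" using alpha by simp
    define f where "f j = real (Suc j) powr (- 1 - \<alpha>)" for j
    have "summable (\<lambda>j. real j powr (- 1 - \<alpha>))" using a by (simp add: summable_real_powr_iff)
    then have f: "summable f" unfolding f_def by (subst summable_Suc_iff)
    define H where "H = max 1 (suminf f)"
    have H: "1 \<le> H" "(\<Sum>j<m. f j) \<le> H" for m
      using sum_le_suminf[OF f, of "{..<m}"] by (auto simp: H_def f_def)
    have "onorm (\<lambda>x. (F (t / real n) ^^ n) x - W t x)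
        \<le> exp (3 * t) * ((12 * E + 1) + (3 * E * H + 1) * t powr (1 - \<alpha>)) * (ln (real n) / real n powr (1 - \<alpha>))"
      if t: "0 \<le> t" and n: "2 < n" for t and n :: nat
    proof -
      have "onorm (\<lambda>x. (F (t / real n) ^^ n) x - W t x)
        \<le> exp (3 * t) * (E * (12 + 3 * H * t powr (1 - \<alpha>)) * (ln (real n) / real n powr (1 - \<alpha>)))"
        using n H by (intro trotter_onorm t) (auto simp: f_def)
      also have "E * (12 + 3 * H * t powr (1 - \<alpha>)) \<le> (12 * E + 1) + (3 * E * H + 1) * t powr (1 - \<alpha>)"
        by (simp add: algebra_simps)
      finally show ?thesis using ln1[OF n] by (simp add: mult.assoc mult_left_mono mult_right_mono divide_right_mono)
    qed
    moreover have "0 < 3 * E * H + 1" using E_nonneg H by (simp add: add_nonneg_pos)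
    ultimately show ?thesis using E_nonneg False
      by (intro exI[of _ "12 * E + 1"] exI[of _ "3 * E * H + 1"] exI[of _ 1] exI[of _ 3] conjI) auto
  qed
qed

end

section \<open>The resolvent of the generator and the final assembly\<close>

lemma (in contraction_sg) resolvent_exists:
  "\<exists>R. bounded_clinear R \<and> (\<forall>x. R x \<in> dom \<and> R x + gen (R x) = x) \<and> (\<forall>x\<in>dom. R (x + gen x) = x)"
proof -
  have "\<exists>y. y \<in> dom \<and> y + gen y = x" for x
    using G_surj[of 1 x] by (auto simp: G_iff)
  then obtain R where R: "\<And>x. R x \<in> dom" "\<And>x. R x + gen (R x) = x" by metis
  have acc: "norm x \<le> norm (x + gen x)" if "x \<in> dom" for x
    using G_accretive[OF gen_mem[OF that], of 1] by simp
  have left: "R z = x" if x: "x \<in> dom" "x + gen x = z" for x z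
  proof -
    have "R z - x + gen (R z - x) = (R z + gen (R z)) - (x + gen x)" by (simp add: gen_simps R(1) x(1))
    also have "\<dots> = 0" by (simp add: R(2) x(2))
    finally show ?thesis using acc[of "R z - x"] by (simp add: dom_simps R(1) x(1))
  qed
  have add: "R (x + y) = R x + R y" for x y
  proof (rule left)
    have "R x + R y + gen (R x + R y) = (R x + gen (R x)) + (R y + gen (R y))" by (simp add: gen_simps R(1))
    then show "R x + R y + gen (R x + R y) = x + y" by (simp add: R(2))
  qed (simp add: dom_simps R(1))
  have scC: "R (k *\<^sub>C x) = k *\<^sub>C R x" for k x
  proof (rule left)
    have "k *\<^sub>C R x + gen (k *\<^sub>C R x) = k *\<^sub>C (R x + gen (R x))" by (simp add: gen_simps R(1) scaleC_add_right)
    then show "k *\<^sub>C R x + gen (k *\<^sub>C R x) = k *\<^sub>C x" by (simp add: R(2))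
  qed (simp add: dom_simps R(1))
  have scR: "R (r *\<^sub>R x) = r *\<^sub>R R x" for r x using scC[of "complex_of_real r" x] by (simp add: scaleC_of_real)
  have "norm (R x) \<le> norm x" for x using acc[OF R(1), of x] by (simp add: R(2))
  then have "bounded_linear R" by (intro bounded_linear_intro[where K = 1]) (auto simp: add scR)
  then have "bounded_clinear R" using scC by (simp add: bounded_clinear_def)
  then show ?thesis using R left by blast
qed

theorem theorem2p6:
  fixes U :: "complex \<Rightarrow> 'a::complex_banach \<Rightarrow> 'a"
    and V :: "real \<Rightarrow> 'a \<Rightarrow> 'a"
    and A B :: "('a \<times> 'a) set"
    and \<theta> \<alpha> :: real
  assumes "0 < \<theta>" and "\<theta> \<le> pi / 2"
    and "holomorphic_contraction_semigroup \<theta> U"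
    and "A = generator (\<lambda>t. U (complex_of_real t))"
    and "contraction_semigroup V"
    and "B = generator V"
    and "0 \<le> \<alpha>" and "\<alpha> < 1"
    and "Domain (frac_power (\<lambda>t. U (complex_of_real t)) \<alpha>) \<subseteq> Domain B"
    and "Domain (adjoint_op A) \<subseteq> Domain (adjoint_op B)"
  shows "\<exists>W. contraction_semigroup W \<and> generator W = op_sum A B \<and>
    (\<exists>M1>0. \<exists>M2>0. \<exists>M2'>0. \<exists>\<eta>>0. \<forall>t\<ge>0. \<forall>n::nat. n > 2 \<longrightarrow>
      (\<alpha> > 0 \<longrightarrow>
        onorm (\<lambda>x. ((V (t / real n) \<circ> U (complex_of_real (t / real n))) ^^ n) x - W t x)
          \<le> exp (\<eta> * t) * (M1 + M2 * t powr (1 - \<alpha>)) * (ln (real n) / real n powr (1 - \<alpha>))) \<and>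
      (\<alpha> = 0 \<longrightarrow>
        onorm (\<lambda>x. ((V (t / real n) \<circ> U (complex_of_real (t / real n))) ^^ n) x - W t x)
          \<le> exp (\<eta> * t) * (M1 + M2' * t) * (2 * (ln (real n))\<^sup>2 / real n)))"
proof -
  let ?S = "\<lambda>t. U (complex_of_real t)"
  have S: "contraction_semigroup ?S" using assms(3) by (simp add: holomorphic_contraction_semigroup_def)
  interpret A: contraction_sg ?S by standard (rule S)
  interpret B: contraction_sg V by standard (rule assms(5))
  have AG: "A = A.G" and BG: "B = B.G" using assms(4,6) by (simp_all add: A.G_def B.G_def)
  obtain c where c: "0 \<le> c" "\<And>t x. 0 < t \<Longrightarrow> \<exists>y. (?S t x, y) \<in> A.G \<and> norm y \<le> c / t * norm x"
    using analytic_smoothing[OF assms(3)] unfolding A.G_def by blast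
  have "Domain (frac_power ?S \<alpha>) \<subseteq> Domain (generator V)" using assms(9,6) by simp
  from A.relative_bound[OF assms(5,7,8) this]
  obtain K where K: "0 \<le> K" "\<And>x y. (x, y) \<in> A.G \<Longrightarrow> \<exists>z. (x, z) \<in> B.G \<and>
    (\<forall>\<delta>. 0 < \<delta> \<and> \<delta> \<le> 1 \<longrightarrow> norm z \<le> K * (\<delta> powr (1 - \<alpha>) * norm y + \<delta> powr - \<alpha> * norm x))"
    unfolding B.G_def by blast
  \<comment> \<open>From here on holomorphy is present only through the constant \<open>c\<close>,
    and the condition on the fractional power only through \<open>K\<close>.\<close>
  interpret perturbation ?S V \<alpha> c K
  proof
    show "?S t x \<in> A.dom" "norm (A.gen (?S t x)) \<le> c / t * norm x" if "0 < t" for t x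
      using c(2)[OF that, of x] by (auto simp: A.G_iff)
    show "x \<in> B.dom" if "x \<in> A.dom" for x using K(2)[OF A.gen_mem[OF that]] by (auto simp: B.G_iff)
    show "norm (B.gen x) \<le> K * (\<delta> powr (1 - \<alpha>) * norm (A.gen x) + \<delta> powr - \<alpha> * norm x)"
      if "x \<in> A.dom" "0 < \<delta>" "\<delta> \<le> 1" for x \<delta>
      using K(2)[OF A.gen_mem[OF that(1)]] that by (auto simp: B.G_iff)
  qed (use assms(7,8) c K in auto)
  obtain W where W: "contraction_semigroup W" "generator W = C" using sum_generates by blast
  interpret W: contraction_sg W by standard (rule W)
  interpret perturbed_semigroup ?S V W \<alpha> c K by standard (simp add: W.G_def W)
  obtain R where R: "bounded_clinear R" "\<And>x. R x \<in> A.dom" "\<And>x. R x + A.gen (R x) = x"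
    "\<And>x. x \<in> A.dom \<Longrightarrow> R (x + A.gen x) = x"
    using A.resolvent_exists by blast
  \<comment> \<open>The adjoint condition enters here: \<open>R B\<close> is bounded on the domain
    of \<open>B\<close>.\<close>
  have "\<exists>L\<ge>0. \<forall>(x, z)\<in>generator V. norm (R z) \<le> L * norm x"
  proof (rule resolvent_times_bounded[OF S assms(5) _ R(1)])
    show "Domain (adjoint_op (generator ?S)) \<subseteq> Domain (adjoint_op (generator V))" using assms(4,6,10) by simp
    show "R (x + y) = x" if "(x, y) \<in> generator ?S" for x y
      using that R(4) unfolding A.G_def[symmetric] by (auto simp: A.G_iff)
  qed
  then obtain L where L: "0 \<le> L" "\<And>x z. (x, z) \<in> B.G \<Longrightarrow> norm (R z) \<le> L * norm x"
    unfolding B.G_def by blast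
  obtain N where N: "0 \<le> N" "\<And>t x. 0 < t \<Longrightarrow> W t x \<in> A.dom \<and> norm (A.gen (W t x)) \<le> N * (1 + 1 / t) * norm x"
    using W_smooth by blast
  interpret trotter ?S V W \<alpha> c K R L N
  proof (intro trotter.intro trotter_axioms.intro perturbed_semigroup_axioms)
    show "bounded_linear R" using R(1) by (simp add: bounded_clinear_def)
    show "norm (R (B.gen x)) \<le> L * norm x" if "x \<in> B.dom" for x by (rule L(2)[OF B.gen_mem[OF that]])
  qed (use R(2-) L(1) N in auto)
  have F: "V \<tau> \<circ> ?S \<tau> = F \<tau>" for \<tau> by (auto simp: F_def)
  have "generator W = op_sum A B" using W by (simp add: C_def AG BG)
  with W(1) trotter_convergence[folded F] show ?thesis by (intro exI[of _ W] conjI)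
qed

end
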